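(* Let $A$ be a dg algebra with graded-commutative cohomology ring $H^*A$ and let $\mathfrak p$ be a graded prime ideal of $H^*A$. If a graded $H^*A$-module $X$ is realisable, then $X_{\mathfrak p}$ is realisable; and if $X$ is strictly realisable, then $X_{\mathfrak p}$ is strictly realisable.
   Context: Graded means $\mathbb Z$-graded; modules are right modules. A dg algebra $A$ (over a commutative ring $k$) is a graded $k$-algebra with a $k$-linear differential of degree $+1$ satisfying the Leibniz rule; $\mathcal D(A)$ is the derived category of dg $A$-modules. A graded $H^*A$-module $X$ is realisable if it is isomorphic to a direct summand of $H^*M$ for some $M\in\mathcal D(A)$, and strictly realisable if $X\cong H^*M$ for some $M\in\mathcal D(A)$. A graded ring is graded-commutative if $rs=(-1)^{|r||s|}sr$ for homogeneous $r,s$; a prime ideal is a proper ideal with $ab\in\mathfrak p\Rightarrow a\in\mathfrak p$ or $b\in\mathfrak p$. $X_{\mathfrak p}=X\otimes_{H^*A}(H^*A)_{\mathfrak p}$ is the localisation obtained by inverting the even-degree homogeneous elements outside $\mathfrak p$, regarded as a graded $H^*A$-module. *)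

theory Defs
  imports "HOL-Algebra.Module" "HOL-Algebra.QuotRing"
begin

section \<open>Gradings\<close>

text \<open>
  Graded objects are total objects (abelian groups, rings, modules) together with an
  internal direct sum decomposition indexed by the integers.  In an additive structure that is
  only an abelian group or a module, the inherited fields \<open>mult\<close> and \<open>one\<close> of the \<open>ring\<close> record
  carry no meaning (the convention of \<open>HOL-Algebra.Module\<close>).
\<close>

definition hom_decomp ::
  "('a, 'z) ring_scheme \<Rightarrow> (int \<Rightarrow> 'a set) \<Rightarrow> 'a \<Rightarrow> (int \<Rightarrow> 'a) \<Rightarrow> bool" where
  "hom_decomp G D x f \<longleftrightarrow>
     (\<forall>n. f n \<in> D n) \<and> finite {n. f n \<noteq> \<zero>\<^bsub>G\<^esub>} \<and>
     x = (\<Oplus>\<^bsub>G\<^esub>n\<in>{n. f n \<noteq> \<zero>\<^bsub>G\<^esub>}. f n)"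

definition grading :: "('a, 'z) ring_scheme \<Rightarrow> (int \<Rightarrow> 'a set) \<Rightarrow> bool" where
  "grading G D \<longleftrightarrow>
     (\<forall>n. additive_subgroup (D n) G) \<and> (\<forall>x\<in>carrier G. \<exists>!f. hom_decomp G D x f)"

text \<open>Every element of \<open>U\<close> is a finite sum of homogeneous elements of \<open>U\<close>.\<close>

definition homogeneous_subset ::
  "('a, 'z) ring_scheme \<Rightarrow> (int \<Rightarrow> 'a set) \<Rightarrow> 'a set \<Rightarrow> bool" where
  "homogeneous_subset G D U \<longleftrightarrow> (\<forall>x\<in>U. \<exists>f. hom_decomp G (\<lambda>n. D n \<inter> U) x f)"

definition ksign :: "('a, 'z) ring_scheme \<Rightarrow> int \<Rightarrow> 'a \<Rightarrow> 'a" where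
  "ksign G n x = (if even n then x else \<ominus>\<^bsub>G\<^esub> x)" \<comment> \<open>\<open>(-1)\<close> to the power \<open>n\<close>, times \<open>x\<close>\<close>


section \<open>Graded rings and graded right modules\<close>

record 'a graded_ring = "'a ring" +
  rdeg :: "int \<Rightarrow> 'a set"

record ('r, 'm) graded_module = "'m ring" +
  ract :: "'m \<Rightarrow> 'r \<Rightarrow> 'm"  (infixl \<open>\<triangleleft>\<index>\<close> 70)
  mdeg :: "int \<Rightarrow> 'm set"

definition graded_commutative :: "('a, 'z) graded_ring_scheme \<Rightarrow> bool" where
  "graded_commutative R \<longleftrightarrow>
     (\<forall>i j. \<forall>r\<in>rdeg R i. \<forall>s\<in>rdeg R j. r \<otimes>\<^bsub>R\<^esub> s = ksign R (i * j) (s \<otimes>\<^bsub>R\<^esub> r))"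

text \<open>
  The library's \<open>primeideal\<close> presupposes a commutative ring, so it does not apply to
  graded-commutative rings.
\<close>

definition graded_prime_ideal :: "'a set \<Rightarrow> ('a, 'z) graded_ring_scheme \<Rightarrow> bool" where
  "graded_prime_ideal P R \<longleftrightarrow>
     ideal P R \<and> homogeneous_subset R (rdeg R) P \<and> P \<noteq> carrier R \<and>
     (\<forall>a\<in>carrier R. \<forall>b\<in>carrier R. a \<otimes>\<^bsub>R\<^esub> b \<in> P \<longrightarrow> a \<in> P \<or> b \<in> P)"

locale graded_right_module = R?: ring R + M?: abelian_group M
  for R (structure) and M (structure) and D :: "int \<Rightarrow> 'a set" \<comment> \<open>the grading of \<open>R\<close>\<close> +
  assumes ract_closed: "\<lbrakk>x \<in> carrier M; a \<in> carrier R\<rbrakk> \<Longrightarrow> x \<triangleleft>\<^bsub>M\<^esub> a \<in> carrier M"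
    and ract_l_distr: "\<lbrakk>x \<in> carrier M; y \<in> carrier M; a \<in> carrier R\<rbrakk>
      \<Longrightarrow> (x \<oplus>\<^bsub>M\<^esub> y) \<triangleleft>\<^bsub>M\<^esub> a = x \<triangleleft>\<^bsub>M\<^esub> a \<oplus>\<^bsub>M\<^esub> y \<triangleleft>\<^bsub>M\<^esub> a"
    and ract_r_distr: "\<lbrakk>x \<in> carrier M; a \<in> carrier R; b \<in> carrier R\<rbrakk>
      \<Longrightarrow> x \<triangleleft>\<^bsub>M\<^esub> (a \<oplus>\<^bsub>R\<^esub> b) = x \<triangleleft>\<^bsub>M\<^esub> a \<oplus>\<^bsub>M\<^esub> x \<triangleleft>\<^bsub>M\<^esub> b"
    and ract_assoc: "\<lbrakk>x \<in> carrier M; a \<in> carrier R; b \<in> carrier R\<rbrakk>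
      \<Longrightarrow> x \<triangleleft>\<^bsub>M\<^esub> (a \<otimes>\<^bsub>R\<^esub> b) = x \<triangleleft>\<^bsub>M\<^esub> a \<triangleleft>\<^bsub>M\<^esub> b"
    and ract_one: "x \<in> carrier M \<Longrightarrow> x \<triangleleft>\<^bsub>M\<^esub> \<one>\<^bsub>R\<^esub> = x"
    and mdeg_grading: "grading M (mdeg M)"
    and ract_mdeg: "\<lbrakk>x \<in> mdeg M i; a \<in> D j\<rbrakk> \<Longrightarrow> x \<triangleleft>\<^bsub>M\<^esub> a \<in> mdeg M (i + j)"

definition is_graded_module ::
  "('r, 'z) graded_ring_scheme \<Rightarrow> ('r, 'm, 'y) graded_module_scheme \<Rightarrow> bool" where
  "is_graded_module R M \<longleftrightarrow> graded_right_module R M (rdeg R)"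

definition graded_iso ::
  "('r, 'z) graded_ring_scheme \<Rightarrow> ('r, 'm, 'y) graded_module_scheme \<Rightarrow>
   ('r, 'n, 'w) graded_module_scheme \<Rightarrow> ('m \<Rightarrow> 'n) set" where
  "graded_iso R M N = {f. bij_betw f (carrier M) (carrier N) \<and>
     (\<forall>x\<in>carrier M. \<forall>y\<in>carrier M. f (x \<oplus>\<^bsub>M\<^esub> y) = f x \<oplus>\<^bsub>N\<^esub> f y) \<and>
     (\<forall>x\<in>carrier M. \<forall>a\<in>carrier R. f (x \<triangleleft>\<^bsub>M\<^esub> a) = f x \<triangleleft>\<^bsub>N\<^esub> a) \<and>
     (\<forall>n. f ` mdeg M n = mdeg N n)}"

definition graded_isomorphic ::
  "('r, 'z) graded_ring_scheme \<Rightarrow> ('r, 'm, 'y) graded_module_scheme \<Rightarrow>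
   ('r, 'n, 'w) graded_module_scheme \<Rightarrow> bool" where
  "graded_isomorphic R M N \<longleftrightarrow> graded_iso R M N \<noteq> {}"

definition graded_submodule ::
  "('r, 'z) graded_ring_scheme \<Rightarrow> ('r, 'm, 'y) graded_module_scheme \<Rightarrow> 'm set \<Rightarrow> bool" where
  "graded_submodule R M U \<longleftrightarrow>
     additive_subgroup U M \<and> (\<forall>x\<in>U. \<forall>a\<in>carrier R. x \<triangleleft>\<^bsub>M\<^esub> a \<in> U) \<and>
     homogeneous_subset M (mdeg M) U"

definition restrict_module ::
  "('r, 'm) graded_module \<Rightarrow> 'm set \<Rightarrow> ('r, 'm) graded_module" where
  "restrict_module M U = M\<lparr>carrier := U, mdeg := \<lambda>n. mdeg M n \<inter> U\<rparr>"

definition direct_summand ::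
  "('r, 'z) graded_ring_scheme \<Rightarrow> ('r, 'm, 'y) graded_module_scheme \<Rightarrow> 'm set \<Rightarrow> bool" where
  "direct_summand R M U \<longleftrightarrow> graded_submodule R M U \<and>
     (\<exists>V. graded_submodule R M V \<and> U \<inter> V = {\<zero>\<^bsub>M\<^esub>} \<and> U <+>\<^bsub>M\<^esub> V = carrier M)"


section \<open>Dg algebras and dg modules\<close>

record ('k, 'a) dg_algebra = "('k, 'a) module" +
  adeg :: "int \<Rightarrow> 'a set"
  adiff :: "'a \<Rightarrow> 'a"

record ('a, 'm) dg_module = "('a, 'm) graded_module" +
  mdiff :: "'m \<Rightarrow> 'm"

locale dg_algebra = M?: module K A + A?: ring A for K (structure) and A (structure) +
  assumes smult_mult_left: "\<lbrakk>c \<in> carrier K; a \<in> carrier A; b \<in> carrier A\<rbrakk>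
      \<Longrightarrow> (c \<odot>\<^bsub>A\<^esub> a) \<otimes>\<^bsub>A\<^esub> b = c \<odot>\<^bsub>A\<^esub> (a \<otimes>\<^bsub>A\<^esub> b)"
    and smult_mult_right: "\<lbrakk>c \<in> carrier K; a \<in> carrier A; b \<in> carrier A\<rbrakk>
      \<Longrightarrow> a \<otimes>\<^bsub>A\<^esub> (c \<odot>\<^bsub>A\<^esub> b) = c \<odot>\<^bsub>A\<^esub> (a \<otimes>\<^bsub>A\<^esub> b)"
    and adeg_grading: "grading A (adeg A)"
    and smult_adeg: "\<lbrakk>c \<in> carrier K; a \<in> adeg A n\<rbrakk> \<Longrightarrow> c \<odot>\<^bsub>A\<^esub> a \<in> adeg A n"
    and one_adeg: "\<one>\<^bsub>A\<^esub> \<in> adeg A 0"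
    and mult_adeg: "\<lbrakk>a \<in> adeg A i; b \<in> adeg A j\<rbrakk> \<Longrightarrow> a \<otimes>\<^bsub>A\<^esub> b \<in> adeg A (i + j)"
    and adiff_closed: "a \<in> carrier A \<Longrightarrow> adiff A a \<in> carrier A"
    and adiff_add: "\<lbrakk>a \<in> carrier A; b \<in> carrier A\<rbrakk>
      \<Longrightarrow> adiff A (a \<oplus>\<^bsub>A\<^esub> b) = adiff A a \<oplus>\<^bsub>A\<^esub> adiff A b"
    and adiff_smult: "\<lbrakk>c \<in> carrier K; a \<in> carrier A\<rbrakk>
      \<Longrightarrow> adiff A (c \<odot>\<^bsub>A\<^esub> a) = c \<odot>\<^bsub>A\<^esub> adiff A a"
    and adiff_adeg: "a \<in> adeg A n \<Longrightarrow> adiff A a \<in> adeg A (n + 1)"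
    and adiff_adiff: "a \<in> carrier A \<Longrightarrow> adiff A (adiff A a) = \<zero>\<^bsub>A\<^esub>"
    and leibniz: "\<lbrakk>a \<in> adeg A n; b \<in> carrier A\<rbrakk> \<Longrightarrow>
      adiff A (a \<otimes>\<^bsub>A\<^esub> b) = adiff A a \<otimes>\<^bsub>A\<^esub> b \<oplus>\<^bsub>A\<^esub> ksign A n (a \<otimes>\<^bsub>A\<^esub> adiff A b)"

text \<open>
  Dg right modules.  The action of the ground ring is the one induced along the unit map of \<open>A\<close>
  (\<open>x c\<close> is \<open>x\<close> acted on by \<open>c \<odot> \<one>\<close>, a cocycle of degree 0), so it is not part of the data, and
  linearity of the differential over the ground ring follows from the Leibniz rule.
\<close>

locale dg_right_module = graded_right_module A M "adeg A" for A (structure) and M (structure) +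
  assumes mdiff_closed: "x \<in> carrier M \<Longrightarrow> mdiff M x \<in> carrier M"
    and mdiff_add: "\<lbrakk>x \<in> carrier M; y \<in> carrier M\<rbrakk>
      \<Longrightarrow> mdiff M (x \<oplus>\<^bsub>M\<^esub> y) = mdiff M x \<oplus>\<^bsub>M\<^esub> mdiff M y"
    and mdiff_mdeg: "x \<in> mdeg M n \<Longrightarrow> mdiff M x \<in> mdeg M (n + 1)"
    and mdiff_mdiff: "x \<in> carrier M \<Longrightarrow> mdiff M (mdiff M x) = \<zero>\<^bsub>M\<^esub>"
    and mleibniz: "\<lbrakk>x \<in> mdeg M n; a \<in> carrier A\<rbrakk> \<Longrightarrow>
      mdiff M (x \<triangleleft>\<^bsub>M\<^esub> a) = mdiff M x \<triangleleft>\<^bsub>M\<^esub> a \<oplus>\<^bsub>M\<^esub> ksign M n (x \<triangleleft>\<^bsub>M\<^esub> adiff A a)"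


section \<open>Cohomology\<close>

definition cocycles :: "('a, 'z) ring_scheme \<Rightarrow> ('a \<Rightarrow> 'a) \<Rightarrow> 'a set" where
  "cocycles G d = {x \<in> carrier G. d x = \<zero>\<^bsub>G\<^esub>}"

definition coboundaries :: "('a, 'z) ring_scheme \<Rightarrow> ('a \<Rightarrow> 'a) \<Rightarrow> 'a set" where
  "coboundaries G d = d ` carrier G"

definition cohom_ring :: "('k, 'a) dg_algebra \<Rightarrow> 'a set graded_ring" where
  "cohom_ring A =
     (let Z = cocycles A (adiff A); B = coboundaries A (adiff A)
      in ring.extend (A\<lparr>carrier := Z\<rparr> Quot B)
           (graded_ring.fields (\<lambda>n. (\<lambda>z. B +>\<^bsub>A\<^esub> z) ` (Z \<inter> adeg A n))))"

text \<open>
  Only the additive part of the quotient of \<open>M\<close> is meaningful; the class of \<open>z\<close> acted on by the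
  class of \<open>a\<close> is the class of \<open>z \<triangleleft> a\<close>, phrased on cosets as in \<open>rcoset_mult\<close>.
\<close>

definition cohom_module :: "('a, 'm) dg_module \<Rightarrow> ('a set, 'm set) graded_module" where
  "cohom_module M =
     (let Z = cocycles M (mdiff M); B = coboundaries M (mdiff M)
      in ring.extend (M\<lparr>carrier := Z\<rparr> Quot B)
           (graded_module.fields
              (\<lambda>\<xi> \<alpha>. \<Union>z\<in>\<xi>. \<Union>a\<in>\<alpha>. B +>\<^bsub>M\<^esub> (z \<triangleleft>\<^bsub>M\<^esub> a))
              (\<lambda>n. (\<lambda>z. B +>\<^bsub>M\<^esub> z) ` (Z \<inter> mdeg M n))))"


section \<open>Realisability\<close>

text \<open>
  An object of the derived category of \<open>A\<close> is a dg \<open>A\<close>-module.  The type argument says in which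
  type the elements of that dg module are drawn; HOL has no quantification over types, so
  ``for some \<open>M\<close>'' has to be read relative to it.
\<close>

definition strictly_realisable ::
  "'m itself \<Rightarrow> ('k, 'a) dg_algebra \<Rightarrow> ('a set, 'x) graded_module \<Rightarrow> bool" where
  "strictly_realisable _ A X \<longleftrightarrow>
     (\<exists>M :: ('a, 'm) dg_module. dg_right_module A M \<and>
        graded_isomorphic (cohom_ring A) X (cohom_module M))"

definition realisable ::
  "'m itself \<Rightarrow> ('k, 'a) dg_algebra \<Rightarrow> ('a set, 'x) graded_module \<Rightarrow> bool" where
  "realisable _ A X \<longleftrightarrow>
     (\<exists>(M :: ('a, 'm) dg_module) U. dg_right_module A M \<and>
        direct_summand (cohom_ring A) (cohom_module M) U \<and>
        graded_isomorphic (cohom_ring A) X (restrict_module (cohom_module M) U))"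


section \<open>Localisation\<close>

definition even_complement :: "('r, 'z) graded_ring_scheme \<Rightarrow> 'r set \<Rightarrow> 'r set" where
  "even_complement R P = (\<Union>n\<in>{n. even n}. rdeg R n) - P"

text \<open>
  The fraction \<open>x / s\<close>, as the set of all pairs equivalent to \<open>(x, s)\<close>.  In a graded-commutative
  ring even homogeneous elements are central, so the usual module of fractions (equivalently, the
  tensor product with the localised ring) makes sense; \<open>x / s\<close> has degree \<open>|x| - |s|\<close>.
\<close>

definition fraction ::
  "('r, 'x, 'y) graded_module_scheme \<Rightarrow> 'r set \<Rightarrow> 'x \<Rightarrow> 'r \<Rightarrow> ('x \<times> 'r) set" where
  "fraction X S x s =
     {(y, t). y \<in> carrier X \<and> t \<in> S \<and> (\<exists>u\<in>S. x \<triangleleft>\<^bsub>X\<^esub> t \<triangleleft>\<^bsub>X\<^esub> u = y \<triangleleft>\<^bsub>X\<^esub> s \<triangleleft>\<^bsub>X\<^esub> u)}"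

definition localise ::
  "('r, 'z) graded_ring_scheme \<Rightarrow> 'r set \<Rightarrow> ('r, 'x, 'y) graded_module_scheme \<Rightarrow>
   ('r, ('x \<times> 'r) set) graded_module" where
  "localise R P X =
     (let S = even_complement R P
      in \<lparr>carrier = {fraction X S x s | x s. x \<in> carrier X \<and> s \<in> S},
          mult = (\<lambda>_ _. {}), one = {},
          zero = fraction X S \<zero>\<^bsub>X\<^esub> \<one>\<^bsub>R\<^esub>,
          add = (\<lambda>\<xi> \<eta>. \<Union>(x, s)\<in>\<xi>. \<Union>(y, t)\<in>\<eta>.
                   fraction X S (x \<triangleleft>\<^bsub>X\<^esub> t \<oplus>\<^bsub>X\<^esub> y \<triangleleft>\<^bsub>X\<^esub> s) (s \<otimes>\<^bsub>R\<^esub> t)),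
          ract = (\<lambda>\<xi> r. \<Union>(x, s)\<in>\<xi>. fraction X S (x \<triangleleft>\<^bsub>X\<^esub> r) s),
          mdeg = (\<lambda>n. {fraction X S x s | x s i j.
                   x \<in> mdeg X i \<and> s \<in> S \<and> s \<in> rdeg R j \<and> n = i - j})\<rparr>)"

end

theory Submission
  imports Defs "HOL-Library.Countable"
begin

text \<open>
  The assertion is a form of Bousfield localisation.  Only \<open>H\<^sup>*A\<close> is graded-commutative, so elements
  of \<open>A\<close> cannot be inverted directly, but left multiplication by a cocycle \<open>a\<close> is a map of right
  modules from \<open>A\<close> to \<open>A\<close>.  Let \<open>S\<close> be the set of cocycles of even degree whose class is not in \<open>P\<close>.
  The cone of left multiplication by \<open>a\<close> in \<open>S\<close> has two generators; a map from a shift of this cone to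
  a dg module \<open>N\<close> is a pair \<open>(z, v)\<close> with \<open>d z = 0\<close> and \<open>d v = z a\<close>, and it becomes null-homotopic
  as soon as there are \<open>e\<close> and \<open>f\<close> with \<open>d e = z\<close> and \<open>d f = v - e a\<close>.  If this is so for all triples
  \<open>(z, v, a)\<close>, then every \<open>a\<close> in \<open>S\<close> acts bijectively on \<open>H\<^sup>*N\<close>: the triples with given \<open>z\<close> show
  injectivity, and those with \<open>z = 0\<close>, where \<open>v\<close> is any cocycle, show surjectivity.
  
  So, given \<open>M\<close>, such \<open>e\<close> and \<open>f\<close> are adjoined freely for all triples in \<open>M\<close>, then for all triples in
  the module just obtained, and so on; the union \<open>\<Omega>\<close> has the property above.
  The key point is that adjoining one pair \<open>(e, f)\<close> leaves the localised cohomology unchanged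
  (lemma \<open>cell_detach\<close>): if \<open>x = n + e \<alpha> + f \<beta>\<close> has its differential in the smaller module, then
  \<open>x a a\<close> differs from an element of the smaller module by a coboundary.  This is where \<open>a\<close> has
  to be central in cohomology.  By induction along the tower every \<open>x\<close> in \<open>\<Omega>\<close> with \<open>d x\<close> in \<open>M\<close> has a
  multiple \<open>x b\<close>, with \<open>b\<close> in \<open>S\<close>, that is cohomologous to an element of \<open>M\<close>; applied to cocycles, and to
  elements bounding a cocycle of \<open>M\<close>, this says that \<open>H\<^sup>*M \<rightarrow> H\<^sup>*\<Omega>\<close> has torsion cokernel and kernel.
  
  A map of graded modules with these properties is a localisation (locale \<open>localisation_map\<close>), and then
  the fraction \<open>x / s\<close> corresponds to the unique \<open>y\<close> with \<open>y s = x\<close>.  If \<open>X\<close> is a submodule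
  \<open>U\<close> of \<open>H\<^sup>*M\<close>, the localisation of \<open>X\<close> becomes the saturation of \<open>U\<close>, that is, the set of all \<open>y\<close>
  some multiple of which comes from \<open>U\<close>; saturation preserves complements, and the saturation of
  \<open>H\<^sup>*M\<close> itself is \<open>H\<^sup>*\<Omega>\<close>.  This gives both halves of the theorem at once.
  
  Finally the elements of \<open>\<Omega>\<close> have to be drawn from the required type.  An adjoined pair is named by the
  triple it was adjoined for, and the elements in that triple are finite combinations of earlier
  generators; hence the names form a datatype, whose members can be written as words in letters
  from \<open>M\<close> and \<open>A\<close>.
\<close>

section \<open>Gradings and homogeneous components\<close>

lemma abelian_group_homI_add:
  assumes "abelian_group G" "abelian_group H"
    and "\<And>x. x \<in> carrier G \<Longrightarrow> h x \<in> carrier H"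
    and "\<And>x y. \<lbrakk>x \<in> carrier G; y \<in> carrier G\<rbrakk> \<Longrightarrow> h (x \<oplus>\<^bsub>G\<^esub> y) = h x \<oplus>\<^bsub>H\<^esub> h y"
  shows "abelian_group_hom G H h"
  using assms
  by (intro abelian_group_homI group_hom.intro group_hom_axioms.intro)
     (auto intro: abelian_group.a_group simp: hom_def)

lemma (in abelian_group_hom) hom_finsum:
  assumes "f \<in> I \<rightarrow> carrier G"
  shows "h (finsum G f I) = finsum H (\<lambda>i. h (f i)) I"
  using assms
proof (induction I rule: infinite_finite_induct)
  case (infinite I)
  then show ?case by (simp add: G.finsum_infinite H.finsum_infinite)
next
  case (insert i I)
  then show ?case by (auto simp: Pi_def)
qed simp

lemma (in abelian_group) minus_zero_iff:
  assumes "x \<in> carrier G" "y \<in> carrier G"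
  shows "x \<ominus> y = \<zero> \<longleftrightarrow> x = y"
  using assms by (metis a_minus_def a_inv_closed minus_equality minus_minus r_neg)

lemma (in abelian_group) finsum_support:
  assumes "finite J" "{i. f i \<noteq> \<zero>} \<subseteq> J" "f \<in> J \<rightarrow> carrier G"
  shows "finsum G f {i. f i \<noteq> \<zero>} = finsum G f J"
  using assms by (intro add.finprod_mono_neutral_cong_left) auto

lemma (in abelian_group) additive_subgroupI_add:
  assumes "B \<subseteq> carrier G" "\<zero> \<in> B"
    and "\<And>x y. \<lbrakk>x \<in> B; y \<in> B\<rbrakk> \<Longrightarrow> x \<oplus> y \<in> B" "\<And>x. x \<in> B \<Longrightarrow> \<ominus> x \<in> B"
  shows "additive_subgroup B G"
  using assms by (intro additive_subgroup.intro add.subgroupI) auto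

lemma (in additive_subgroup) finsum_in_subgroup:
  assumes "abelian_group G" "f \<in> I \<rightarrow> H"
  shows "finsum G f I \<in> H"
proof -
  interpret abelian_group G by fact
  show ?thesis using assms(2)
  proof (induction I rule: infinite_finite_induct)
    case (infinite I)
    then show ?case by (simp add: finsum_infinite)
  next
    case (insert i I)
    moreover have "f \<in> I \<rightarrow> carrier G" "f i \<in> carrier G" using insert a_subset by auto
    ultimately show ?case by (auto simp: Pi_def)
  qed simp
qed

locale graded_group = abelian_group G for G (structure) +
  fixes D :: "int \<Rightarrow> 'a set"
  assumes grading: "grading G D"

definition component :: "('a, 'z) ring_scheme \<Rightarrow> (int \<Rightarrow> 'a set) \<Rightarrow> int \<Rightarrow> 'a \<Rightarrow> 'a" where
  "component G D n x = (THE f. hom_decomp G D x f) n"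

context graded_group
begin

abbreviation "cp \<equiv> component G D"

lemma degree_subgroup: "additive_subgroup (D n) G"
  using grading by (simp add: grading_def)

lemma degree_carrier: "x \<in> D n \<Longrightarrow> x \<in> carrier G"
  using additive_subgroup.a_subset[OF degree_subgroup] by blast

lemma degree_zero [simp]: "\<zero> \<in> D n"
  by (rule additive_subgroup.zero_closed[OF degree_subgroup])

lemma degree_add: "x \<in> D n \<Longrightarrow> y \<in> D n \<Longrightarrow> x \<oplus> y \<in> D n"
  by (rule additive_subgroup.a_closed[OF degree_subgroup])

lemma degree_neg: "x \<in> D n \<Longrightarrow> \<ominus> x \<in> D n"
  by (rule additive_subgroup.a_inv_closed[OF degree_subgroup])

lemma degree_minus: "x \<in> D n \<Longrightarrow> y \<in> D n \<Longrightarrow> x \<ominus> y \<in> D n"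
  by (simp add: a_minus_def degree_add degree_neg)

lemma hom_decomp_component:
  assumes "x \<in> carrier G" shows "hom_decomp G D x (\<lambda>n. cp n x)"
proof -
  have "\<exists>!f. hom_decomp G D x f" using grading assms by (simp add: grading_def)
  from theI'[OF this] show ?thesis by (simp add: component_def)
qed

lemma component_unique:
  assumes "hom_decomp G D x f" "x \<in> carrier G" shows "cp n x = f n"
proof -
  have "\<exists>!f. hom_decomp G D x f" using grading assms by (simp add: grading_def)
  with assms(1) show ?thesis by (simp add: component_def the1_equality)
qed

lemma component_degree: "x \<in> carrier G \<Longrightarrow> cp n x \<in> D n"
  and component_finite: "x \<in> carrier G \<Longrightarrow> finite {n. cp n x \<noteq> \<zero>}"
  and component_sum: "x \<in> carrier G \<Longrightarrow> x = (\<Oplus>n\<in>{n. cp n x \<noteq> \<zero>}. cp n x)"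
  using hom_decomp_component unfolding hom_decomp_def by blast+

lemma component_closed [simp]: "x \<in> carrier G \<Longrightarrow> cp n x \<in> carrier G"
  using component_degree degree_carrier by blast

lemma component_sum_over:
  assumes "x \<in> carrier G" "finite J" "{n. cp n x \<noteq> \<zero>} \<subseteq> J"
  shows "x = (\<Oplus>n\<in>J. cp n x)"
proof -
  have "x = (\<Oplus>n\<in>{n. cp n x \<noteq> \<zero>}. cp n x)" by (rule component_sum[OF assms(1)])
  also have "\<dots> = (\<Oplus>n\<in>J. cp n x)"
    using assms by (intro finsum_support) auto
  finally show ?thesis .
qed

lemma hom_decompI:
  assumes "\<And>n. f n \<in> D n" "finite J" "{n. f n \<noteq> \<zero>} \<subseteq> J" "x = (\<Oplus>n\<in>J. f n)"
  shows "hom_decomp G D x f"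
proof -
  have "(\<Oplus>n\<in>{n. f n \<noteq> \<zero>}. f n) = (\<Oplus>n\<in>J. f n)"
    using assms degree_carrier by (intro finsum_support) auto
  then show ?thesis unfolding hom_decomp_def using assms finite_subset by auto
qed

lemma component_of_degree:
  assumes "x \<in> D n" shows "cp m x = (if m = n then x else \<zero>)"
proof (rule component_unique[where f = "\<lambda>m. if m = n then x else \<zero>"])
  show "hom_decomp G D x (\<lambda>m. if m = n then x else \<zero>)"
    using assms degree_carrier by (intro hom_decompI[where J = "{n}"]) auto
  show "x \<in> carrier G" using assms degree_carrier by blast
qed

lemma component_add:
  assumes x: "x \<in> carrier G" and y: "y \<in> carrier G"
  shows "cp n (x \<oplus> y) = cp n x \<oplus> cp n y"
proof -
  let ?J = "{n. cp n x \<noteq> \<zero>} \<union> {n. cp n y \<noteq> \<zero>}"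
  have fin: "finite ?J" using component_finite x y by blast
  have "x \<oplus> y = (\<Oplus>n\<in>?J. cp n x) \<oplus> (\<Oplus>n\<in>?J. cp n y)"
    using component_sum_over[OF x fin] component_sum_over[OF y fin] by force
  also have "\<dots> = (\<Oplus>n\<in>?J. cp n x \<oplus> cp n y)"
    using x y by (intro finsum_addf[symmetric]) auto
  finally have eq: "x \<oplus> y = (\<Oplus>n\<in>?J. cp n x \<oplus> cp n y)" .
  have "hom_decomp G D (x \<oplus> y) (\<lambda>n. cp n x \<oplus> cp n y)"
    using x y by (intro hom_decompI[OF _ fin _ eq]) (auto simp: degree_add component_degree)
  from component_unique[OF this] show ?thesis using x y by simp
qed

lemma component_hom: "abelian_group_hom G G (cp n)"
  by (rule abelian_group_homI_add) (auto simp: component_add abelian_group_axioms)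

lemma component_zero [simp]: "cp n \<zero> = \<zero>"
  by (rule abelian_group_hom.hom_zero[OF component_hom])

lemma component_neg: "x \<in> carrier G \<Longrightarrow> cp n (\<ominus> x) = \<ominus> cp n x"
  by (rule abelian_group_hom.hom_a_inv[OF component_hom])

lemma component_minus:
  "x \<in> carrier G \<Longrightarrow> y \<in> carrier G \<Longrightarrow> cp n (x \<ominus> y) = cp n x \<ominus> cp n y"
  by (simp add: a_minus_def component_add component_neg)

lemma in_subgroup_by_components:
  assumes "additive_subgroup B G" "x \<in> carrier G" "\<And>n. cp n x \<in> B"
  shows "x \<in> B"
proof -
  have "(\<Oplus>n\<in>{n. cp n x \<noteq> \<zero>}. cp n x) \<in> B"
    by (rule additive_subgroup.finsum_in_subgroup[OF assms(1) abelian_group_axioms])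
       (use assms in auto)
  then show ?thesis using component_sum[OF assms(2)] by simp
qed

lemma zero_by_components:
  assumes "x \<in> carrier G" "\<And>n. cp n x = \<zero>" shows "x = \<zero>"
  using component_sum[OF assms(1)] assms(2) by simp

lemma degree_by_components:
  assumes "x \<in> carrier G" "\<And>m. m \<noteq> n \<Longrightarrow> cp m x = \<zero>" shows "x \<in> D n"
proof (rule in_subgroup_by_components[OF degree_subgroup assms(1)])
  fix m show "cp m x \<in> D n" using assms component_degree by (cases "m = n") auto
qed

end

text \<open>
  Stated for maps of any degree \<open>k\<close>, as it is used for differentials, for the action of a homogeneous
  element and for maps of modules.
\<close>

lemma component_natural:
  assumes G: "graded_group G D" and H: "graded_group H E" and h: "abelian_group_hom G H h"
    and deg: "\<And>n x. x \<in> D n \<Longrightarrow> h x \<in> E (n + k)" and x: "x \<in> carrier G"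
  shows "component H E (n + k) (h x) = h (component G D n x)"
proof -
  interpret G: graded_group G D by fact
  interpret H: graded_group H E by fact
  interpret h: abelian_group_hom G H h by fact
  let ?J = "{n. component G D n x \<noteq> \<zero>\<^bsub>G\<^esub>}"
  let ?f = "\<lambda>m. h (component G D (m - k) x)"
  have eq: "h x = finsum H ?f ((\<lambda>n. n + k) ` ?J)"
  proof -
    have "h x = h (finsum G (\<lambda>n. component G D n x) ?J)" using G.component_sum[OF x] by simp
    also have "\<dots> = finsum H (\<lambda>n. h (component G D n x)) ?J"
      using x by (intro h.hom_finsum) auto
    also have "\<dots> = finsum H ?f ((\<lambda>n. n + k) ` ?J)"
      using x by (subst H.finsum_reindex) (auto simp: inj_on_def)
    finally show ?thesis .
  qed
  have "hom_decomp H E (h x) ?f"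
  proof (rule H.hom_decompI[OF _ _ _ eq])
    show "?f m \<in> E m" for m using deg[OF G.component_degree[OF x], of "m - k"] by simp
    show "finite ((\<lambda>n. n + k) ` ?J)" using G.component_finite[OF x] by simp
    show "{m. ?f m \<noteq> \<zero>\<^bsub>H\<^esub>} \<subseteq> (\<lambda>n. n + k) ` ?J"
    proof
      fix m assume "m \<in> {m. ?f m \<noteq> \<zero>\<^bsub>H\<^esub>}"
      then have "m - k \<in> ?J" by auto
      then show "m \<in> (\<lambda>n. n + k) ` ?J" by (intro image_eqI[of _ _ "m - k"]) auto
    qed
  qed
  from H.component_unique[OF this] show ?thesis using x by simp
qed

text \<open>
  Conversely, a family of additive projections determines a grading.  This avoids manipulating
  direct sums: for cohomology and for free extensions the projections are evident, whereas writing
  down the decomposition of an element is not.  Existence of the decomposition holds because the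
  difference between \<open>x\<close> and the sum of its projections has all projections zero.
\<close>

lemma (in abelian_group) graded_groupI:
  assumes sub: "\<And>n. additive_subgroup (D n) G"
    and hom: "\<And>n. abelian_group_hom G G (p n)"
    and deg: "\<And>n x. x \<in> carrier G \<Longrightarrow> p n x \<in> D n"
    and fin: "\<And>x. x \<in> carrier G \<Longrightarrow> finite {n. p n x \<noteq> \<zero>}"
    and proj: "\<And>m n x. x \<in> D n \<Longrightarrow> p m x = (if m = n then x else \<zero>)"
    and zero: "\<And>x. \<lbrakk>x \<in> carrier G; \<And>n. p n x = \<zero>\<rbrakk> \<Longrightarrow> x = \<zero>"
  shows "graded_group G D"
proof (unfold_locales, unfold grading_def, intro conjI allI ballI)
  have DG: "x \<in> D n \<Longrightarrow> x \<in> carrier G" for x n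
    using additive_subgroup.a_subset[OF sub] by blast
  fix x assume x: "x \<in> carrier G"
  have p_sum: "p m (\<Oplus>n\<in>{n. f n \<noteq> \<zero>}. f n) = f m"
    if f: "\<And>n. f n \<in> D n" and ff: "finite {n. f n \<noteq> \<zero>}" for f m
  proof -
    interpret abelian_group_hom G G "p m" by (rule hom)
    have fG: "f n \<in> carrier G" for n using f DG by blast
    have "p m (\<Oplus>n\<in>{n. f n \<noteq> \<zero>}. f n) = (\<Oplus>n\<in>{n. f n \<noteq> \<zero>}. p m (f n))"
      using fG by (intro hom_finsum) auto
    also have "\<dots> = (\<Oplus>n\<in>{n. f n \<noteq> \<zero>}. if m = n then f n else \<zero>)"
      using fG f by (intro finsum_cong') (auto simp: proj)
    also have "\<dots> = f m"
    proof (cases "f m = \<zero>")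
      case True
      then show ?thesis using fG by (intro trans[OF add.finprod_one_eqI]) auto
    next
      case False
      then show ?thesis using fG ff by (intro finsum_singleton) auto
    qed
    finally show ?thesis .
  qed
  have pd: "hom_decomp G D x (\<lambda>n. p n x)"
    unfolding hom_decomp_def
  proof (intro conjI allI)
    show "p n x \<in> D n" for n using deg x by blast
    show "finite {n. p n x \<noteq> \<zero>}" using fin x by blast
    let ?y = "(\<Oplus>n\<in>{n. p n x \<noteq> \<zero>}. p n x)"
    have y: "?y \<in> carrier G" using deg x DG by (intro finsum_closed) blast
    have "p m (x \<ominus> ?y) = \<zero>" for m
    proof -
      interpret abelian_group_hom G G "p m" by (rule hom)
      have "p m ?y = p m x" using p_sum[of "\<lambda>n. p n x"] deg fin x by blast
      then show ?thesis using x y by (simp add: a_minus_def r_neg)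
    qed
    then have "x \<ominus> ?y = \<zero>" using zero x y by blast
    then show "x = ?y" using x y by (simp add: minus_zero_iff)
  qed
  show "\<exists>!f. hom_decomp G D x f"
  proof (rule ex1I[of "hom_decomp G D x", OF pd])
    fix f assume f: "hom_decomp G D x f"
    show "f = (\<lambda>n. p n x)"
      using p_sum[of f] f unfolding hom_decomp_def by metis
  qed
qed (use sub in auto)

section \<open>Cohomology of graded complexes\<close>

locale graded_complex = graded_group G D for G (structure) and D +
  fixes d :: "'a \<Rightarrow> 'a"
  assumes d_hom: "abelian_group_hom G G d"
    and d_degree: "x \<in> D n \<Longrightarrow> d x \<in> D (n + 1)"
    and d_d: "x \<in> carrier G \<Longrightarrow> d (d x) = \<zero>"
begin

abbreviation "Z \<equiv> cocycles G d"
abbreviation "B \<equiv> coboundaries G d"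
abbreviation cls ("\<lbrakk>_\<rbrakk>") where "cls x \<equiv> B +> x"

lemma d_closed [simp]: "x \<in> carrier G \<Longrightarrow> d x \<in> carrier G"
  by (rule abelian_group_hom.hom_closed[OF d_hom])

lemma d_add: "x \<in> carrier G \<Longrightarrow> y \<in> carrier G \<Longrightarrow> d (x \<oplus> y) = d x \<oplus> d y"
  by (rule abelian_group_hom.hom_add[OF d_hom])

lemma d_zero [simp]: "d \<zero> = \<zero>"
  by (rule abelian_group_hom.hom_zero[OF d_hom])

lemma d_neg: "x \<in> carrier G \<Longrightarrow> d (\<ominus> x) = \<ominus> d x"
  by (rule abelian_group_hom.hom_a_inv[OF d_hom])

lemma d_minus: "x \<in> carrier G \<Longrightarrow> y \<in> carrier G \<Longrightarrow> d (x \<ominus> y) = d x \<ominus> d y"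
  by (simp add: a_minus_def d_add d_neg)

lemma d_component: "x \<in> carrier G \<Longrightarrow> d (cp n x) = cp (n + 1) (d x)"
  using component_natural[OF graded_group_axioms graded_group_axioms d_hom d_degree] by simp

lemma cocycle_iff: "x \<in> Z \<longleftrightarrow> x \<in> carrier G \<and> d x = \<zero>"
  by (simp add: cocycles_def)

lemma coboundary_iff: "x \<in> B \<longleftrightarrow> (\<exists>y\<in>carrier G. x = d y)"
  by (auto simp: coboundaries_def)

lemma cocycle_carrier [simp]: "x \<in> Z \<Longrightarrow> x \<in> carrier G"
  by (simp add: cocycle_iff)

lemma coboundary_cocycle: "x \<in> B \<Longrightarrow> x \<in> Z"
  by (auto simp: cocycle_iff coboundary_iff d_d)

lemma coboundary_carrier [simp]: "x \<in> B \<Longrightarrow> x \<in> carrier G"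
  using coboundary_cocycle by simp

lemma cocycles_subgroup: "additive_subgroup Z G"
  by (rule additive_subgroupI_add) (auto simp: cocycle_iff d_add d_neg)

lemma coboundaries_subgroup: "additive_subgroup B G"
  by (rule additive_subgroupI_add)
     (unfold coboundary_iff, auto, metis d_zero zero_closed, metis d_add a_closed,
       metis d_neg a_inv_closed)

sublocale B: abelian_subgroup B G
  by (rule abelian_subgroupI3[OF coboundaries_subgroup abelian_group_axioms])

lemma cocycle_add: "x \<in> Z \<Longrightarrow> y \<in> Z \<Longrightarrow> x \<oplus> y \<in> Z"
  by (rule additive_subgroup.a_closed[OF cocycles_subgroup])

lemma cocycle_component: "x \<in> Z \<Longrightarrow> cp n x \<in> Z"
  by (simp add: cocycle_iff d_component)

lemma coboundary_component:
  assumes "x \<in> B" shows "cp n x \<in> B"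
proof -
  obtain y where y: "y \<in> carrier G" "x = d y" using assms coboundary_iff by blast
  then have "cp n x = d (cp (n - 1) y)" by (simp add: d_component)
  then show ?thesis using y coboundary_iff component_closed by blast
qed

lemma cls_eq_iff:
  assumes "x \<in> carrier G" "y \<in> carrier G"
  shows "\<lbrakk>x\<rbrakk> = \<lbrakk>y\<rbrakk> \<longleftrightarrow> x \<ominus> y \<in> B"
proof
  assume "\<lbrakk>x\<rbrakk> = \<lbrakk>y\<rbrakk>"
  then have "x \<in> \<lbrakk>y\<rbrakk>" using B.a_rcos_self[OF assms(1)] by simp
  then show "x \<ominus> y \<in> B" using B.a_rcos_module_imp[OF assms(2)] by (simp add: a_minus_def)
next
  assume "x \<ominus> y \<in> B"
  then have "x \<in> \<lbrakk>y\<rbrakk>" using B.a_rcos_module_rev[OF assms(2,1)] by (simp add: a_minus_def)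
  then show "\<lbrakk>x\<rbrakk> = \<lbrakk>y\<rbrakk>" using a_repr_independence[OF _ assms(2) B.a_subgroup] by simp
qed

lemma cls_memD: "y \<in> \<lbrakk>x\<rbrakk> \<Longrightarrow> x \<in> carrier G \<Longrightarrow> y \<in> carrier G \<and> y \<ominus> x \<in> B"
  using B.a_rcos_module_imp[of x y] a_r_coset_subset_G[OF B.a_subset, of x]
  by (auto simp: a_minus_def)

lemma cls_mem_cocycle:
  assumes "y \<in> \<lbrakk>x\<rbrakk>" "x \<in> Z" shows "y \<in> Z"
proof -
  have y: "y \<in> carrier G" "y \<ominus> x \<in> B" using cls_memD assms by auto
  then have "y = (y \<ominus> x) \<oplus> x" using assms(2) by (simp add: a_minus_def a_assoc l_neg)
  then show ?thesis using cocycle_add[OF coboundary_cocycle[OF y(2)] assms(2)] by simp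
qed

lemma minus_zero: "x \<in> carrier G \<Longrightarrow> x \<ominus> \<zero> = x"
  using minus_equality[of \<zero> \<zero>] by (simp add: a_minus_def)

lemma cls_zero: "\<lbrakk>\<zero>\<rbrakk> = B"
  using B.a_subset by simp

lemma cls_eq_zero_iff: "x \<in> carrier G \<Longrightarrow> \<lbrakk>x\<rbrakk> = B \<longleftrightarrow> x \<in> B"
  using cls_eq_iff[of x \<zero>] by (simp add: cls_zero minus_zero)

lemma cls_add: "x \<in> carrier G \<Longrightarrow> y \<in> carrier G \<Longrightarrow> \<lbrakk>x\<rbrakk> <+>\<^bsub>G\<^esub> \<lbrakk>y\<rbrakk> = \<lbrakk>x \<oplus> y\<rbrakk>"
  by (rule B.a_rcos_sum)

end

text \<open>
  \<open>Q\<close> is any structure with the additive data of the cohomology group.  This covers both \<open>cohom_ring\<close>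
  and \<open>cohom_module\<close>, which differ in their remaining fields.
\<close>

locale cohomology_group = graded_complex G D d for G (structure) and D d +
  fixes Q (structure)
  assumes Q_carrier: "carrier Q = cls ` Z"
    and Q_add: "add Q = set_add G"
    and Q_zero: "zero Q = B"
begin

sublocale Q: abelian_group Q
proof (rule abelian_groupI)
  fix \<xi> assume "\<xi> \<in> carrier Q"
  then obtain x where x: "x \<in> Z" "\<xi> = \<lbrakk>x\<rbrakk>" by (auto simp: Q_carrier)
  then have "\<ominus> x \<in> Z" "\<lbrakk>\<ominus> x\<rbrakk> \<oplus>\<^bsub>Q\<^esub> \<xi> = \<zero>\<^bsub>Q\<^esub>"
    using additive_subgroup.a_inv_closed[OF cocycles_subgroup]
    by (auto simp: Q_add Q_zero cls_add l_neg cls_zero)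
  then show "\<exists>\<eta>\<in>carrier Q. \<eta> \<oplus>\<^bsub>Q\<^esub> \<xi> = \<zero>\<^bsub>Q\<^esub>" by (auto simp: Q_carrier)
next
  show "\<zero>\<^bsub>Q\<^esub> \<in> carrier Q"
    using additive_subgroup.zero_closed[OF cocycles_subgroup] cls_zero
    unfolding Q_zero Q_carrier by (intro image_eqI[of _ _ \<zero>]) auto
next
  fix \<xi> assume "\<xi> \<in> carrier Q"
  then obtain x where x: "x \<in> Z" "\<xi> = \<lbrakk>x\<rbrakk>" by (auto simp: Q_carrier)
  have "B <+>\<^bsub>G\<^esub> \<lbrakk>x\<rbrakk> = \<lbrakk>\<zero>\<rbrakk> <+>\<^bsub>G\<^esub> \<lbrakk>x\<rbrakk>" by (simp only: cls_zero)
  then show "\<zero>\<^bsub>Q\<^esub> \<oplus>\<^bsub>Q\<^esub> \<xi> = \<xi>"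
    using x cls_add[of \<zero> x] by (simp add: Q_zero Q_add)
qed (auto simp: Q_carrier Q_add cls_add cocycle_add a_ac)

lemma cls_closed [simp]: "x \<in> Z \<Longrightarrow> \<lbrakk>x\<rbrakk> \<in> carrier Q"
  by (simp add: Q_carrier)

lemma cls_add_Q: "x \<in> Z \<Longrightarrow> y \<in> Z \<Longrightarrow> \<lbrakk>x\<rbrakk> \<oplus>\<^bsub>Q\<^esub> \<lbrakk>y\<rbrakk> = \<lbrakk>x \<oplus> y\<rbrakk>"
  by (simp add: Q_add cls_add)

lemma cls_neg_Q: "x \<in> Z \<Longrightarrow> \<ominus>\<^bsub>Q\<^esub> \<lbrakk>x\<rbrakk> = \<lbrakk>\<ominus> x\<rbrakk>"
  using additive_subgroup.a_inv_closed[OF cocycles_subgroup, of x]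
  by (intro Q.minus_equality) (auto simp: Q_add Q_zero cls_add l_neg cls_zero)

abbreviation "E n \<equiv> cls ` (Z \<inter> D n)"

definition "cpQ n \<xi> = \<lbrakk>cp n (SOME x. x \<in> Z \<and> \<xi> = \<lbrakk>x\<rbrakk>)\<rbrakk>"

lemma cls_component_cong:
  assumes "x \<in> Z" "y \<in> Z" "\<lbrakk>x\<rbrakk> = \<lbrakk>y\<rbrakk>"
  shows "\<lbrakk>cp n x\<rbrakk> = \<lbrakk>cp n y\<rbrakk>"
proof -
  have xy: "x \<in> carrier G" "y \<in> carrier G" using assms(1,2) by simp_all
  have "x \<ominus> y \<in> B" using assms(3) cls_eq_iff[OF xy] by blast
  then have "cp n (x \<ominus> y) \<in> B" by (rule coboundary_component)
  then have "cp n x \<ominus> cp n y \<in> B" by (simp only: component_minus[OF xy])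
  then show ?thesis by (rule iffD2[OF cls_eq_iff[OF component_closed component_closed], OF xy])
qed

lemma cpQ_cls:
  assumes "x \<in> Z" shows "cpQ n \<lbrakk>x\<rbrakk> = \<lbrakk>cp n x\<rbrakk>"
proof -
  let ?y = "SOME y. y \<in> Z \<and> \<lbrakk>x\<rbrakk> = \<lbrakk>y\<rbrakk>"
  have "?y \<in> Z \<and> \<lbrakk>x\<rbrakk> = \<lbrakk>?y\<rbrakk>" by (rule someI[of _ x]) (use assms in simp)
  then show ?thesis using cls_component_cong[of ?y x n] assms unfolding cpQ_def by blast
qed

lemma graded_group_Q: "graded_group Q E"
proof (rule Q.graded_groupI[where p = cpQ])
  show "additive_subgroup (E n) Q" for n
  proof (rule Q.additive_subgroupI_add)
    show "\<zero>\<^bsub>Q\<^esub> \<in> E n"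
      using additive_subgroup.zero_closed[OF cocycles_subgroup] cls_zero
      unfolding Q_zero by (intro image_eqI[of _ _ \<zero>]) auto
    show "\<xi> \<oplus>\<^bsub>Q\<^esub> \<eta> \<in> E n" if "\<xi> \<in> E n" "\<eta> \<in> E n" for \<xi> \<eta>
      using that by (auto simp: cls_add_Q cocycle_add degree_add)
    show "\<ominus>\<^bsub>Q\<^esub> \<xi> \<in> E n" if "\<xi> \<in> E n" for \<xi>
      using that additive_subgroup.a_inv_closed[OF cocycles_subgroup]
      by (auto simp: cls_neg_Q degree_neg)
  qed (auto simp: Q_carrier)
  show "abelian_group_hom Q Q (cpQ n)" for n
    by (rule abelian_group_homI_add)
       (auto simp: Q.abelian_group_axioms Q_carrier cpQ_cls cocycle_component
         cls_add_Q cocycle_add component_add)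
  show "cpQ n \<xi> \<in> E n" if "\<xi> \<in> carrier Q" for n \<xi>
    using that by (auto simp: Q_carrier cpQ_cls cocycle_component component_degree)
  show "finite {n. cpQ n \<xi> \<noteq> \<zero>\<^bsub>Q\<^esub>}" if \<xi>: "\<xi> \<in> carrier Q" for \<xi>
  proof -
    obtain x where x: "x \<in> Z" "\<xi> = \<lbrakk>x\<rbrakk>" using \<xi> by (auto simp: Q_carrier)
    have "{n. cpQ n \<xi> \<noteq> \<zero>\<^bsub>Q\<^esub>} \<subseteq> {n. cp n x \<noteq> \<zero>}"
      using x by (auto simp: cpQ_cls Q_zero cls_zero)
    then show ?thesis using component_finite[of x] x finite_subset by auto
  qed
  show "cpQ m \<xi> = (if m = n then \<xi> else \<zero>\<^bsub>Q\<^esub>)" if "\<xi> \<in> E n" for m n \<xi>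
    using that by (auto simp: cpQ_cls component_of_degree Q_zero cls_zero)
  show "\<xi> = \<zero>\<^bsub>Q\<^esub>" if \<xi>: "\<xi> \<in> carrier Q" and 0: "\<And>n. cpQ n \<xi> = \<zero>\<^bsub>Q\<^esub>" for \<xi>
  proof -
    obtain x where x: "x \<in> Z" "\<xi> = \<lbrakk>x\<rbrakk>" using \<xi> by (auto simp: Q_carrier)
    have "cp n x \<in> B" for n
    proof -
      have "\<lbrakk>cp n x\<rbrakk> = B" using 0[of n] cpQ_cls[OF x(1)] x(2) Q_zero by metis
      then show ?thesis by (rule iffD1[OF cls_eq_zero_iff, rotated]) (use x(1) in simp)
    qed
    then have "x \<in> B"
      by (rule in_subgroup_by_components[OF coboundaries_subgroup cocycle_carrier[OF x(1)]])
    then show ?thesis using iffD2[OF cls_eq_zero_iff[OF cocycle_carrier[OF x(1)]]]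
      by (simp only: x(2) Q_zero)
  qed
qed

end

section \<open>Actions as additive maps\<close>

lemma (in graded_right_module) act_hom:
  "a \<in> carrier R \<Longrightarrow> abelian_group_hom M M (\<lambda>x. x \<triangleleft>\<^bsub>M\<^esub> a)"
  by (rule abelian_group_homI_add) (auto simp: ract_closed ract_l_distr M.abelian_group_axioms)

lemma (in graded_right_module) act_ring_hom:
  "x \<in> carrier M \<Longrightarrow> abelian_group_hom R M (\<lambda>a. x \<triangleleft>\<^bsub>M\<^esub> a)"
  by (rule abelian_group_homI_add)
     (auto simp: ract_closed ract_r_distr R.abelian_group_axioms M.abelian_group_axioms)

lemma (in graded_right_module) graded_group_M: "graded_group M (mdeg M)"
  using mdeg_grading by unfold_locales

lemmas (in graded_right_module)
  act_zero_left = abelian_group_hom.hom_zero[OF act_hom]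
  and act_neg_left = abelian_group_hom.hom_a_inv[OF act_hom]
  and act_zero_right = abelian_group_hom.hom_zero[OF act_ring_hom]
  and act_neg_right = abelian_group_hom.hom_a_inv[OF act_ring_hom]

lemma (in graded_right_module) act_minus_left:
  "\<lbrakk>x \<in> carrier M; y \<in> carrier M; a \<in> carrier R\<rbrakk>
    \<Longrightarrow> (x \<ominus>\<^bsub>M\<^esub> y) \<triangleleft>\<^bsub>M\<^esub> a = x \<triangleleft>\<^bsub>M\<^esub> a \<ominus>\<^bsub>M\<^esub> y \<triangleleft>\<^bsub>M\<^esub> a"
  by (simp add: a_minus_def ract_l_distr act_neg_left)

lemma (in graded_right_module) act_minus_right:
  "\<lbrakk>x \<in> carrier M; a \<in> carrier R; b \<in> carrier R\<rbrakk>
    \<Longrightarrow> x \<triangleleft>\<^bsub>M\<^esub> (a \<ominus>\<^bsub>R\<^esub> b) = x \<triangleleft>\<^bsub>M\<^esub> a \<ominus>\<^bsub>M\<^esub> x \<triangleleft>\<^bsub>M\<^esub> b"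
  by (simp add: a_minus_def ract_r_distr act_neg_right)

lemma (in dg_right_module) complex: "graded_complex M (mdeg M) (mdiff M)"
proof -
  interpret graded_group M "mdeg M" by (rule graded_group_M)
  show ?thesis
    by (intro graded_complex.intro graded_complex_axioms.intro graded_group_axioms
          abelian_group_homI_add)
       (auto simp: mdiff_mdeg mdiff_mdiff mdiff_closed mdiff_add M.abelian_group_axioms)
qed

lemma (in dg_algebra) complex: "graded_complex A (adeg A) (adiff A)"
proof -
  interpret graded_group A "adeg A" using adeg_grading by unfold_locales
  show ?thesis
    by (intro graded_complex.intro graded_complex_axioms.intro graded_group_axioms
          abelian_group_homI_add)
       (auto simp: adiff_adeg adiff_adiff adiff_closed adiff_add abelian_group_axioms)
qed

section \<open>Cohomology of dg algebras and dg modules\<close>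

sublocale dg_right_module \<subseteq> Mc: graded_complex M "mdeg M" "mdiff M"
  by (rule complex)

sublocale dg_algebra \<subseteq> Ac: graded_complex A "adeg A" "adiff A"
  by (rule complex)

lemma (in abelian_group) ksign_zero [simp]: "ksign G n \<zero> = \<zero>"
  using minus_equality[of \<zero> \<zero>] by (simp add: ksign_def)

lemma (in abelian_group) ksign_closed [simp]: "x \<in> carrier G \<Longrightarrow> ksign G n x \<in> carrier G"
  by (simp add: ksign_def)

lemma (in additive_subgroup) ksign_in_subgroup: "x \<in> H \<Longrightarrow> ksign G n x \<in> H"
  by (simp add: ksign_def)

context dg_right_module
begin

text \<open>
  The sign in the Leibniz rule depends on the degree of \<open>x\<close>, but the term that carries it vanishes; so
  the identity holds on homogeneous components and extends additively.
\<close>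

lemma d_act_cocycle:
  assumes x: "x \<in> carrier M" and a: "a \<in> carrier A" "adiff A a = \<zero>"
  shows "mdiff M (x \<triangleleft>\<^bsub>M\<^esub> a) = mdiff M x \<triangleleft>\<^bsub>M\<^esub> a"
proof -
  let ?K = "{x \<in> carrier M. mdiff M (x \<triangleleft>\<^bsub>M\<^esub> a) = mdiff M x \<triangleleft>\<^bsub>M\<^esub> a}"
  have "additive_subgroup ?K M"
    using a by (intro M.additive_subgroupI_add)
      (auto simp: ract_closed ract_l_distr act_zero_left act_neg_left Mc.d_add Mc.d_neg)
  moreover have "Mc.cp n x \<in> ?K" for n
    using mleibniz[OF Mc.component_degree[OF x] a(1)] x a
    by (simp add: act_zero_right ract_closed)
  ultimately have "x \<in> ?K" using Mc.in_subgroup_by_components x by blast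
  then show ?thesis by simp
qed

lemma act_coboundary:
  assumes x: "x \<in> Mc.Z" and c: "c \<in> carrier A" "adiff A c \<in> carrier A"
  shows "x \<triangleleft>\<^bsub>M\<^esub> adiff A c \<in> Mc.B"
proof -
  let ?K = "{x \<in> carrier M. x \<triangleleft>\<^bsub>M\<^esub> adiff A c \<in> Mc.B}"
  have "additive_subgroup ?K M"
    using c by (intro M.additive_subgroupI_add)
      (auto simp: ract_l_distr act_zero_left act_neg_left)
  moreover have "Mc.cp n x \<in> ?K" for n
  proof -
    let ?x = "Mc.cp n x"
    have x': "?x \<in> Mc.Z" using x by (rule Mc.cocycle_component)
    have dx': "mdiff M ?x = \<zero>\<^bsub>M\<^esub>" and xc: "?x \<triangleleft>\<^bsub>M\<^esub> c \<in> carrier M"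
      and xdc: "?x \<triangleleft>\<^bsub>M\<^esub> adiff A c \<in> carrier M"
      using x' c Mc.cocycle_iff ract_closed by blast+
    have "mdiff M (?x \<triangleleft>\<^bsub>M\<^esub> c) = mdiff M ?x \<triangleleft>\<^bsub>M\<^esub> c \<oplus>\<^bsub>M\<^esub> ksign M n (?x \<triangleleft>\<^bsub>M\<^esub> adiff A c)"
      using x by (intro mleibniz[OF Mc.component_degree c(1)]) simp
    also have "\<dots> = ksign M n (?x \<triangleleft>\<^bsub>M\<^esub> adiff A c)"
      using xdc c by (simp add: dx' act_zero_left)
    finally have "mdiff M (?x \<triangleleft>\<^bsub>M\<^esub> c) = ksign M n (?x \<triangleleft>\<^bsub>M\<^esub> adiff A c)" .
    moreover have "mdiff M (?x \<triangleleft>\<^bsub>M\<^esub> c) \<in> Mc.B"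
      using xc Mc.coboundary_iff by blast
    ultimately have "ksign M n (?x \<triangleleft>\<^bsub>M\<^esub> adiff A c) \<in> Mc.B" by simp
    from Mc.B.ksign_in_subgroup[OF this, of n]
    have "?x \<triangleleft>\<^bsub>M\<^esub> adiff A c \<in> Mc.B"
      using xdc by (simp add: ksign_def split: if_splits)
    then show ?thesis using x by simp
  qed
  ultimately have "x \<in> ?K" using Mc.in_subgroup_by_components x by (meson Mc.cocycle_carrier)
  then show ?thesis by simp
qed

end

text \<open>
  \<open>A\<close> as a right module over itself: what is proved about dg modules then applies to products in \<open>A\<close>.
\<close>

definition regular_module :: "('k, 'a, 'z) dg_algebra_scheme \<Rightarrow> ('a, 'a) dg_module" where
  "regular_module A = \<lparr>carrier = carrier A, mult = mult A, one = one A, zero = zero A,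
     add = add A, ract = mult A, mdeg = adeg A, mdiff = adiff A\<rparr>"

lemma regular_module_simps [simp]:
  "carrier (regular_module A) = carrier A" "zero (regular_module A) = zero A"
  "add (regular_module A) = add A" "ract (regular_module A) = mult A"
  "mdeg (regular_module A) = adeg A" "mdiff (regular_module A) = adiff A"
  "a_inv (regular_module A) = a_inv A" "a_minus (regular_module A) = a_minus A"
  "ksign (regular_module A) = ksign A" "cocycles (regular_module A) = cocycles A"
  "coboundaries (regular_module A) = coboundaries A"
  "a_r_coset (regular_module A) = a_r_coset A"
  by (auto simp: regular_module_def a_inv_def a_minus_def ksign_def fun_eq_iff m_inv_def
      cocycles_def coboundaries_def a_r_coset_def r_coset_def)

text \<open>
  The notions below only see the additive part of a structure, so they agree for two records of
  different types, or with different remaining fields, whose additive parts coincide.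
\<close>

lemma additive_structure_cong:
  assumes "carrier G = carrier H" "zero G = zero H" "add G = add H"
  shows "finsum G = finsum H" "abelian_group G \<longleftrightarrow> abelian_group H"
    "additive_subgroup U G \<longleftrightarrow> additive_subgroup U H" "grading G D \<longleftrightarrow> grading H D"
proof -
  show f: "finsum G = finsum H"
    by (auto simp: finsum_def finprod_def fun_eq_iff assms)
  show "abelian_group G \<longleftrightarrow> abelian_group H"
    using assms abelian_groupE[of G] abelian_groupE[of H]
    by (intro iffI abelian_groupI) metis+
  have s: "additive_subgroup U G \<longleftrightarrow> additive_subgroup U H" for U
    by (simp add: additive_subgroup_def subgroup_def assms m_inv_def)
  show "additive_subgroup U G \<longleftrightarrow> additive_subgroup U H" by (rule s)
  show "grading G D \<longleftrightarrow> grading H D"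
    by (simp add: grading_def hom_decomp_def f s assms)
qed

context dg_algebra
begin

lemma regular_dg_module: "dg_right_module A (regular_module A)"
proof (intro dg_right_module.intro graded_right_module.intro graded_right_module_axioms.intro
    dg_right_module_axioms.intro)
  show "ring A" by (rule A.ring_axioms)
  have c: "carrier (regular_module A) = carrier A" "zero (regular_module A) = zero A"
    "add (regular_module A) = add A" by simp_all
  note cong = additive_structure_cong[OF c]
  show "abelian_group (regular_module A)"
    using cong(2) M.abelian_group_axioms by blast
  show "grading (regular_module A) (mdeg (regular_module A))"
    using cong(4) adeg_grading by simp
qed (simp_all add: A.l_distr A.r_distr A.m_assoc mult_adeg adiff_closed adiff_add adiff_adeg
      adiff_adiff leibniz)

end

lemma cohom_ring_simps:
  fixes A :: "('k, 'a) dg_algebra"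
  defines "Z \<equiv> cocycles A (adiff A)" and "B \<equiv> coboundaries A (adiff A)"
  shows "carrier (cohom_ring A) = (\<lambda>z. B +>\<^bsub>A\<^esub> z) ` Z"
    "mult (cohom_ring A) \<alpha> \<beta> = (\<Union>a\<in>\<alpha>. \<Union>b\<in>\<beta>. B +>\<^bsub>A\<^esub> (a \<otimes>\<^bsub>A\<^esub> b))"
    "one (cohom_ring A) = B +>\<^bsub>A\<^esub> \<one>\<^bsub>A\<^esub>"
    "zero (cohom_ring A) = B"
    "add (cohom_ring A) = set_add A"
    "rdeg (cohom_ring A) n = (\<lambda>z. B +>\<^bsub>A\<^esub> z) ` (Z \<inter> adeg A n)"
  by (auto simp: cohom_ring_def Let_def Z_def B_def ring.defs graded_ring.defs FactRing_def
      rcoset_mult_def A_RCOSETS_def RCOSETS_def a_r_coset_def r_coset_def set_add_def set_mult_def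
      fun_eq_iff)

lemma cohom_module_simps:
  fixes M :: "('a, 'm) dg_module"
  defines "Z \<equiv> cocycles M (mdiff M)" and "B \<equiv> coboundaries M (mdiff M)"
  shows "carrier (cohom_module M) = (\<lambda>z. B +>\<^bsub>M\<^esub> z) ` Z"
    "ract (cohom_module M) \<xi> \<alpha> = (\<Union>z\<in>\<xi>. \<Union>a\<in>\<alpha>. B +>\<^bsub>M\<^esub> (z \<triangleleft>\<^bsub>M\<^esub> a))"
    "zero (cohom_module M) = B"
    "add (cohom_module M) = set_add M"
    "mdeg (cohom_module M) n = (\<lambda>z. B +>\<^bsub>M\<^esub> z) ` (Z \<inter> mdeg M n)"
  by (auto simp: cohom_module_def Let_def Z_def B_def ring.defs graded_module.defs FactRing_def
      A_RCOSETS_def RCOSETS_def a_r_coset_def r_coset_def set_add_def set_mult_def fun_eq_iff)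

locale dga = dg_algebra K A for K and A :: "('k, 'a) dg_algebra" (structure)

sublocale dga \<subseteq> HA: cohomology_group A "adeg A" "adiff A" "cohom_ring A"
  by unfold_locales (simp_all add: cohom_ring_simps)

locale dg_module_over = Alg: dga K A + Mod: dg_right_module A M
  for K and A :: "('k, 'a) dg_algebra" (structure)
    and M :: "('a, 'm) dg_module" (structure)

sublocale dg_module_over \<subseteq> HM: cohomology_group M "mdeg M" "mdiff M" "cohom_module M"
  by unfold_locales (simp_all add: cohom_module_simps)

context dg_module_over
begin

lemma act_carrier [simp]: "x \<in> carrier M \<Longrightarrow> a \<in> carrier A \<Longrightarrow> x \<triangleleft>\<^bsub>M\<^esub> a \<in> carrier M"
  by (rule Mod.ract_closed)

lemma act_cocycle: "x \<in> Mod.Mc.Z \<Longrightarrow> a \<in> Alg.Ac.Z \<Longrightarrow> x \<triangleleft>\<^bsub>M\<^esub> a \<in> Mod.Mc.Z"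
  by (simp add: Mod.Mc.cocycle_iff Alg.Ac.cocycle_iff Mod.d_act_cocycle Mod.act_zero_left)

lemma coboundary_act:
  assumes "x \<in> Mod.Mc.B" "a \<in> Alg.Ac.Z" shows "x \<triangleleft>\<^bsub>M\<^esub> a \<in> Mod.Mc.B"
proof -
  obtain y where y: "y \<in> carrier M" "x = mdiff M y"
    using assms(1) Mod.Mc.coboundary_iff by blast
  have "x \<triangleleft>\<^bsub>M\<^esub> a = mdiff M (y \<triangleleft>\<^bsub>M\<^esub> a)"
    using y assms(2) by (simp add: Alg.Ac.cocycle_iff Mod.d_act_cocycle)
  then show ?thesis
    using y(1) assms(2) Mod.Mc.coboundary_iff act_carrier Alg.Ac.cocycle_carrier by blast
qed

lemma act_coboundary:
  assumes "x \<in> Mod.Mc.Z" "a \<in> Alg.Ac.B" shows "x \<triangleleft>\<^bsub>M\<^esub> a \<in> Mod.Mc.B"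
  using assms Mod.act_coboundary Alg.Ac.coboundary_iff Alg.adiff_closed by metis

lemma cls_act_cong:
  assumes x: "x \<in> Mod.Mc.Z" and a: "a \<in> Alg.Ac.Z"
    and z: "z \<in> Mod.Mc.cls x" and b: "b \<in> Alg.Ac.cls a"
  shows "Mod.Mc.cls (z \<triangleleft>\<^bsub>M\<^esub> b) = Mod.Mc.cls (x \<triangleleft>\<^bsub>M\<^esub> a)"
proof -
  have z': "z \<in> Mod.Mc.Z" "z \<ominus>\<^bsub>M\<^esub> x \<in> Mod.Mc.B"
    using Mod.Mc.cls_mem_cocycle[OF z x] Mod.Mc.cls_memD[OF z] x by auto
  have b': "b \<in> Alg.Ac.Z" "b \<ominus>\<^bsub>A\<^esub> a \<in> Alg.Ac.B"
    using Alg.Ac.cls_mem_cocycle[OF b a] Alg.Ac.cls_memD[OF b] a by auto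
  note c = Mod.Mc.cocycle_carrier[OF x] Mod.Mc.cocycle_carrier[OF z'(1)]
    Alg.Ac.cocycle_carrier[OF a] Alg.Ac.cocycle_carrier[OF b'(1)]
  have "(z \<ominus>\<^bsub>M\<^esub> x) \<triangleleft>\<^bsub>M\<^esub> b \<oplus>\<^bsub>M\<^esub> x \<triangleleft>\<^bsub>M\<^esub> (b \<ominus>\<^bsub>A\<^esub> a) \<in> Mod.Mc.B"
    using coboundary_act[OF z'(2) b'(1)] act_coboundary[OF x b'(2)] by (rule Mod.Mc.B.a_closed)
  moreover have "(z \<ominus>\<^bsub>M\<^esub> x) \<triangleleft>\<^bsub>M\<^esub> b \<oplus>\<^bsub>M\<^esub> x \<triangleleft>\<^bsub>M\<^esub> (b \<ominus>\<^bsub>A\<^esub> a) = z \<triangleleft>\<^bsub>M\<^esub> b \<ominus>\<^bsub>M\<^esub> x \<triangleleft>\<^bsub>M\<^esub> a"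
  proof -
    have "p \<oplus>\<^bsub>M\<^esub> \<ominus>\<^bsub>M\<^esub> q \<oplus>\<^bsub>M\<^esub> (q \<oplus>\<^bsub>M\<^esub> \<ominus>\<^bsub>M\<^esub> r) = p \<oplus>\<^bsub>M\<^esub> \<ominus>\<^bsub>M\<^esub> r"
      if "p \<in> carrier M" "q \<in> carrier M" "r \<in> carrier M" for p q r
      using that by (simp add: Mod.M.a_assoc Mod.M.r_neg1)
    then show ?thesis
      using c by (simp add: Mod.act_minus_left Mod.act_minus_right) (simp add: a_minus_def)
  qed
  ultimately show ?thesis
    using Mod.Mc.cls_eq_iff[of "z \<triangleleft>\<^bsub>M\<^esub> b" "x \<triangleleft>\<^bsub>M\<^esub> a"] c by simp
qed

lemma cls_act:
  assumes x: "x \<in> Mod.Mc.Z" and a: "a \<in> Alg.Ac.Z"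
  shows "(\<Union>z\<in>Mod.Mc.cls x. \<Union>b\<in>Alg.Ac.cls a. Mod.Mc.cls (z \<triangleleft>\<^bsub>M\<^esub> b)) = Mod.Mc.cls (x \<triangleleft>\<^bsub>M\<^esub> a)"
proof -
  have "(\<Union>z\<in>Mod.Mc.cls x. \<Union>b\<in>Alg.Ac.cls a. Mod.Mc.cls (z \<triangleleft>\<^bsub>M\<^esub> b))
      = (\<Union>z\<in>Mod.Mc.cls x. \<Union>b\<in>Alg.Ac.cls a. Mod.Mc.cls (x \<triangleleft>\<^bsub>M\<^esub> a))"
    by (intro SUP_cong refl cls_act_cong[OF x a])
  moreover have "x \<in> Mod.Mc.cls x" "a \<in> Alg.Ac.cls a"
    using Mod.Mc.B.a_rcos_self Alg.Ac.B.a_rcos_self x a by simp_all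
  ultimately show ?thesis by auto
qed

end


lemma (in dga) regular: "dg_module_over K A (regular_module A)"
  using regular_dg_module by (intro dg_module_over.intro dga_axioms)

context dga
begin

lemma cls_mult:
  assumes a: "a \<in> Ac.Z" and b: "b \<in> Ac.Z"
  shows "Ac.cls a \<otimes>\<^bsub>cohom_ring A\<^esub> Ac.cls b = Ac.cls (a \<otimes> b)"
  using dg_module_over.cls_act[OF regular, of a b] a b by (simp add: cohom_ring_simps)

lemma mult_cocycle: "a \<in> Ac.Z \<Longrightarrow> b \<in> Ac.Z \<Longrightarrow> a \<otimes> b \<in> Ac.Z"
  using dg_module_over.act_cocycle[OF regular, of a b] by simp

lemma one_cocycle: "\<one> \<in> Ac.Z"
proof -
  have "adiff A (\<one> \<otimes> \<one>) = adiff A \<one> \<otimes> \<one> \<oplus> ksign A 0 (\<one> \<otimes> adiff A \<one>)"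
    using one_adeg by (intro leibniz) auto
  then have "adiff A \<one> = adiff A \<one> \<oplus> adiff A \<one>"
    by (simp add: ksign_def adiff_closed)
  then have "adiff A \<one> = \<zero>"
    using adiff_closed[of \<one>] add.l_cancel_one'[of "adiff A \<one>" "adiff A \<one>"] by simp
  then show ?thesis by (simp add: Ac.cocycle_iff)
qed

lemma ring_cohom_ring: "ring (cohom_ring A)"
proof (rule ringI)
  show "abelian_group (cohom_ring A)" by (rule HA.Q.abelian_group_axioms)
  show "Group.monoid (cohom_ring A)"
    by (rule monoidI)
       (auto simp: HA.Q_carrier cls_mult mult_cocycle one_cocycle cohom_ring_simps(3) A.m_assoc)
qed (auto simp: HA.Q_carrier cls_mult mult_cocycle HA.cls_add_Q Ac.cocycle_add A.l_distr A.r_distr)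

end

context dg_module_over
begin

lemma cls_act_cohom:
  "x \<in> Mod.Mc.Z \<Longrightarrow> a \<in> Alg.Ac.Z \<Longrightarrow>
    Mod.Mc.cls x \<triangleleft>\<^bsub>cohom_module M\<^esub> Alg.Ac.cls a = Mod.Mc.cls (x \<triangleleft>\<^bsub>M\<^esub> a)"
  using cls_act by (simp add: cohom_module_simps)

lemma cohom_module_graded:
  "graded_right_module (cohom_ring A) (cohom_module M) (rdeg (cohom_ring A))"
proof (intro graded_right_module.intro graded_right_module_axioms.intro)
  show "ring (cohom_ring A)" by (rule Alg.ring_cohom_ring)
  show "abelian_group (cohom_module M)" by (rule HM.Q.abelian_group_axioms)
  have "mdeg (cohom_module M) = HM.E"
    by (simp add: cohom_module_simps fun_eq_iff)
  then show "grading (cohom_module M) (mdeg (cohom_module M))"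
    using graded_group.grading[OF HM.graded_group_Q] by simp
  show "\<xi> \<triangleleft>\<^bsub>cohom_module M\<^esub> \<one>\<^bsub>cohom_ring A\<^esub> = \<xi>" if "\<xi> \<in> carrier (cohom_module M)" for \<xi>
    using that
    by (auto simp: HM.Q_carrier cohom_ring_simps(3) cls_act_cohom Alg.one_cocycle Mod.ract_one)
  show "\<xi> \<triangleleft>\<^bsub>cohom_module M\<^esub> \<alpha> \<in> mdeg (cohom_module M) (i + j)"
    if "\<xi> \<in> mdeg (cohom_module M) i" "\<alpha> \<in> rdeg (cohom_ring A) j" for \<xi> \<alpha> i j
    using that
    by (auto simp: cohom_module_simps(5) cohom_ring_simps(6) cls_act_cohom act_cocycle
        Mod.ract_mdeg)
qed (auto simp: HM.Q_carrier Alg.HA.Q_carrier cls_act_cohom act_cocycle HM.cls_add_Q Alg.HA.cls_add_Q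
    Mod.Mc.cocycle_add Alg.Ac.cocycle_add Mod.ract_l_distr Mod.ract_r_distr Alg.cls_mult
    Alg.mult_cocycle Mod.ract_assoc)

end

section \<open>Localisation maps of graded modules\<close>

text \<open>
  Localisations are characterised by conditions on elements: \<open>S\<close> acts bijectively on the target, and
  kernel and cokernel are \<open>S\<close>-torsion.  These can be verified on cocycles.
\<close>

locale localisation_map = N0: graded_right_module R N0 "rdeg R" + N1: graded_right_module R N1 "rdeg R"
  for R :: "('r, 'z) graded_ring_scheme" (structure)
    and N0 :: "('r, 'm) graded_module" and N1 :: "('r, 'n) graded_module" +
  fixes S :: "'r set" and \<iota> :: "'m \<Rightarrow> 'n"
  assumes S_carrier: "S \<subseteq> carrier R" and S_one: "\<one> \<in> S"
    and S_mult: "\<lbrakk>s \<in> S; t \<in> S\<rbrakk> \<Longrightarrow> s \<otimes> t \<in> S"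
    and S_central: "\<lbrakk>s \<in> S; a \<in> carrier R\<rbrakk> \<Longrightarrow> s \<otimes> a = a \<otimes> s"
    and S_degree: "s \<in> S \<Longrightarrow> \<exists>j. s \<in> rdeg R j"
    and iota_hom: "abelian_group_hom N0 N1 \<iota>"
    and iota_act: "\<lbrakk>x \<in> carrier N0; a \<in> carrier R\<rbrakk> \<Longrightarrow> \<iota> (x \<triangleleft>\<^bsub>N0\<^esub> a) = \<iota> x \<triangleleft>\<^bsub>N1\<^esub> a"
    and iota_degree: "x \<in> mdeg N0 n \<Longrightarrow> \<iota> x \<in> mdeg N1 n"
    and unit_inj: "\<lbrakk>s \<in> S; y \<in> carrier N1; y \<triangleleft>\<^bsub>N1\<^esub> s = \<zero>\<^bsub>N1\<^esub>\<rbrakk> \<Longrightarrow> y = \<zero>\<^bsub>N1\<^esub>"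
    and unit_surj: "\<lbrakk>s \<in> S; y \<in> carrier N1\<rbrakk> \<Longrightarrow> \<exists>w\<in>carrier N1. y = w \<triangleleft>\<^bsub>N1\<^esub> s"
    and kernel_torsion: "\<lbrakk>x \<in> carrier N0; \<iota> x = \<zero>\<^bsub>N1\<^esub>\<rbrakk> \<Longrightarrow> \<exists>s\<in>S. x \<triangleleft>\<^bsub>N0\<^esub> s = \<zero>\<^bsub>N0\<^esub>"
    and cokernel_torsion: "y \<in> carrier N1 \<Longrightarrow> \<exists>s\<in>S. \<exists>x\<in>carrier N0. y \<triangleleft>\<^bsub>N1\<^esub> s = \<iota> x"
begin

abbreviation act0 (infixl "\<star>" 70) where "x \<star> a \<equiv> x \<triangleleft>\<^bsub>N0\<^esub> a"
abbreviation act1 (infixl "\<bullet>" 70) where "y \<bullet> a \<equiv> y \<triangleleft>\<^bsub>N1\<^esub> a"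

sublocale iota: abelian_group_hom N0 N1 \<iota> by (rule iota_hom)
sublocale G0: graded_group N0 "mdeg N0" by (rule N0.graded_group_M)
sublocale G1: graded_group N1 "mdeg N1" by (rule N1.graded_group_M)

lemma S_in_carrier [simp]: "s \<in> S \<Longrightarrow> s \<in> carrier R"
  using S_carrier by blast

lemma act_commute:
  assumes "graded_right_module R N (rdeg R)" "y \<in> carrier N" "s \<in> S" "a \<in> carrier R"
  shows "y \<triangleleft>\<^bsub>N\<^esub> s \<triangleleft>\<^bsub>N\<^esub> a = y \<triangleleft>\<^bsub>N\<^esub> a \<triangleleft>\<^bsub>N\<^esub> s"
proof -
  interpret N: graded_right_module R N "rdeg R" by fact
  have "y \<triangleleft>\<^bsub>N\<^esub> s \<triangleleft>\<^bsub>N\<^esub> a = y \<triangleleft>\<^bsub>N\<^esub> (s \<otimes> a)" using assms by (simp add: N.ract_assoc)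
  also have "\<dots> = y \<triangleleft>\<^bsub>N\<^esub> (a \<otimes> s)" using assms by (simp add: S_central)
  also have "\<dots> = y \<triangleleft>\<^bsub>N\<^esub> a \<triangleleft>\<^bsub>N\<^esub> s" using assms by (simp add: N.ract_assoc)
  finally show ?thesis .
qed

lemmas act_commute1 = act_commute[OF N1.graded_right_module_axioms]

lemma act_cancel:
  assumes "s \<in> S" "y \<in> carrier N1" "w \<in> carrier N1" "y \<bullet> s = w \<bullet> s"
  shows "y = w"
proof -
  have "(y \<ominus>\<^bsub>N1\<^esub> w) \<bullet> s = \<zero>\<^bsub>N1\<^esub>"
    using assms by (simp add: N1.act_minus_left N1.ract_closed N1.M.minus_zero_iff)
  then have "y \<ominus>\<^bsub>N1\<^esub> w = \<zero>\<^bsub>N1\<^esub>" using assms unit_inj by blast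
  then show ?thesis using assms N1.M.minus_zero_iff by simp
qed

lemma act_component:
  assumes "graded_right_module R N (rdeg R)" "y \<in> carrier N" "s \<in> S" "s \<in> rdeg R j"
  shows "component N (mdeg N) (n + j) (y \<triangleleft>\<^bsub>N\<^esub> s) = component N (mdeg N) n y \<triangleleft>\<^bsub>N\<^esub> s"
proof -
  interpret N: graded_right_module R N "rdeg R" by fact
  show ?thesis using assms
    by (intro component_natural[where h = "\<lambda>y. y \<triangleleft>\<^bsub>N\<^esub> s"] N.graded_group_M N.act_hom)
       (auto intro: N.ract_mdeg)
qed

lemma iota_component:
  "x \<in> carrier N0 \<Longrightarrow> component N1 (mdeg N1) n (\<iota> x) = \<iota> (component N0 (mdeg N0) n x)"
  using component_natural[OF N0.graded_group_M N1.graded_group_M iota_hom, of 0 x n] iota_degree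
  by simp

text \<open>
  Division by a homogeneous element of \<open>S\<close> is homogeneous, because the other components of \<open>y\<close> are
  killed by an element that acts injectively.
\<close>

lemma degree_cancel:
  assumes s: "s \<in> S" "s \<in> rdeg R j" and y: "y \<in> carrier N1" "y \<bullet> s \<in> mdeg N1 (n + j)"
  shows "y \<in> mdeg N1 n"
proof (rule G1.degree_by_components[OF y(1)])
  fix m assume m: "m \<noteq> n"
  have "component N1 (mdeg N1) m y \<bullet> s = component N1 (mdeg N1) (m + j) (y \<bullet> s)"
    by (rule act_component[OF N1.graded_right_module_axioms y(1) s, symmetric])
  also have "\<dots> = \<zero>\<^bsub>N1\<^esub>"
    using m by (simp add: G1.component_of_degree[OF y(2)])
  finally show "component N1 (mdeg N1) m y = \<zero>\<^bsub>N1\<^esub>"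
    by (rule unit_inj[OF s(1) G1.component_closed[OF y(1)]])
qed

lemma iota_eqD:
  assumes "x \<in> carrier N0" "x' \<in> carrier N0" "\<iota> x = \<iota> x'"
  shows "\<exists>s\<in>S. x \<star> s = x' \<star> s"
proof -
  have "\<iota> (x \<ominus>\<^bsub>N0\<^esub> x') = \<iota> x \<ominus>\<^bsub>N1\<^esub> \<iota> x'"
    using assms(1,2) by (simp add: a_minus_def)
  also have "\<dots> = \<zero>\<^bsub>N1\<^esub>" using assms by (simp add: N1.M.minus_zero_iff)
  finally obtain s where s: "s \<in> S" "(x \<ominus>\<^bsub>N0\<^esub> x') \<star> s = \<zero>\<^bsub>N0\<^esub>"
    using kernel_torsion assms(1,2) by blast
  then have "x \<star> s \<ominus>\<^bsub>N0\<^esub> x' \<star> s = \<zero>\<^bsub>N0\<^esub>"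
    using assms by (simp add: N0.act_minus_left)
  then have "x \<star> s = x' \<star> s"
    using s assms by (simp add: N0.M.minus_zero_iff N0.ract_closed)
  then show ?thesis using s(1) by blast
qed

text \<open>
  The image of the localisation of \<open>U\<close> in \<open>N1\<close>.
\<close>

definition saturation :: "'m set \<Rightarrow> 'n set" where
  "saturation U = {y \<in> carrier N1. \<exists>s\<in>S. \<exists>u\<in>U. y \<bullet> s = \<iota> u}"

lemma graded_submoduleD:
  assumes "graded_submodule R N0 U"
  shows "U \<subseteq> carrier N0" "\<zero>\<^bsub>N0\<^esub> \<in> U" "\<And>x y. \<lbrakk>x \<in> U; y \<in> U\<rbrakk> \<Longrightarrow> x \<oplus>\<^bsub>N0\<^esub> y \<in> U"
    "\<And>x. x \<in> U \<Longrightarrow> \<ominus>\<^bsub>N0\<^esub> x \<in> U" "\<And>x a. \<lbrakk>x \<in> U; a \<in> carrier R\<rbrakk> \<Longrightarrow> x \<star> a \<in> U"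
    "\<And>x n. x \<in> U \<Longrightarrow> component N0 (mdeg N0) n x \<in> U"
proof -
  interpret U: additive_subgroup U N0 using assms by (simp add: graded_submodule_def)
  show "U \<subseteq> carrier N0" "\<zero>\<^bsub>N0\<^esub> \<in> U" "\<And>x y. \<lbrakk>x \<in> U; y \<in> U\<rbrakk> \<Longrightarrow> x \<oplus>\<^bsub>N0\<^esub> y \<in> U"
    "\<And>x. x \<in> U \<Longrightarrow> \<ominus>\<^bsub>N0\<^esub> x \<in> U" "\<And>x a. \<lbrakk>x \<in> U; a \<in> carrier R\<rbrakk> \<Longrightarrow> x \<star> a \<in> U"
    using assms U.a_subset by (auto simp: graded_submodule_def)
  fix x n assume x: "x \<in> U"
  then obtain f where f: "hom_decomp N0 (\<lambda>n. mdeg N0 n \<inter> U) x f"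
    using assms by (auto simp: graded_submodule_def homogeneous_subset_def)
  then have "hom_decomp N0 (mdeg N0) x f" by (simp add: hom_decomp_def)
  from G0.component_unique[OF this] have "component N0 (mdeg N0) n x = f n"
    using x U.a_subset by blast
  then show "component N0 (mdeg N0) n x \<in> U" using f by (simp add: hom_decomp_def)
qed

text \<open>
  Closure under sums uses the common denominator \<open>s \<otimes> t\<close>.  Components are taken degree by degree: if
  \<open>y \<bullet> s = \<iota> u\<close> with \<open>s\<close> of degree \<open>j\<close>, then the component of \<open>y\<close> in degree \<open>n\<close>, multiplied by \<open>s\<close>, is the
  image of the component of \<open>u\<close> in degree \<open>n + j\<close>.
\<close>

lemma saturation_submodule:
  assumes U: "graded_submodule R N0 U"
  shows "graded_submodule R N1 (saturation U)"
proof -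
  note U = graded_submoduleD[OF U]
  have UN: "u \<in> carrier N0" if "u \<in> U" for u using that U(1) by blast
  have act: "y \<bullet> a \<in> saturation U" if y: "y \<in> saturation U" and a: "a \<in> carrier R" for y a
  proof -
    obtain s u where su: "y \<in> carrier N1" "s \<in> S" "u \<in> U" "y \<bullet> s = \<iota> u"
      using y by (auto simp: saturation_def)
    have "y \<bullet> a \<bullet> s = \<iota> (u \<star> a)"
      using act_commute1[OF su(1,2) a] su a UN by (simp add: iota_act)
    then show ?thesis using su U(5) a N1.ract_closed unfolding saturation_def by blast
  qed
  have "additive_subgroup (saturation U) N1"
  proof (rule N1.M.additive_subgroupI_add)
    show "saturation U \<subseteq> carrier N1" by (auto simp: saturation_def)
    have "\<zero>\<^bsub>N1\<^esub> \<bullet> \<one> = \<iota> \<zero>\<^bsub>N0\<^esub>" by (simp add: N1.act_zero_left)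
    then show "\<zero>\<^bsub>N1\<^esub> \<in> saturation U" using S_one U(2) unfolding saturation_def by blast
    show "y \<oplus>\<^bsub>N1\<^esub> y' \<in> saturation U" if "y \<in> saturation U" "y' \<in> saturation U" for y y'
    proof -
      obtain s u t v where su: "y \<in> carrier N1" "s \<in> S" "u \<in> U" "y \<bullet> s = \<iota> u"
        and tv: "y' \<in> carrier N1" "t \<in> S" "v \<in> U" "y' \<bullet> t = \<iota> v"
        using \<open>y \<in> saturation U\<close> \<open>y' \<in> saturation U\<close> by (auto simp: saturation_def)
      have "(y \<oplus>\<^bsub>N1\<^esub> y') \<bullet> (s \<otimes> t) = y \<bullet> s \<bullet> t \<oplus>\<^bsub>N1\<^esub> y' \<bullet> t \<bullet> s"
        using su(1,2) tv(1,2)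
        by (simp add: N1.ract_l_distr N1.ract_assoc N1.ract_closed act_commute1[of y' s t])
      also have "\<dots> = \<iota> (u \<star> t \<oplus>\<^bsub>N0\<^esub> v \<star> s)"
        using su tv UN by (simp add: iota_act N0.ract_closed)
      finally have "(y \<oplus>\<^bsub>N1\<^esub> y') \<bullet> (s \<otimes> t) = \<iota> (u \<star> t \<oplus>\<^bsub>N0\<^esub> v \<star> s)" .
      moreover have "u \<star> t \<oplus>\<^bsub>N0\<^esub> v \<star> s \<in> U" using su tv U(3,5) by simp
      moreover have "y \<oplus>\<^bsub>N1\<^esub> y' \<in> carrier N1" using su tv by simp
      ultimately show ?thesis using S_mult[OF su(2) tv(2)] unfolding saturation_def by blast
    qed
    show "\<ominus>\<^bsub>N1\<^esub> y \<in> saturation U" if y: "y \<in> saturation U" for y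
    proof -
      obtain s u where su: "y \<in> carrier N1" "s \<in> S" "u \<in> U" "y \<bullet> s = \<iota> u"
        using y by (auto simp: saturation_def)
      then have "(\<ominus>\<^bsub>N1\<^esub> y) \<bullet> s = \<iota> (\<ominus>\<^bsub>N0\<^esub> u)" using UN by (simp add: N1.act_neg_left)
      then show ?thesis using su U(4) N1.M.a_inv_closed unfolding saturation_def by blast
    qed
  qed
  moreover have "homogeneous_subset N1 (mdeg N1) (saturation U)"
    unfolding homogeneous_subset_def
  proof
    fix y assume "y \<in> saturation U"
    then obtain s u where su: "y \<in> carrier N1" "s \<in> S" "u \<in> U" "y \<bullet> s = \<iota> u"
      by (auto simp: saturation_def)
    obtain j where j: "s \<in> rdeg R j" using S_degree su(2) by blast
    have comp: "G1.cp n y \<in> saturation U" for n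
    proof -
      have "G1.cp n y \<bullet> s = \<iota> (G0.cp (n + j) u)"
        using act_component[OF N1.graded_right_module_axioms su(1,2) j] su(4)
          iota_component[OF UN[OF su(3)]] by simp
      then show ?thesis
        using su U(6) G1.component_closed unfolding saturation_def by blast
    qed
    have "hom_decomp N1 (\<lambda>n. mdeg N1 n \<inter> saturation U) y (\<lambda>n. G1.cp n y)"
      using G1.hom_decomp_component[OF su(1)] comp by (simp add: hom_decomp_def)
    then show "\<exists>f. hom_decomp N1 (\<lambda>n. mdeg N1 n \<inter> saturation U) y f" by blast
  qed
  ultimately show ?thesis using act by (simp add: graded_submodule_def)
qed

lemma saturation_carrier: "saturation (carrier N0) = carrier N1"
  using cokernel_torsion by (auto simp: saturation_def)

text \<open>
  The complement is the saturation of a complement \<open>V\<close>.  An element of both saturations has a multiple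
  that comes from \<open>U \<inter> V\<close>, up to torsion in the kernel of \<open>\<iota>\<close>, and elements of \<open>S\<close> act injectively.
  Conversely a decomposition of a multiple of \<open>y\<close> can be divided by the denominator.
\<close>

lemma saturation_summand:
  assumes U: "direct_summand R N0 U"
  shows "direct_summand R N1 (saturation U)"
proof -
  obtain V where gU: "graded_submodule R N0 U" and gV: "graded_submodule R N0 V"
    and UV: "U \<inter> V = {\<zero>\<^bsub>N0\<^esub>}" "U <+>\<^bsub>N0\<^esub> V = carrier N0"
    using U by (auto simp: direct_summand_def)
  note U = graded_submoduleD[OF gU] and V = graded_submoduleD[OF gV]
  have UN: "u \<in> carrier N0" if "u \<in> U" for u using that U(1) by blast
  have VN: "v \<in> carrier N0" if "v \<in> V" for v using that V(1) by blast
  note sU = saturation_submodule[OF gU] and sV = saturation_submodule[OF gV]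
  have sub: "saturation U \<subseteq> carrier N1" "saturation V \<subseteq> carrier N1"
    by (auto simp: saturation_def)
  have zero: "\<zero>\<^bsub>N1\<^esub> \<in> saturation U" "\<zero>\<^bsub>N1\<^esub> \<in> saturation V"
    using sU sV additive_subgroup.zero_closed unfolding graded_submodule_def by blast+
  have int: "y = \<zero>\<^bsub>N1\<^esub>" if "y \<in> saturation U" "y \<in> saturation V" for y
  proof -
    obtain s u t v where su: "y \<in> carrier N1" "s \<in> S" "u \<in> U" "y \<bullet> s = \<iota> u"
      and tv: "t \<in> S" "v \<in> V" "y \<bullet> t = \<iota> v"
      using \<open>y \<in> saturation U\<close> \<open>y \<in> saturation V\<close> by (auto simp: saturation_def)
    have "\<iota> (u \<star> t) = y \<bullet> s \<bullet> t" using su tv UN by (simp add: iota_act)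
    also have "\<dots> = \<iota> (v \<star> s)"
      using su tv VN act_commute1[of y s t] by (simp add: iota_act)
    finally obtain b where b: "b \<in> S" "u \<star> t \<star> b = v \<star> s \<star> b"
      using iota_eqD[of "u \<star> t" "v \<star> s"] su tv UN VN N0.ract_closed by auto
    have "u \<star> t \<star> b \<in> U \<inter> V" using su tv b U(5) V(5) by (metis IntI S_in_carrier)
    then have "u \<star> t \<star> b = \<zero>\<^bsub>N0\<^esub>" using UV(1) by blast
    then have "\<iota> u \<bullet> t \<bullet> b = \<zero>\<^bsub>N1\<^esub>"
      using iota_act[of u t] iota_act[of "u \<star> t" b] su tv b UN N0.ract_closed iota.hom_zero
      by (metis S_in_carrier)
    then have "y \<bullet> s \<bullet> t \<bullet> b = \<zero>\<^bsub>N1\<^esub>" using su by simp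
    then show ?thesis using unit_inj su tv b N1.ract_closed by (metis S_in_carrier)
  qed
  have sum: "y \<in> saturation U <+>\<^bsub>N1\<^esub> saturation V" if y: "y \<in> carrier N1" for y
  proof -
    obtain s x where sx: "s \<in> S" "x \<in> carrier N0" "y \<bullet> s = \<iota> x"
      using cokernel_torsion[OF y] by blast
    have "x \<in> U <+>\<^bsub>N0\<^esub> V" using sx(2) UV(2) by simp
    then obtain u v where uv: "u \<in> U" "v \<in> V" "x = u \<oplus>\<^bsub>N0\<^esub> v"
      by (auto simp: set_add_def')
    obtain p where p: "p \<in> carrier N1" "\<iota> u = p \<bullet> s"
      using unit_surj[OF sx(1) iota.hom_closed[OF UN[OF uv(1)]]] by blast
    obtain r where r: "r \<in> carrier N1" "\<iota> v = r \<bullet> s"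
      using unit_surj[OF sx(1) iota.hom_closed[OF VN[OF uv(2)]]] by blast
    have "y \<bullet> s = (p \<oplus>\<^bsub>N1\<^esub> r) \<bullet> s"
      using sx uv UN VN p r by (simp add: N1.ract_l_distr)
    then have "y = p \<oplus>\<^bsub>N1\<^esub> r" using act_cancel[OF sx(1) y] p r by simp
    moreover have "p \<in> saturation U" "r \<in> saturation V"
      using p r uv sx(1) by (force simp: saturation_def)+
    ultimately show ?thesis by (auto simp: set_add_def')
  qed
  have "saturation U \<inter> saturation V = {\<zero>\<^bsub>N1\<^esub>}" using int zero by blast
  moreover have "saturation U <+>\<^bsub>N1\<^esub> saturation V = carrier N1"
    using sum sub by (auto simp: set_add_def')
  ultimately show ?thesis using sU sV unfolding direct_summand_def by blast
qed

end


section \<open>Fractions as elements of the target\<close>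

locale localised_fractions = localisation_map R N0 N1 S \<iota> + X: graded_right_module R X "rdeg R"
  for R :: "('r, 'z) graded_ring_scheme" (structure)
    and N0 :: "('r, 'm) graded_module" and N1 :: "('r, 'n) graded_module" and S \<iota>
    and X :: "('r, 'x) graded_module" +
  fixes P :: "'r set" and U :: "'m set" and \<theta> :: "'x \<Rightarrow> 'm"
  assumes S_eq: "S = even_complement R P"
    and U: "graded_submodule R N0 U"
    and theta: "\<theta> \<in> graded_iso R X (restrict_module N0 U)"
begin

lemma theta_bij: "bij_betw \<theta> (carrier X) U"
  and theta_add: "\<lbrakk>x \<in> carrier X; y \<in> carrier X\<rbrakk> \<Longrightarrow> \<theta> (x \<oplus>\<^bsub>X\<^esub> y) = \<theta> x \<oplus>\<^bsub>N0\<^esub> \<theta> y"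
  and theta_act: "\<lbrakk>x \<in> carrier X; a \<in> carrier R\<rbrakk> \<Longrightarrow> \<theta> (x \<triangleleft>\<^bsub>X\<^esub> a) = \<theta> x \<star> a"
  and theta_degree: "\<theta> ` mdeg X n = mdeg N0 n \<inter> U"
  using theta by (auto simp: graded_iso_def restrict_module_def)

lemma theta_U: "x \<in> carrier X \<Longrightarrow> \<theta> x \<in> U"
  using theta_bij by (auto simp: bij_betw_def)

lemma theta_closed [simp]: "x \<in> carrier X \<Longrightarrow> \<theta> x \<in> carrier N0"
  using theta_U graded_submoduleD(1)[OF U] by blast

text \<open>
  The value of the fraction \<open>x / s\<close> in \<open>N1\<close>.
\<close>

definition quotient :: "'x \<Rightarrow> 'r \<Rightarrow> 'n" where
  "quotient x s = (THE y. y \<in> carrier N1 \<and> y \<bullet> s = \<iota> (\<theta> x))"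

lemma quotient_eqI:
  assumes "x \<in> carrier X" "s \<in> S" "y \<in> carrier N1" "y \<bullet> s = \<iota> (\<theta> x)"
  shows "quotient x s = y"
  unfolding quotient_def using assms act_cancel by (intro the_equality) auto

lemma quotient_closed: "\<lbrakk>x \<in> carrier X; s \<in> S\<rbrakk> \<Longrightarrow> quotient x s \<in> carrier N1"
  and quotient_act: "\<lbrakk>x \<in> carrier X; s \<in> S\<rbrakk> \<Longrightarrow> quotient x s \<bullet> s = \<iota> (\<theta> x)"
  using quotient_eqI unit_surj[of s "\<iota> (\<theta> x)"] by fastforce+

text \<open>
  This is the equivalence relation of \<open>fraction\<close>: equality of values means equality of cross products
  in \<open>N1\<close>, which can be lifted to \<open>X\<close> at the cost of a factor \<open>u\<close> since the kernel of \<open>\<iota>\<close> is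
  torsion and \<open>\<theta>\<close> is injective.
\<close>

lemma quotient_eq_iff:
  assumes x: "x \<in> carrier X" "s \<in> S" and y: "y \<in> carrier X" "t \<in> S"
  shows "quotient x s = quotient y t \<longleftrightarrow>
    (\<exists>u\<in>S. x \<triangleleft>\<^bsub>X\<^esub> t \<triangleleft>\<^bsub>X\<^esub> u = y \<triangleleft>\<^bsub>X\<^esub> s \<triangleleft>\<^bsub>X\<^esub> u)"
proof
  let ?p = "quotient x s" and ?q = "quotient y t"
  note p = quotient_closed[OF x] quotient_act[OF x] and q = quotient_closed[OF y] quotient_act[OF y]
  {
    assume "?p = ?q"
    then have "\<iota> (\<theta> x) \<bullet> t = \<iota> (\<theta> y) \<bullet> s"
      using act_commute1[of ?p s t] p q x y by simp
    then have "\<iota> (\<theta> x \<star> t) = \<iota> (\<theta> y \<star> s)" using x y by (simp add: iota_act)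
    then obtain u where u: "u \<in> S" "\<theta> x \<star> t \<star> u = \<theta> y \<star> s \<star> u"
      using iota_eqD[of "\<theta> x \<star> t" "\<theta> y \<star> s"] x y N0.ract_closed by auto
    then have "\<theta> (x \<triangleleft>\<^bsub>X\<^esub> t \<triangleleft>\<^bsub>X\<^esub> u) = \<theta> (y \<triangleleft>\<^bsub>X\<^esub> s \<triangleleft>\<^bsub>X\<^esub> u)"
      using x y by (simp add: theta_act X.ract_closed)
    then have "x \<triangleleft>\<^bsub>X\<^esub> t \<triangleleft>\<^bsub>X\<^esub> u = y \<triangleleft>\<^bsub>X\<^esub> s \<triangleleft>\<^bsub>X\<^esub> u"
      using theta_bij x y u X.ract_closed by (auto simp: bij_betw_def inj_on_def)
    then show "\<exists>u\<in>S. x \<triangleleft>\<^bsub>X\<^esub> t \<triangleleft>\<^bsub>X\<^esub> u = y \<triangleleft>\<^bsub>X\<^esub> s \<triangleleft>\<^bsub>X\<^esub> u" using u by blast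
  next
    assume "\<exists>u\<in>S. x \<triangleleft>\<^bsub>X\<^esub> t \<triangleleft>\<^bsub>X\<^esub> u = y \<triangleleft>\<^bsub>X\<^esub> s \<triangleleft>\<^bsub>X\<^esub> u"
    then obtain u where u: "u \<in> S" "\<iota> (\<theta> (x \<triangleleft>\<^bsub>X\<^esub> t \<triangleleft>\<^bsub>X\<^esub> u)) = \<iota> (\<theta> (y \<triangleleft>\<^bsub>X\<^esub> s \<triangleleft>\<^bsub>X\<^esub> u))"
      by metis
    then have "\<iota> (\<theta> x) \<bullet> t \<bullet> u = \<iota> (\<theta> y) \<bullet> s \<bullet> u"
      using x y by (simp add: theta_act iota_act X.ract_closed N0.ract_closed)
    then have "\<iota> (\<theta> x) \<bullet> t = \<iota> (\<theta> y) \<bullet> s"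
      using act_cancel[OF u(1)] x y N1.ract_closed by simp
    then have "?p \<bullet> s \<bullet> t = ?q \<bullet> s \<bullet> t"
      using p q x y act_commute1[of ?q s t] by simp
    then show "?p = ?q" using act_cancel p q x y N1.ract_closed by (metis S_in_carrier)
  }
qed

text \<open>
  Fractions are the fibres of \<open>quotient\<close>.  The sum and the action on fractions are unions over all
  representatives, and so they are computed by any one of them.
\<close>

lemma fraction_eq_fibre:
  assumes "x \<in> carrier X" "s \<in> S"
  shows "fraction X S x s = {(y, t). y \<in> carrier X \<and> t \<in> S \<and> quotient y t = quotient x s}"
proof -
  have "quotient y t = quotient x s \<longleftrightarrow> (\<exists>u\<in>S. x \<triangleleft>\<^bsub>X\<^esub> t \<triangleleft>\<^bsub>X\<^esub> u = y \<triangleleft>\<^bsub>X\<^esub> s \<triangleleft>\<^bsub>X\<^esub> u)"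
    if "y \<in> carrier X" "t \<in> S" for y t
    using quotient_eq_iff[OF assms that] by metis
  then show ?thesis by (auto simp: fraction_def)
qed

lemma UN_fraction:
  assumes "x \<in> carrier X" "s \<in> S"
    and "\<And>y t. \<lbrakk>y \<in> carrier X; t \<in> S; quotient y t = quotient x s\<rbrakk> \<Longrightarrow> F y t = c"
  shows "(\<Union>(y, t)\<in>fraction X S x s. F y t) = c"
proof -
  have "F y t = c" if "(y, t) \<in> fraction X S x s" for y t
    using that assms(3) by (simp add: fraction_eq_fibre[OF assms(1,2)])
  moreover have "(x, s) \<in> fraction X S x s"
    using assms by (simp add: fraction_eq_fibre)
  ultimately show ?thesis by fast
qed

lemma quotient_add:
  assumes x: "x \<in> carrier X" "s \<in> S" and y: "y \<in> carrier X" "t \<in> S"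
  shows "quotient (x \<triangleleft>\<^bsub>X\<^esub> t \<oplus>\<^bsub>X\<^esub> y \<triangleleft>\<^bsub>X\<^esub> s) (s \<otimes> t) = quotient x s \<oplus>\<^bsub>N1\<^esub> quotient y t"
proof (rule quotient_eqI)
  let ?p = "quotient x s" and ?q = "quotient y t"
  note p = quotient_closed[OF x] quotient_act[OF x] and q = quotient_closed[OF y] quotient_act[OF y]
  have "(?p \<oplus>\<^bsub>N1\<^esub> ?q) \<bullet> (s \<otimes> t) = ?p \<bullet> s \<bullet> t \<oplus>\<^bsub>N1\<^esub> ?q \<bullet> t \<bullet> s"
    using p(1) q(1) x(2) y(2)
    by (simp add: N1.ract_l_distr N1.ract_assoc N1.ract_closed act_commute1[of ?q s t])
  also have "\<dots> = \<iota> (\<theta> (x \<triangleleft>\<^bsub>X\<^esub> t \<oplus>\<^bsub>X\<^esub> y \<triangleleft>\<^bsub>X\<^esub> s))"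
    using p q x y by (simp add: theta_add theta_act iota_act X.ract_closed N0.ract_closed)
  finally show "(?p \<oplus>\<^bsub>N1\<^esub> ?q) \<bullet> (s \<otimes> t) = \<iota> (\<theta> (x \<triangleleft>\<^bsub>X\<^esub> t \<oplus>\<^bsub>X\<^esub> y \<triangleleft>\<^bsub>X\<^esub> s))" .
qed (use assms quotient_closed in \<open>auto simp: S_mult X.ract_closed\<close>)

lemma quotient_act_ring:
  assumes x: "x \<in> carrier X" "s \<in> S" and a: "a \<in> carrier R"
  shows "quotient (x \<triangleleft>\<^bsub>X\<^esub> a) s = quotient x s \<bullet> a"
proof (rule quotient_eqI)
  have "quotient x s \<bullet> a \<bullet> s = quotient x s \<bullet> s \<bullet> a"
    using act_commute1[of "quotient x s" s a] quotient_closed[OF x] x a by simp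
  also have "\<dots> = \<iota> (\<theta> (x \<triangleleft>\<^bsub>X\<^esub> a))"
    using x a by (simp add: quotient_act theta_act iota_act)
  finally show "quotient x s \<bullet> a \<bullet> s = \<iota> (\<theta> (x \<triangleleft>\<^bsub>X\<^esub> a))" .
qed (use assms quotient_closed in \<open>auto simp: X.ract_closed N1.ract_closed\<close>)

definition value_of :: "('x \<times> 'r) set \<Rightarrow> 'n" where
  "value_of \<xi> = the_elem ((\<lambda>(y, t). quotient y t) ` \<xi>)"

lemma value_of_fraction:
  assumes "x \<in> carrier X" "s \<in> S" shows "value_of (fraction X S x s) = quotient x s"
proof -
  have "(\<lambda>(y, t). quotient y t) ` fraction X S x s = {quotient x s}"
    using assms by (auto simp: fraction_eq_fibre intro!: image_eqI[of _ _ "(x, s)"])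
  then show ?thesis by (simp add: value_of_def)
qed

lemma localise_simps:
  "carrier (localise R P X) = {fraction X S x s | x s. x \<in> carrier X \<and> s \<in> S}"
  "mdeg (localise R P X) n = {fraction X S x s | x s i j.
     x \<in> mdeg X i \<and> s \<in> S \<and> s \<in> rdeg R j \<and> n = i - j}"
  by (auto simp: localise_def Let_def S_eq)

lemma localise_add:
  assumes x: "x \<in> carrier X" "s \<in> S" and y: "y \<in> carrier X" "t \<in> S"
  shows "fraction X S x s \<oplus>\<^bsub>localise R P X\<^esub> fraction X S y t
    = fraction X S (x \<triangleleft>\<^bsub>X\<^esub> t \<oplus>\<^bsub>X\<^esub> y \<triangleleft>\<^bsub>X\<^esub> s) (s \<otimes> t)"
proof -
  have "fraction X S x s \<oplus>\<^bsub>localise R P X\<^esub> fraction X S y t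
    = (\<Union>(x', s')\<in>fraction X S x s. \<Union>(y', t')\<in>fraction X S y t.
        fraction X S (x' \<triangleleft>\<^bsub>X\<^esub> t' \<oplus>\<^bsub>X\<^esub> y' \<triangleleft>\<^bsub>X\<^esub> s') (s' \<otimes> t'))"
    by (simp add: localise_def Let_def S_eq)
  also have "\<dots> = fraction X S (x \<triangleleft>\<^bsub>X\<^esub> t \<oplus>\<^bsub>X\<^esub> y \<triangleleft>\<^bsub>X\<^esub> s) (s \<otimes> t)"
    using assms
    by (intro UN_fraction assms) (simp add: fraction_eq_fibre quotient_add S_mult X.ract_closed)
  finally show ?thesis .
qed

lemma localise_act:
  assumes x: "x \<in> carrier X" "s \<in> S" and a: "a \<in> carrier R"
  shows "fraction X S x s \<triangleleft>\<^bsub>localise R P X\<^esub> a = fraction X S (x \<triangleleft>\<^bsub>X\<^esub> a) s"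
proof -
  have "fraction X S x s \<triangleleft>\<^bsub>localise R P X\<^esub> a
    = (\<Union>(x', s')\<in>fraction X S x s. fraction X S (x' \<triangleleft>\<^bsub>X\<^esub> a) s')"
    by (simp add: localise_def Let_def S_eq)
  also have "\<dots> = fraction X S (x \<triangleleft>\<^bsub>X\<^esub> a) s"
    using assms
    by (intro UN_fraction assms) (simp add: fraction_eq_fibre quotient_act_ring X.ract_closed)
  finally show ?thesis .
qed

lemma quotient_in_saturation: "x \<in> carrier X \<Longrightarrow> s \<in> S \<Longrightarrow> quotient x s \<in> saturation U"
  using quotient_closed quotient_act theta_U unfolding saturation_def by blast

lemma value_of_bij: "bij_betw value_of (carrier (localise R P X)) (saturation U)"
proof (rule bij_betwI')
  fix \<xi> \<eta> assume "\<xi> \<in> carrier (localise R P X)" "\<eta> \<in> carrier (localise R P X)"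
  then obtain x s y t where xy: "\<xi> = fraction X S x s" "x \<in> carrier X" "s \<in> S"
      "\<eta> = fraction X S y t" "y \<in> carrier X" "t \<in> S"
    by (auto simp: localise_simps)
  then have "\<xi> = \<eta>" if "quotient x s = quotient y t"
    using that by (simp add: fraction_eq_fibre)
  then show "value_of \<xi> = value_of \<eta> \<longleftrightarrow> \<xi> = \<eta>"
    using xy value_of_fraction by metis
next
  fix \<xi> assume "\<xi> \<in> carrier (localise R P X)"
  then show "value_of \<xi> \<in> saturation U"
    by (auto simp: localise_simps value_of_fraction quotient_in_saturation)
next
  fix y assume "y \<in> saturation U"
  then obtain s u where su: "y \<in> carrier N1" "s \<in> S" "u \<in> U" "y \<bullet> s = \<iota> u"
    by (auto simp: saturation_def)
  then obtain x where x: "x \<in> carrier X" "u = \<theta> x" using theta_bij by (auto simp: bij_betw_def)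
  have "y = value_of (fraction X S x s)"
    using su x quotient_eqI value_of_fraction by simp
  then show "\<exists>\<xi>\<in>carrier (localise R P X). y = value_of \<xi>"
    using x su by (auto simp: localise_simps)
qed

lemma value_of_degree: "value_of ` mdeg (localise R P X) n = mdeg N1 n \<inter> saturation U"
proof (intro equalityI subsetI)
  have Xc: "x \<in> carrier X" if "x \<in> mdeg X i" for x i
    using graded_group.degree_carrier[OF X.graded_group_M that] .
  {
    fix y assume "y \<in> value_of ` mdeg (localise R P X) n"
    then obtain x s i j where x: "y = value_of (fraction X S x s)" "x \<in> mdeg X i" "s \<in> S"
        "s \<in> rdeg R j" "n = i - j"
      by (auto simp: localise_simps)
    have y: "y = quotient x s" using x Xc value_of_fraction by blast
    have "\<theta> x \<in> mdeg N0 i" using theta_degree[of i] x(2) by blast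
    then have "quotient x s \<bullet> s \<in> mdeg N1 (n + j)"
      using quotient_act[OF Xc[OF x(2)] x(3)] iota_degree x(5) by simp
    then have "quotient x s \<in> mdeg N1 n"
      using degree_cancel[OF x(3,4)] quotient_closed[OF Xc[OF x(2)] x(3)] by blast
    then show "y \<in> mdeg N1 n \<inter> saturation U"
      using y quotient_in_saturation[OF Xc[OF x(2)] x(3)] by simp
  next
    fix y assume y: "y \<in> mdeg N1 n \<inter> saturation U"
    then obtain s u where su: "y \<in> carrier N1" "s \<in> S" "u \<in> U" "y \<bullet> s = \<iota> u"
      by (auto simp: saturation_def)
    obtain j where j: "s \<in> rdeg R j" using S_degree su(2) by blast
    let ?u = "G0.cp (n + j) u"
    have uc: "u \<in> carrier N0" using su(3) graded_submoduleD(1)[OF U] by blast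
    have "?u \<in> mdeg N0 (n + j) \<inter> U"
      using G0.component_degree[OF uc] graded_submoduleD(6)[OF U su(3)] by blast
    then obtain x where x: "x \<in> mdeg X (n + j)" "\<theta> x = ?u" using theta_degree by (metis imageE)
    have "y \<bullet> s \<in> mdeg N1 (n + j)" using y j N1.ract_mdeg by blast
    then have "\<iota> ?u = y \<bullet> s"
      using iota_component[OF uc, of "n + j"] su(4) by (simp add: G1.component_of_degree)
    then have "quotient x s = y" using quotient_eqI[OF Xc[OF x(1)] su(2,1)] x(2) by simp
    then have "y = value_of (fraction X S x s)"
      using value_of_fraction[OF Xc[OF x(1)] su(2)] by simp
    moreover have "fraction X S x s \<in> mdeg (localise R P X) n"
      using x(1) su(2) j unfolding localise_simps by force
    ultimately show "y \<in> value_of ` mdeg (localise R P X) n" by blast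
  }
qed

lemma localise_iso: "value_of \<in> graded_iso R (localise R P X) (restrict_module N1 (saturation U))"
  unfolding graded_iso_def mem_Collect_eq
proof (intro conjI ballI allI)
  show "bij_betw value_of (carrier (localise R P X)) (carrier (restrict_module N1 (saturation U)))"
    using value_of_bij by (simp add: restrict_module_def)
  show "value_of ` mdeg (localise R P X) n = mdeg (restrict_module N1 (saturation U)) n" for n
    using value_of_degree by (simp add: restrict_module_def)
next
  fix \<xi> \<eta> assume "\<xi> \<in> carrier (localise R P X)" "\<eta> \<in> carrier (localise R P X)"
  then show "value_of (\<xi> \<oplus>\<^bsub>localise R P X\<^esub> \<eta>)
      = value_of \<xi> \<oplus>\<^bsub>restrict_module N1 (saturation U)\<^esub> value_of \<eta>"
    by (auto simp: localise_simps localise_add value_of_fraction X.ract_closed S_mult quotient_add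
        restrict_module_def)
next
  fix \<xi> a assume "\<xi> \<in> carrier (localise R P X)" "a \<in> carrier R"
  then show "value_of (\<xi> \<triangleleft>\<^bsub>localise R P X\<^esub> a)
      = value_of \<xi> \<triangleleft>\<^bsub>restrict_module N1 (saturation U)\<^esub> a"
    by (auto simp: localise_simps localise_act value_of_fraction X.ract_closed quotient_act_ring
        restrict_module_def)
qed

end

section \<open>Attaching one cell\<close>

lemma (in abelian_group) ksign_ksign [simp]: "x \<in> carrier G \<Longrightarrow> ksign G n (ksign G n x) = x"
  by (simp add: ksign_def)

lemma (in abelian_group) ksign_eq_zero_iff [simp]:
  assumes "x \<in> carrier G" shows "ksign G n x = \<zero> \<longleftrightarrow> x = \<zero>"
  using ksign_ksign[OF assms, of n] ksign_zero[of n] by metis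

lemma (in abelian_group_hom) hom_ksign: "x \<in> carrier G \<Longrightarrow> h (ksign G n x) = ksign H n (h x)"
  by (simp add: ksign_def)

lemma (in abelian_group) add_minus_left_cancel:
  "x \<in> carrier G \<Longrightarrow> y \<in> carrier G \<Longrightarrow> (x \<oplus> y) \<ominus> x = y"
  by (simp add: a_minus_def a_comm[of x y] a_assoc r_neg)

lemma (in abelian_group) minus_minus_cancel:
  "x \<in> carrier G \<Longrightarrow> y \<in> carrier G \<Longrightarrow> x \<ominus> (x \<ominus> y) = y"
  by (simp add: a_minus_def minus_add r_neg2)

lemma (in abelian_group) subgroup_minus:
  "additive_subgroup B G \<Longrightarrow> x \<in> B \<Longrightarrow> y \<in> B \<Longrightarrow> x \<ominus> y \<in> B"
  by (simp add: a_minus_def additive_subgroup.a_closed additive_subgroup.a_inv_closed)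

lemma (in abelian_group) subgroup_plus_subgroup:
  assumes U: "additive_subgroup U G" and V: "additive_subgroup V G"
  shows "additive_subgroup {x \<in> carrier G. \<exists>u\<in>U. x \<ominus> u \<in> V} G" (is "additive_subgroup ?T G")
proof (rule additive_subgroupI_add)
  interpret U: additive_subgroup U G by fact
  interpret V: additive_subgroup V G by fact
  have UG: "u \<in> carrier G" if "u \<in> U" for u using that U.a_subset by blast
  show "\<zero> \<in> ?T" by (auto intro!: bexI[of _ \<zero>] simp: minus_zero_iff[THEN iffD2])
  show "x \<oplus> y \<in> ?T" if "x \<in> ?T" "y \<in> ?T" for x y
  proof -
    obtain u v where uv: "x \<in> carrier G" "y \<in> carrier G" "u \<in> U" "v \<in> U" "x \<ominus> u \<in> V" "y \<ominus> v \<in> V"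
      using \<open>x \<in> ?T\<close> \<open>y \<in> ?T\<close> by blast
    have "x \<oplus> y \<ominus> (u \<oplus> v) = (x \<ominus> u) \<oplus> (y \<ominus> v)"
      using uv UG by (simp add: a_minus_def minus_add a_ac)
    then have "x \<oplus> y \<ominus> (u \<oplus> v) \<in> V" using uv by simp
    then show ?thesis using uv by blast
  qed
  show "\<ominus> x \<in> ?T" if x: "x \<in> ?T" for x
  proof -
    obtain u where u: "x \<in> carrier G" "u \<in> U" "x \<ominus> u \<in> V" using x by blast
    have "(\<ominus> x) \<ominus> (\<ominus> u) = \<ominus> (x \<ominus> u)" using u UG by (simp add: a_minus_def minus_add)
    then have "(\<ominus> x) \<ominus> (\<ominus> u) \<in> V" using u by simp
    then show ?thesis using u by blast
  qed
qed auto

lemma (in graded_right_module) act_ksign: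
  "x \<in> carrier M \<Longrightarrow> a \<in> carrier R \<Longrightarrow> x \<triangleleft>\<^bsub>M\<^esub> ksign R n a = ksign M n (x \<triangleleft>\<^bsub>M\<^esub> a)"
  by (rule abelian_group_hom.hom_ksign[OF act_ring_hom])

lemma (in graded_complex) d_ksign: "x \<in> carrier G \<Longrightarrow> d (ksign G n x) = ksign G n (d x)"
  by (rule abelian_group_hom.hom_ksign[OF d_hom])

context dg_module_over
begin

abbreviation "dM \<equiv> mdiff M"
abbreviation "dA \<equiv> adiff A"

lemma d_generator:
  assumes "e \<in> mdeg M p" "\<alpha> \<in> carrier A"
  shows "dM (e \<triangleleft>\<^bsub>M\<^esub> \<alpha>) = dM e \<triangleleft>\<^bsub>M\<^esub> \<alpha> \<oplus>\<^bsub>M\<^esub> e \<triangleleft>\<^bsub>M\<^esub> ksign A p (dA \<alpha>)"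
  using assms Mod.Mc.degree_carrier[OF assms(1)] Alg.adiff_closed
  by (simp add: Mod.mleibniz Mod.act_ksign)

text \<open>
  The key lemma: \<open>e\<close> and \<open>f\<close> generate freely over the dg submodule \<open>N\<close>, so \<open>d x \<in> N\<close> can be read off
  coefficient by coefficient.  It gives \<open>d \<beta> = 0\<close> and makes \<open>a \<beta>\<close>, hence also \<open>\<beta> a\<close>, a coboundary.  Therefore \<open>x a\<close>
  is cohomologous to an element \<open>n1 + e \<alpha>1\<close> without an \<open>f\<close>-part, where \<open>\<alpha>1\<close> is a cocycle.  In a second
  step \<open>e \<alpha>1 a\<close> is cohomologous to \<open>e a \<alpha>1\<close> modulo \<open>N\<close>, and \<open>e a \<alpha>1 = v \<alpha>1 - d (f \<alpha>1)\<close>.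
\<close>

lemma cell_detach:
  assumes N: "additive_subgroup N M" and N_act: "\<And>n \<alpha>. \<lbrakk>n \<in> N; \<alpha> \<in> carrier A\<rbrakk> \<Longrightarrow> n \<triangleleft>\<^bsub>M\<^esub> \<alpha> \<in> N"
    and N_d: "\<And>n. n \<in> N \<Longrightarrow> dM n \<in> N"
    and a: "a \<in> Alg.Ac.Z" and central: "\<And>b. b \<in> Alg.Ac.Z \<Longrightarrow> a \<otimes>\<^bsub>A\<^esub> b \<ominus>\<^bsub>A\<^esub> b \<otimes>\<^bsub>A\<^esub> a \<in> Alg.Ac.B"
    and e: "e \<in> mdeg M p" "dM e = z" "z \<in> N"
    and f: "f \<in> mdeg M q" "dM f = v \<ominus>\<^bsub>M\<^esub> e \<triangleleft>\<^bsub>M\<^esub> a" "v \<in> N"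
    and free: "\<And>n \<alpha> \<beta>. \<lbrakk>n \<in> N; \<alpha> \<in> carrier A; \<beta> \<in> carrier A;
        n \<oplus>\<^bsub>M\<^esub> (e \<triangleleft>\<^bsub>M\<^esub> \<alpha> \<oplus>\<^bsub>M\<^esub> f \<triangleleft>\<^bsub>M\<^esub> \<beta>) \<in> N\<rbrakk> \<Longrightarrow> \<alpha> = \<zero>\<^bsub>A\<^esub> \<and> \<beta> = \<zero>\<^bsub>A\<^esub>"
    and n: "n \<in> N" and \<alpha>: "\<alpha> \<in> carrier A" and \<beta>: "\<beta> \<in> carrier A"
    and x: "x = n \<oplus>\<^bsub>M\<^esub> (e \<triangleleft>\<^bsub>M\<^esub> \<alpha> \<oplus>\<^bsub>M\<^esub> f \<triangleleft>\<^bsub>M\<^esub> \<beta>)" and dx: "dM x \<in> N"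
  shows "\<exists>n'\<in>N. x \<triangleleft>\<^bsub>M\<^esub> a \<triangleleft>\<^bsub>M\<^esub> a \<ominus>\<^bsub>M\<^esub> n' \<in> Mod.Mc.B"
proof -
  interpret N: additive_subgroup N M by fact
  note NM [simp] = subsetD[OF N.a_subset]
  have aA [simp]: "a \<in> carrier A" and da: "dA a = \<zero>\<^bsub>A\<^esub>" using a Alg.Ac.cocycle_iff by blast+
  note [simp] = Mod.Mc.degree_carrier[OF e(1)] Mod.Mc.degree_carrier[OF f(1)] \<alpha> \<beta> Alg.adiff_closed
  note [simp del] = Mod.Mc.cocycle_carrier Mod.Mc.coboundary_carrier
    Alg.Ac.cocycle_carrier Alg.Ac.coboundary_carrier
  have zv [simp]: "z \<in> carrier M" "v \<in> carrier M" using e f NM by blast+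
  \<comment> \<open>\<open>T\<close> is \<open>N\<close> plus coboundaries; the rest of the proof shows \<open>x a a \<in> T\<close>.\<close>
  define T where "T = {t \<in> carrier M. \<exists>n\<in>N. t \<ominus>\<^bsub>M\<^esub> n \<in> Mod.Mc.B}"
  interpret T: additive_subgroup T M
    unfolding T_def by (rule Mod.M.subgroup_plus_subgroup[OF N Mod.Mc.coboundaries_subgroup])
  have TI: "t \<in> T" if "t \<in> carrier M" "n \<in> N" "t \<ominus>\<^bsub>M\<^esub> n \<in> Mod.Mc.B" for t n
    using that unfolding T_def by blast
  have NT: "t \<in> T" if t: "t \<in> N" for t
  proof -
    have "t \<ominus>\<^bsub>M\<^esub> t = \<zero>\<^bsub>M\<^esub>" using Mod.M.minus_zero_iff[of t t] NM[OF t] by blast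
    then show ?thesis using TI[OF NM[OF t] t] Mod.Mc.B.zero_closed by (simp only:)
  qed
  have BT: "dM t \<in> T" if t: "t \<in> carrier M" for t
  proof -
    have c: "dM t \<in> carrier M" using t by simp
    have "dM t \<ominus>\<^bsub>M\<^esub> \<zero>\<^bsub>M\<^esub> \<in> Mod.Mc.B"
      unfolding Mod.Mc.minus_zero[OF c] Mod.Mc.coboundary_iff using t by blast
    then show ?thesis by (rule TI[OF c N.zero_closed])
  qed
  have T_minus: "s \<ominus>\<^bsub>M\<^esub> t \<in> T" if "s \<in> T" "t \<in> T" for s t
    by (rule Mod.M.subgroup_minus[OF T.is_additive_subgroup that])
  have T_act: "t \<triangleleft>\<^bsub>M\<^esub> a \<in> T" if "t \<in> T" for t
  proof -
    obtain m where m: "t \<in> carrier M" "m \<in> N" "t \<ominus>\<^bsub>M\<^esub> m \<in> Mod.Mc.B" using \<open>t \<in> T\<close> unfolding T_def by blast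
    have "t \<triangleleft>\<^bsub>M\<^esub> a \<ominus>\<^bsub>M\<^esub> m \<triangleleft>\<^bsub>M\<^esub> a = (t \<ominus>\<^bsub>M\<^esub> m) \<triangleleft>\<^bsub>M\<^esub> a" using m by (simp add: Mod.act_minus_left)
    also have "\<dots> \<in> Mod.Mc.B" using coboundary_act[OF m(3) a] .
    finally show ?thesis by (rule TI[rotated 2]) (use m N_act aA in simp_all)
  qed
  have d_cell: "dM (k \<oplus>\<^bsub>M\<^esub> (e \<triangleleft>\<^bsub>M\<^esub> \<xi> \<oplus>\<^bsub>M\<^esub> f \<triangleleft>\<^bsub>M\<^esub> \<eta>)) =
      (dM k \<oplus>\<^bsub>M\<^esub> z \<triangleleft>\<^bsub>M\<^esub> \<xi> \<oplus>\<^bsub>M\<^esub> v \<triangleleft>\<^bsub>M\<^esub> \<eta>) \<oplus>\<^bsub>M\<^esub>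
      (e \<triangleleft>\<^bsub>M\<^esub> (ksign A p (dA \<xi>) \<ominus>\<^bsub>A\<^esub> a \<otimes>\<^bsub>A\<^esub> \<eta>) \<oplus>\<^bsub>M\<^esub> f \<triangleleft>\<^bsub>M\<^esub> ksign A q (dA \<eta>))"
    if [simp]: "k \<in> carrier M" "\<xi> \<in> carrier A" "\<eta> \<in> carrier A" for k \<xi> \<eta>
  proof -
    have "dM (e \<triangleleft>\<^bsub>M\<^esub> \<xi>) = z \<triangleleft>\<^bsub>M\<^esub> \<xi> \<oplus>\<^bsub>M\<^esub> e \<triangleleft>\<^bsub>M\<^esub> ksign A p (dA \<xi>)"
      using d_generator[OF e(1), of \<xi>] e(2) by simp
    moreover have "dM (f \<triangleleft>\<^bsub>M\<^esub> \<eta>) = (v \<triangleleft>\<^bsub>M\<^esub> \<eta> \<ominus>\<^bsub>M\<^esub> e \<triangleleft>\<^bsub>M\<^esub> (a \<otimes>\<^bsub>A\<^esub> \<eta>)) \<oplus>\<^bsub>M\<^esub> f \<triangleleft>\<^bsub>M\<^esub> ksign A q (dA \<eta>)"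
      using d_generator[OF f(1), of \<eta>] f(2) by (simp add: Mod.act_minus_left Mod.ract_assoc)
    ultimately show ?thesis
      by (simp add: Mod.Mc.d_add Mod.act_minus_right) (simp add: a_minus_def Mod.M.a_ac)
  qed
  \<comment> \<open>The coefficients of \<open>e\<close> and \<open>f\<close> in \<open>d x\<close> vanish.\<close>
  have B1: "dA \<beta> = \<zero>\<^bsub>A\<^esub>" and B2: "a \<otimes>\<^bsub>A\<^esub> \<beta> = ksign A p (dA \<alpha>)"
  proof -
    have "(dM n \<oplus>\<^bsub>M\<^esub> z \<triangleleft>\<^bsub>M\<^esub> \<alpha> \<oplus>\<^bsub>M\<^esub> v \<triangleleft>\<^bsub>M\<^esub> \<beta>) \<in> N"
      using n e(3) f(3) N_d N_act by simp
    from free[OF this _ _ dx[unfolded x d_cell[OF NM[OF n] \<alpha> \<beta>]]]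
    have "ksign A p (dA \<alpha>) \<ominus>\<^bsub>A\<^esub> a \<otimes>\<^bsub>A\<^esub> \<beta> = \<zero>\<^bsub>A\<^esub> \<and> ksign A q (dA \<beta>) = \<zero>\<^bsub>A\<^esub>"
      by simp
    then show "dA \<beta> = \<zero>\<^bsub>A\<^esub>" "a \<otimes>\<^bsub>A\<^esub> \<beta> = ksign A p (dA \<alpha>)"
      using Alg.minus_zero_iff[of "ksign A p (dA \<alpha>)" "a \<otimes>\<^bsub>A\<^esub> \<beta>"] by simp_all
  qed
  obtain \<gamma>0 where \<gamma>0: "\<gamma>0 \<in> carrier A" "\<beta> \<otimes>\<^bsub>A\<^esub> a = dA \<gamma>0"
  proof -
    have "a \<otimes>\<^bsub>A\<^esub> \<beta> = dA (ksign A p \<alpha>)" by (simp add: B2 Alg.Ac.d_ksign)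
    then have "a \<otimes>\<^bsub>A\<^esub> \<beta> \<in> Alg.Ac.B" using Alg.Ac.coboundary_iff by auto
    moreover have "a \<otimes>\<^bsub>A\<^esub> \<beta> \<ominus>\<^bsub>A\<^esub> \<beta> \<otimes>\<^bsub>A\<^esub> a \<in> Alg.Ac.B"
      using B1 by (intro central) (simp add: Alg.Ac.cocycle_iff)
    ultimately have "a \<otimes>\<^bsub>A\<^esub> \<beta> \<ominus>\<^bsub>A\<^esub> (a \<otimes>\<^bsub>A\<^esub> \<beta> \<ominus>\<^bsub>A\<^esub> \<beta> \<otimes>\<^bsub>A\<^esub> a) \<in> Alg.Ac.B"
      by (rule Alg.subgroup_minus[OF Alg.Ac.coboundaries_subgroup])
    moreover have "a \<otimes>\<^bsub>A\<^esub> \<beta> \<ominus>\<^bsub>A\<^esub> (a \<otimes>\<^bsub>A\<^esub> \<beta> \<ominus>\<^bsub>A\<^esub> \<beta> \<otimes>\<^bsub>A\<^esub> a) = \<beta> \<otimes>\<^bsub>A\<^esub> a"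
      by (simp add: Alg.minus_minus_cancel)
    ultimately show ?thesis using that Alg.Ac.coboundary_iff by auto
  qed
  \<comment> \<open>The sign cancels the one in the Leibniz rule for \<open>f \<gamma>\<close>.\<close>
  define \<gamma> where "\<gamma> = ksign A q \<gamma>0"
  have \<gamma> [simp]: "\<gamma> \<in> carrier A" and d\<gamma>: "ksign A q (dA \<gamma>) = \<beta> \<otimes>\<^bsub>A\<^esub> a"
    using \<gamma>0 by (simp_all add: \<gamma>_def Alg.Ac.d_ksign)
  define n1 where "n1 = n \<triangleleft>\<^bsub>M\<^esub> a \<ominus>\<^bsub>M\<^esub> v \<triangleleft>\<^bsub>M\<^esub> \<gamma>"
  define \<alpha>1 where "\<alpha>1 = \<alpha> \<otimes>\<^bsub>A\<^esub> a \<oplus>\<^bsub>A\<^esub> a \<otimes>\<^bsub>A\<^esub> \<gamma>"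
  have n1: "n1 \<in> N" unfolding n1_def using n f(3) N_act by (intro Mod.M.subgroup_minus[OF N]) simp_all
  have \<alpha>1 [simp]: "\<alpha>1 \<in> carrier A" by (simp add: \<alpha>1_def)
  note [simp] = NM[OF n] NM[OF n1]
  have xM [simp]: "x \<in> carrier M" by (simp add: x)
  define x1 where "x1 = n1 \<oplus>\<^bsub>M\<^esub> e \<triangleleft>\<^bsub>M\<^esub> \<alpha>1"
  have x1: "x \<triangleleft>\<^bsub>M\<^esub> a = x1 \<oplus>\<^bsub>M\<^esub> dM (f \<triangleleft>\<^bsub>M\<^esub> \<gamma>)"
  proof -
    have "dM (f \<triangleleft>\<^bsub>M\<^esub> \<gamma>) = (v \<triangleleft>\<^bsub>M\<^esub> \<gamma> \<ominus>\<^bsub>M\<^esub> e \<triangleleft>\<^bsub>M\<^esub> (a \<otimes>\<^bsub>A\<^esub> \<gamma>)) \<oplus>\<^bsub>M\<^esub> f \<triangleleft>\<^bsub>M\<^esub> (\<beta> \<otimes>\<^bsub>A\<^esub> a)"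
      using d_generator[OF f(1), of \<gamma>] f(2) d\<gamma> by (simp add: Mod.act_minus_left Mod.ract_assoc)
    moreover have "x \<triangleleft>\<^bsub>M\<^esub> a = n \<triangleleft>\<^bsub>M\<^esub> a \<oplus>\<^bsub>M\<^esub> (e \<triangleleft>\<^bsub>M\<^esub> (\<alpha> \<otimes>\<^bsub>A\<^esub> a) \<oplus>\<^bsub>M\<^esub> f \<triangleleft>\<^bsub>M\<^esub> (\<beta> \<otimes>\<^bsub>A\<^esub> a))"
      by (simp add: x Mod.ract_l_distr Mod.ract_assoc)
    moreover have "(p1 \<oplus>\<^bsub>M\<^esub> \<ominus>\<^bsub>M\<^esub> p2 \<oplus>\<^bsub>M\<^esub> (p3 \<oplus>\<^bsub>M\<^esub> p4)) \<oplus>\<^bsub>M\<^esub> ((p2 \<oplus>\<^bsub>M\<^esub> \<ominus>\<^bsub>M\<^esub> p4) \<oplus>\<^bsub>M\<^esub> p5) =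
        p1 \<oplus>\<^bsub>M\<^esub> (p3 \<oplus>\<^bsub>M\<^esub> p5)"
      if "p1 \<in> carrier M" "p2 \<in> carrier M" "p3 \<in> carrier M" "p4 \<in> carrier M" "p5 \<in> carrier M"
      for p1 p2 p3 p4 p5
    proof -
      have "(p1 \<oplus>\<^bsub>M\<^esub> \<ominus>\<^bsub>M\<^esub> p2 \<oplus>\<^bsub>M\<^esub> (p3 \<oplus>\<^bsub>M\<^esub> p4)) \<oplus>\<^bsub>M\<^esub> ((p2 \<oplus>\<^bsub>M\<^esub> \<ominus>\<^bsub>M\<^esub> p4) \<oplus>\<^bsub>M\<^esub> p5) =
        (\<ominus>\<^bsub>M\<^esub> p2 \<oplus>\<^bsub>M\<^esub> p2) \<oplus>\<^bsub>M\<^esub> ((\<ominus>\<^bsub>M\<^esub> p4 \<oplus>\<^bsub>M\<^esub> p4) \<oplus>\<^bsub>M\<^esub> (p1 \<oplus>\<^bsub>M\<^esub> (p3 \<oplus>\<^bsub>M\<^esub> p5)))"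
        using that by (simp only: Mod.M.a_ac Mod.M.a_closed Mod.M.a_inv_closed)
      then show ?thesis using that by (simp add: Mod.M.l_neg)
    qed
    ultimately show ?thesis
      by (simp add: x1_def n1_def \<alpha>1_def Mod.ract_r_distr a_minus_def)
  qed
  have x1M [simp]: "x1 \<in> carrier M" by (simp add: x1_def)
  have d\<alpha>1: "dA \<alpha>1 = \<zero>\<^bsub>A\<^esub>"
  proof -
    have "dM (x \<triangleleft>\<^bsub>M\<^esub> a) \<in> N" using dx N_act by (simp add: Mod.d_act_cocycle da)
    then have "dM x1 \<in> N" by (simp add: x1 Mod.Mc.d_add Mod.Mc.d_d)
    moreover have "dM x1 = (dM n1 \<oplus>\<^bsub>M\<^esub> z \<triangleleft>\<^bsub>M\<^esub> \<alpha>1) \<oplus>\<^bsub>M\<^esub>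
        (e \<triangleleft>\<^bsub>M\<^esub> ksign A p (dA \<alpha>1) \<oplus>\<^bsub>M\<^esub> f \<triangleleft>\<^bsub>M\<^esub> \<zero>\<^bsub>A\<^esub>)"
      using d_generator[OF e(1) \<alpha>1] e(2)
      by (simp add: x1_def Mod.Mc.d_add Mod.act_zero_right Mod.M.a_assoc)
    ultimately have mem: "(dM n1 \<oplus>\<^bsub>M\<^esub> z \<triangleleft>\<^bsub>M\<^esub> \<alpha>1) \<oplus>\<^bsub>M\<^esub>
        (e \<triangleleft>\<^bsub>M\<^esub> ksign A p (dA \<alpha>1) \<oplus>\<^bsub>M\<^esub> f \<triangleleft>\<^bsub>M\<^esub> \<zero>\<^bsub>A\<^esub>) \<in> N" by (simp only:)
    have "dM n1 \<oplus>\<^bsub>M\<^esub> z \<triangleleft>\<^bsub>M\<^esub> \<alpha>1 \<in> N" using n1 e(3) N_d N_act by simp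
    from free[OF this _ _ mem] have "ksign A p (dA \<alpha>1) = \<zero>\<^bsub>A\<^esub>" by simp
    then show ?thesis by simp
  qed
  obtain \<delta>0 where \<delta>0: "\<delta>0 \<in> carrier A" "a \<otimes>\<^bsub>A\<^esub> \<alpha>1 \<ominus>\<^bsub>A\<^esub> \<alpha>1 \<otimes>\<^bsub>A\<^esub> a = dA \<delta>0"
    using central[of \<alpha>1] d\<alpha>1 Alg.Ac.coboundary_iff Alg.Ac.cocycle_iff by auto
  have ed: "e \<triangleleft>\<^bsub>M\<^esub> dA \<delta>0 \<in> T"
  proof -
    let ?\<delta> = "ksign A p \<delta>0"
    have "dM (e \<triangleleft>\<^bsub>M\<^esub> ?\<delta>) = z \<triangleleft>\<^bsub>M\<^esub> ?\<delta> \<oplus>\<^bsub>M\<^esub> e \<triangleleft>\<^bsub>M\<^esub> dA \<delta>0"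
      using d_generator[OF e(1), of ?\<delta>] e(2) \<delta>0 by (simp add: Alg.Ac.d_ksign)
    then have "e \<triangleleft>\<^bsub>M\<^esub> dA \<delta>0 = dM (e \<triangleleft>\<^bsub>M\<^esub> ?\<delta>) \<ominus>\<^bsub>M\<^esub> z \<triangleleft>\<^bsub>M\<^esub> ?\<delta>"
      using \<delta>0(1) by (simp add: Mod.M.add_minus_left_cancel)
    then show ?thesis
      using T_minus[OF BT NT, of "e \<triangleleft>\<^bsub>M\<^esub> ?\<delta>" "z \<triangleleft>\<^bsub>M\<^esub> ?\<delta>"] \<delta>0(1) e(3) N_act by simp
  qed
  have ea: "e \<triangleleft>\<^bsub>M\<^esub> (a \<otimes>\<^bsub>A\<^esub> \<alpha>1) \<in> T"
  proof -
    have "dM (f \<triangleleft>\<^bsub>M\<^esub> \<alpha>1) = v \<triangleleft>\<^bsub>M\<^esub> \<alpha>1 \<ominus>\<^bsub>M\<^esub> e \<triangleleft>\<^bsub>M\<^esub> (a \<otimes>\<^bsub>A\<^esub> \<alpha>1)"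
      using d_generator[OF f(1) \<alpha>1] f(2) d\<alpha>1
      by (simp add: Mod.act_minus_left Mod.ract_assoc Mod.act_zero_right)
    then have "e \<triangleleft>\<^bsub>M\<^esub> (a \<otimes>\<^bsub>A\<^esub> \<alpha>1) = v \<triangleleft>\<^bsub>M\<^esub> \<alpha>1 \<ominus>\<^bsub>M\<^esub> dM (f \<triangleleft>\<^bsub>M\<^esub> \<alpha>1)"
      by (simp add: Mod.M.minus_minus_cancel)
    then show ?thesis
      using T_minus[OF NT BT, of "v \<triangleleft>\<^bsub>M\<^esub> \<alpha>1" "f \<triangleleft>\<^bsub>M\<^esub> \<alpha>1"] f(3) N_act by simp
  qed
  have "e \<triangleleft>\<^bsub>M\<^esub> \<alpha>1 \<triangleleft>\<^bsub>M\<^esub> a = e \<triangleleft>\<^bsub>M\<^esub> (a \<otimes>\<^bsub>A\<^esub> \<alpha>1) \<ominus>\<^bsub>M\<^esub> e \<triangleleft>\<^bsub>M\<^esub> dA \<delta>0"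
    unfolding \<delta>0(2)[symmetric]
    by (simp add: Mod.act_minus_right Mod.ract_assoc Mod.M.minus_minus_cancel)
  then have "e \<triangleleft>\<^bsub>M\<^esub> \<alpha>1 \<triangleleft>\<^bsub>M\<^esub> a \<in> T" using T_minus[OF ea ed] by simp
  moreover have "n1 \<triangleleft>\<^bsub>M\<^esub> a \<in> T" using n1 N_act by (intro NT) simp
  ultimately have "x1 \<triangleleft>\<^bsub>M\<^esub> a \<in> T"
    using T.a_closed[of "n1 \<triangleleft>\<^bsub>M\<^esub> a" "e \<triangleleft>\<^bsub>M\<^esub> \<alpha>1 \<triangleleft>\<^bsub>M\<^esub> a"] by (simp add: x1_def Mod.ract_l_distr)
  moreover have "dM (f \<triangleleft>\<^bsub>M\<^esub> \<gamma>) \<triangleleft>\<^bsub>M\<^esub> a \<in> T" by (intro T_act BT) simp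
  ultimately have "x \<triangleleft>\<^bsub>M\<^esub> a \<triangleleft>\<^bsub>M\<^esub> a \<in> T"
    using T.a_closed[of "x1 \<triangleleft>\<^bsub>M\<^esub> a" "dM (f \<triangleleft>\<^bsub>M\<^esub> \<gamma>) \<triangleleft>\<^bsub>M\<^esub> a"] by (simp add: x1 Mod.ract_l_distr)
  then show ?thesis unfolding T_def by blast
qed

end


section \<open>Homotopy localisations\<close>

locale graded_prime = dga K A for K and A :: "('k, 'a) dg_algebra" (structure) +
  fixes P :: "'a set set"
  assumes commutative: "graded_commutative (cohom_ring A)"
    and prime: "graded_prime_ideal P (cohom_ring A)"
begin

text \<open>
  Cocycles representing the elements that are inverted.
\<close>

definition denominators :: "'a set" where
  "denominators = {a \<in> Ac.Z. (\<exists>n. even n \<and> a \<in> adeg A n) \<and> Ac.cls a \<notin> P}"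

lemma even_complement_eq: "even_complement (cohom_ring A) P = Ac.cls ` denominators"
  by (auto simp: even_complement_def denominators_def cohom_ring_simps)

lemma denominators_cocycle: "a \<in> denominators \<Longrightarrow> a \<in> Ac.Z"
  by (simp add: denominators_def)

lemma one_denominator: "\<one> \<in> denominators"
proof -
  interpret P: ideal P "cohom_ring A" using prime by (simp add: graded_prime_ideal_def)
  have "Ac.cls \<one> \<notin> P"
    using P.one_imp_carrier prime by (auto simp: cohom_ring_simps(3) graded_prime_ideal_def)
  then show ?thesis using one_adeg one_cocycle by (auto simp: denominators_def)
qed

lemma mult_denominator:
  assumes "a \<in> denominators" "b \<in> denominators" shows "a \<otimes> b \<in> denominators"
proof -
  have ab: "a \<in> Ac.Z" "b \<in> Ac.Z" "Ac.cls a \<notin> P" "Ac.cls b \<notin> P"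
    using assms by (auto simp: denominators_def)
  have "Ac.cls a \<otimes>\<^bsub>cohom_ring A\<^esub> Ac.cls b \<notin> P"
    using prime ab(3,4) HA.cls_closed[OF ab(1)] HA.cls_closed[OF ab(2)]
    unfolding graded_prime_ideal_def by blast
  then have "Ac.cls (a \<otimes> b) \<notin> P" unfolding cls_mult[OF ab(1,2)] .
  moreover have "\<exists>n. even n \<and> a \<otimes> b \<in> adeg A n"
  proof -
    obtain m n where "even m" "a \<in> adeg A m" "even n" "b \<in> adeg A n"
      using assms by (auto simp: denominators_def)
    then have "even (m + n)" "a \<otimes> b \<in> adeg A (m + n)" using mult_adeg by auto
    then show ?thesis by blast
  qed
  ultimately show ?thesis using ab mult_cocycle by (simp add: denominators_def)
qed

text \<open>
  Graded commutativity speaks of homogeneous elements only, and has no sign for \<open>a\<close> of even degree; the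
  general case follows by splitting \<open>b\<close> into components.
\<close>

lemma denominator_central:
  assumes a: "a \<in> denominators" and b: "b \<in> Ac.Z"
  shows "a \<otimes> b \<ominus> b \<otimes> a \<in> Ac.B"
proof -
  have aZ: "a \<in> Ac.Z" and aA: "a \<in> carrier A" using a by (simp_all add: denominators_def)
  obtain n where n: "even n" "a \<in> adeg A n" using a by (auto simp: denominators_def)
  have bA: "b \<in> carrier A" using b by simp
  define h where "h = (\<lambda>b. a \<otimes> b \<ominus> b \<otimes> a)"
  have h_hom: "abelian_group_hom A A h"
  proof (rule abelian_group_homI_add)
    show "h (x \<oplus> y) = h x \<oplus> h y" if "x \<in> carrier A" "y \<in> carrier A" for x y
      using that aA unfolding h_def
      by (simp add: A.l_distr A.r_distr) (simp add: a_minus_def minus_add a_ac)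
  qed (use aA in \<open>simp_all add: h_def abelian_group_axioms\<close>)
  note h_simps = abelian_group_hom.hom_add[OF h_hom] abelian_group_hom.hom_zero[OF h_hom]
    abelian_group_hom.hom_a_inv[OF h_hom]
  have "additive_subgroup {b \<in> carrier A. h b \<in> Ac.B} A"
    by (rule additive_subgroupI_add)
       (auto simp: h_simps Ac.B.a_closed Ac.B.a_inv_closed simp del: Ac.coboundary_carrier)
  moreover have "Ac.cp m b \<in> {b \<in> carrier A. h b \<in> Ac.B}" for m
  proof -
    let ?b = "Ac.cp m b"
    have bZ: "?b \<in> Ac.Z" and bm: "?b \<in> adeg A m"
      using Ac.cocycle_component[OF b] Ac.component_degree[OF bA] by auto
    have "Ac.cls a \<in> rdeg (cohom_ring A) n" "Ac.cls ?b \<in> rdeg (cohom_ring A) m"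
      unfolding cohom_ring_simps(6) using aZ n bZ bm by blast+
    then have "Ac.cls a \<otimes>\<^bsub>cohom_ring A\<^esub> Ac.cls ?b
        = ksign (cohom_ring A) (n * m) (Ac.cls ?b \<otimes>\<^bsub>cohom_ring A\<^esub> Ac.cls a)"
      using commutative unfolding graded_commutative_def by blast
    then have "Ac.cls (a \<otimes> ?b) = Ac.cls (?b \<otimes> a)"
      unfolding cls_mult[OF aZ bZ] cls_mult[OF bZ aZ] ksign_def using n(1) by simp
    moreover have "a \<otimes> ?b \<in> carrier A" "?b \<otimes> a \<in> carrier A" using aA bZ by simp_all
    ultimately have "h ?b \<in> Ac.B" unfolding h_def using Ac.cls_eq_iff by blast
    then show ?thesis using bA by (simp del: Ac.coboundary_carrier)
  qed
  ultimately have "b \<in> {b \<in> carrier A. h b \<in> Ac.B}"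
    by (rule Ac.in_subgroup_by_components[OF _ bA])
  then show ?thesis by (simp add: h_def)
qed

end

text \<open>
  The cochain level form of a localisation map.  The condition \<open>relative_torsion\<close> comprises torsion
  cokernel (\<open>m = 0\<close>) and torsion kernel (\<open>w\<close> bounds the cocycle \<open>j m\<close>); in this
  combined form a single induction along a tower of extensions proves both.
\<close>

locale homotopy_localisation = graded_prime K A P + M0: dg_module_over K A M + M1: dg_module_over K A N
  for K and A :: "('k, 'a) dg_algebra" (structure) and P
    and M :: "('a, 'm) dg_module" and N :: "('a, 'n) dg_module" +
  fixes j :: "'m \<Rightarrow> 'n"
  assumes j_hom: "abelian_group_hom M N j"
    and j_act: "\<lbrakk>x \<in> carrier M; a \<in> carrier A\<rbrakk> \<Longrightarrow> j (x \<triangleleft>\<^bsub>M\<^esub> a) = j x \<triangleleft>\<^bsub>N\<^esub> a"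
    and j_degree: "x \<in> mdeg M n \<Longrightarrow> j x \<in> mdeg N n"
    and j_d: "x \<in> carrier M \<Longrightarrow> j (mdiff M x) = mdiff N (j x)"
    and j_inj: "inj_on j (carrier M)"
    and denominators_inj: "\<lbrakk>a \<in> denominators; z \<in> M1.Mod.Mc.Z; z \<triangleleft>\<^bsub>N\<^esub> a \<in> M1.Mod.Mc.B\<rbrakk>
      \<Longrightarrow> z \<in> M1.Mod.Mc.B"
    and denominators_surj: "\<lbrakk>a \<in> denominators; v \<in> M1.Mod.Mc.Z\<rbrakk>
      \<Longrightarrow> \<exists>y\<in>M1.Mod.Mc.Z. v \<ominus>\<^bsub>N\<^esub> y \<triangleleft>\<^bsub>N\<^esub> a \<in> M1.Mod.Mc.B"
    and relative_torsion: "\<lbrakk>w \<in> carrier N; m \<in> carrier M; mdiff N w = j m\<rbrakk>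
      \<Longrightarrow> \<exists>a\<in>denominators. \<exists>m'\<in>carrier M. w \<triangleleft>\<^bsub>N\<^esub> a \<ominus>\<^bsub>N\<^esub> j m' \<in> M1.Mod.Mc.B"
begin

abbreviation "cls0 \<equiv> M0.Mod.Mc.cls" abbreviation "Z0 \<equiv> M0.Mod.Mc.Z"
abbreviation "B0 \<equiv> M0.Mod.Mc.B" abbreviation "cls1 \<equiv> M1.Mod.Mc.cls"
abbreviation "Z1 \<equiv> M1.Mod.Mc.Z" abbreviation "B1 \<equiv> M1.Mod.Mc.B"

sublocale j: abelian_group_hom M N j by (rule j_hom)

definition induced :: "'m set \<Rightarrow> 'n set" where
  "induced \<xi> = (\<Union>x\<in>\<xi>. cls1 (j x))"

lemma j_cocycle: "x \<in> Z0 \<Longrightarrow> j x \<in> Z1"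
  using j_d[of x] by (simp add: M0.Mod.Mc.cocycle_iff M1.Mod.Mc.cocycle_iff)

lemma j_coboundary:
  assumes "x \<in> B0" shows "j x \<in> B1"
proof -
  obtain y where y: "y \<in> carrier M" "x = mdiff M y"
    using assms M0.Mod.Mc.coboundary_iff by blast
  have "j x = mdiff N (j y)" unfolding y(2) by (rule j_d[OF y(1)])
  then show ?thesis unfolding M1.Mod.Mc.coboundary_iff using j.hom_closed[OF y(1)] by blast
qed

lemma induced_cls:
  assumes x: "x \<in> Z0" shows "induced (cls0 x) = cls1 (j x)"
proof -
  have "cls1 (j y) = cls1 (j x)" if y: "y \<in> cls0 x" for y
  proof -
    have xy: "x \<in> carrier M" "y \<in> carrier M" "y \<ominus>\<^bsub>M\<^esub> x \<in> B0"
      using x M0.Mod.Mc.cls_memD[OF y] by auto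
    have "j (y \<ominus>\<^bsub>M\<^esub> x) = j y \<ominus>\<^bsub>N\<^esub> j x" using xy(1,2) by (simp add: a_minus_def)
    then have "j y \<ominus>\<^bsub>N\<^esub> j x \<in> B1" using j_coboundary[OF xy(3)] by simp
    then show ?thesis
      using M1.Mod.Mc.cls_eq_iff[OF j.hom_closed j.hom_closed, OF xy(2,1)] by simp
  qed
  then have "induced (cls0 x) = (\<Union>y\<in>cls0 x. cls1 (j x))" unfolding induced_def by simp
  moreover have "x \<in> cls0 x" using x M0.Mod.Mc.B.a_rcos_self by simp
  ultimately show ?thesis by blast
qed

lemma localisation_map_induced:
  "localisation_map (cohom_ring A) (cohom_module M) (cohom_module N)
     (even_complement (cohom_ring A) P) induced"
proof (intro localisation_map.intro localisation_map_axioms.intro)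
  let ?R = "cohom_ring A" and ?H0 = "cohom_module M" and ?H1 = "cohom_module N"
    and ?S = "even_complement (cohom_ring A) P"
  show "graded_right_module ?R ?H0 (rdeg ?R)" "graded_right_module ?R ?H1 (rdeg ?R)"
    by (rule M0.cohom_module_graded M1.cohom_module_graded)+
  show "?S \<subseteq> carrier ?R"
    by (auto simp: even_complement_eq HA.Q_carrier denominators_def)
  show "\<one>\<^bsub>?R\<^esub> \<in> ?S" using one_denominator by (simp add: even_complement_eq cohom_ring_simps(3))
  show "s \<otimes>\<^bsub>?R\<^esub> t \<in> ?S" if "s \<in> ?S" "t \<in> ?S" for s t
    using that mult_denominator by (auto simp: even_complement_eq cls_mult denominators_cocycle)
  show "s \<otimes>\<^bsub>?R\<^esub> \<alpha> = \<alpha> \<otimes>\<^bsub>?R\<^esub> s" if "s \<in> ?S" "\<alpha> \<in> carrier ?R" for s \<alpha>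
  proof -
    obtain a b where ab: "a \<in> denominators" "s = Ac.cls a" "b \<in> Ac.Z" "\<alpha> = Ac.cls b"
      using \<open>s \<in> ?S\<close> \<open>\<alpha> \<in> carrier ?R\<close> by (auto simp: even_complement_eq HA.Q_carrier)
    then show ?thesis
      using denominator_central[OF ab(1,3)] denominators_cocycle[OF ab(1)]
        Ac.cls_eq_iff[of "a \<otimes> b" "b \<otimes> a"] by (simp add: cls_mult)
  qed
  show "\<exists>n. s \<in> rdeg ?R n" if "s \<in> ?S" for s
    using that by (auto simp: even_complement_def)
  show "abelian_group_hom ?H0 ?H1 induced"
    by (rule abelian_group_homI_add[OF M0.HM.Q.abelian_group_axioms M1.HM.Q.abelian_group_axioms])
       (auto simp: M0.HM.Q_carrier induced_cls j_cocycle M0.HM.cls_add_Q M1.HM.cls_add_Q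
         M0.Mod.Mc.cocycle_add)
  show "induced (\<xi> \<triangleleft>\<^bsub>?H0\<^esub> \<alpha>) = induced \<xi> \<triangleleft>\<^bsub>?H1\<^esub> \<alpha>" if "\<xi> \<in> carrier ?H0" "\<alpha> \<in> carrier ?R" for \<xi> \<alpha>
    using that by (auto simp: M0.HM.Q_carrier HA.Q_carrier induced_cls j_cocycle j_act
        M0.cls_act_cohom M1.cls_act_cohom M0.act_cocycle)
  show "induced \<xi> \<in> mdeg ?H1 n" if "\<xi> \<in> mdeg ?H0 n" for \<xi> n
    using that by (auto simp: cohom_module_simps(5) induced_cls j_cocycle j_degree)
  show "\<eta> = \<zero>\<^bsub>?H1\<^esub>" if "s \<in> ?S" "\<eta> \<in> carrier ?H1" "\<eta> \<triangleleft>\<^bsub>?H1\<^esub> s = \<zero>\<^bsub>?H1\<^esub>" for s \<eta>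
  proof -
    obtain a z where az: "a \<in> denominators" "s = Ac.cls a" "z \<in> Z1" "\<eta> = cls1 z"
      using \<open>s \<in> ?S\<close> \<open>\<eta> \<in> carrier ?H1\<close> by (auto simp: even_complement_eq M1.HM.Q_carrier)
    have "cls1 (z \<triangleleft>\<^bsub>N\<^esub> a) = B1"
      using that(3) az M1.cls_act_cohom denominators_cocycle by (simp add: M1.HM.Q_zero)
    then have "z \<triangleleft>\<^bsub>N\<^esub> a \<in> B1"
      using M1.Mod.Mc.cls_eq_zero_iff[of "z \<triangleleft>\<^bsub>N\<^esub> a"] az denominators_cocycle by simp
    then have "z \<in> B1" using denominators_inj az by blast
    then show ?thesis using M1.Mod.Mc.cls_eq_zero_iff[of z] az by (simp add: M1.HM.Q_zero)
  qed
  show "\<exists>\<omega>\<in>carrier ?H1. \<eta> = \<omega> \<triangleleft>\<^bsub>?H1\<^esub> s" if "s \<in> ?S" "\<eta> \<in> carrier ?H1" for s \<eta>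
  proof -
    obtain a v where av: "a \<in> denominators" "s = Ac.cls a" "v \<in> Z1" "\<eta> = cls1 v"
      using \<open>s \<in> ?S\<close> \<open>\<eta> \<in> carrier ?H1\<close> by (auto simp: even_complement_eq M1.HM.Q_carrier)
    obtain y where y: "y \<in> Z1" "v \<ominus>\<^bsub>N\<^esub> y \<triangleleft>\<^bsub>N\<^esub> a \<in> B1" using denominators_surj av by blast
    have "\<eta> = cls1 y \<triangleleft>\<^bsub>?H1\<^esub> s"
      using y av M1.cls_act_cohom denominators_cocycle M1.Mod.Mc.cls_eq_iff[of v "y \<triangleleft>\<^bsub>N\<^esub> a"]
      by simp
    then show ?thesis using M1.HM.cls_closed[OF y(1)] by blast
  qed
  show "\<exists>s\<in>?S. \<xi> \<triangleleft>\<^bsub>?H0\<^esub> s = \<zero>\<^bsub>?H0\<^esub>" if "\<xi> \<in> carrier ?H0" "induced \<xi> = \<zero>\<^bsub>?H1\<^esub>" for \<xi>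
  proof -
    obtain m where m: "m \<in> Z0" "\<xi> = cls0 m" using \<open>\<xi> \<in> carrier ?H0\<close> by (auto simp: M0.HM.Q_carrier)
    have mc: "m \<in> carrier M" "mdiff M m = \<zero>\<^bsub>M\<^esub>" using m M0.Mod.Mc.cocycle_iff by auto
    have "cls1 (j m) = B1" using that(2) m by (simp add: induced_cls M1.HM.Q_zero)
    then have "j m \<in> B1" using M1.Mod.Mc.cls_eq_zero_iff[of "j m"] mc by simp
    then obtain x where x: "x \<in> carrier N" "mdiff N x = j m"
      using M1.Mod.Mc.coboundary_iff by metis
    obtain a m' where am: "a \<in> denominators" "m' \<in> carrier M" "x \<triangleleft>\<^bsub>N\<^esub> a \<ominus>\<^bsub>N\<^esub> j m' \<in> B1"
      using relative_torsion[OF x(1) mc(1) x(2)] by blast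
    have a: "a \<in> Ac.Z" "a \<in> carrier A" "adiff A a = \<zero>"
      using denominators_cocycle[OF am(1)] Ac.cocycle_iff by auto
    have "mdiff N (x \<triangleleft>\<^bsub>N\<^esub> a \<ominus>\<^bsub>N\<^esub> j m') = \<zero>\<^bsub>N\<^esub>"
      using am(3) M1.Mod.Mc.coboundary_cocycle M1.Mod.Mc.cocycle_iff by blast
    then have "mdiff N (x \<triangleleft>\<^bsub>N\<^esub> a) = mdiff N (j m')"
      using x a am(2) M1.Mod.M.minus_zero_iff[of "mdiff N (x \<triangleleft>\<^bsub>N\<^esub> a)" "mdiff N (j m')"]
      by (simp add: M1.Mod.Mc.d_minus)
    then have "j (m \<triangleleft>\<^bsub>M\<^esub> a) = j (mdiff M m')"
      using x a am(2) mc by (simp add: M1.Mod.d_act_cocycle j_act j_d)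
    then have "m \<triangleleft>\<^bsub>M\<^esub> a = mdiff M m'"
      using j_inj mc a am(2) by (simp add: inj_on_def)
    then have "m \<triangleleft>\<^bsub>M\<^esub> a \<in> B0" using am(2) M0.Mod.Mc.coboundary_iff by blast
    then have "\<xi> \<triangleleft>\<^bsub>?H0\<^esub> Ac.cls a = \<zero>\<^bsub>?H0\<^esub>"
      using m a mc M0.cls_act_cohom M0.Mod.Mc.cls_eq_zero_iff[of "m \<triangleleft>\<^bsub>M\<^esub> a"]
      by (simp add: M0.HM.Q_zero)
    then show ?thesis using am(1) by (auto simp: even_complement_eq)
  qed
  show "\<exists>s\<in>?S. \<exists>\<xi>\<in>carrier ?H0. \<eta> \<triangleleft>\<^bsub>?H1\<^esub> s = induced \<xi>" if \<eta>: "\<eta> \<in> carrier ?H1" for \<eta>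
  proof -
    obtain x where x: "x \<in> Z1" "\<eta> = cls1 x" using \<eta> by (auto simp: M1.HM.Q_carrier)
    have xc: "x \<in> carrier N" "mdiff N x = j \<zero>\<^bsub>M\<^esub>" using x M1.Mod.Mc.cocycle_iff by auto
    obtain a m where am: "a \<in> denominators" "m \<in> carrier M" "x \<triangleleft>\<^bsub>N\<^esub> a \<ominus>\<^bsub>N\<^esub> j m \<in> B1"
      using relative_torsion[OF xc(1) _ xc(2)] by auto
    have a: "a \<in> Ac.Z" "a \<in> carrier A" using denominators_cocycle[OF am(1)] by auto
    have xa: "x \<triangleleft>\<^bsub>N\<^esub> a \<in> Z1" using M1.act_cocycle x a by simp
    have "mdiff N (x \<triangleleft>\<^bsub>N\<^esub> a \<ominus>\<^bsub>N\<^esub> j m) = \<zero>\<^bsub>N\<^esub>"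
      using am(3) M1.Mod.Mc.coboundary_cocycle M1.Mod.Mc.cocycle_iff by blast
    then have "mdiff N (j m) = \<zero>\<^bsub>N\<^esub>"
      using xa am(2) M1.Mod.M.minus_zero_iff[of "\<zero>\<^bsub>N\<^esub>" "mdiff N (j m)"] xc(1) a
      by (simp add: M1.Mod.Mc.d_minus M1.Mod.Mc.cocycle_iff)
    then have "j (mdiff M m) = j \<zero>\<^bsub>M\<^esub>" using am(2) by (simp add: j_d)
    then have "mdiff M m = \<zero>\<^bsub>M\<^esub>" using inj_onD[OF j_inj] am(2) by simp
    then have m: "m \<in> Z0" using am(2) M0.Mod.Mc.cocycle_iff by simp
    have "\<eta> \<triangleleft>\<^bsub>?H1\<^esub> Ac.cls a = induced (cls0 m)"
      using x a m am M1.cls_act_cohom M1.Mod.Mc.cls_eq_iff[of "x \<triangleleft>\<^bsub>N\<^esub> a" "j m"] xc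
      by (simp add: induced_cls)
    then show ?thesis using am(1) M0.HM.cls_closed[OF m] by (auto simp: even_complement_eq)
  qed
qed

end

section \<open>Free extensions of a dg module\<close>

text \<open>
  The direct sum of \<open>M\<close> with the free graded module on the generators in \<open>G\<close>, where \<open>gdeg g\<close> is the degree
  of \<open>g\<close>.  The operations do not depend on \<open>G\<close>, so that enlarging \<open>G\<close> enlarges the
  extension to one that contains it as a graded submodule.  The fields \<open>mult\<close> and \<open>one\<close> carry no meaning.
\<close>

definition free_ext :: "('k, 'a) dg_algebra \<Rightarrow> ('a, 'm) dg_module \<Rightarrow> ('g \<Rightarrow> int) \<Rightarrow>
    ('m \<times> ('g \<Rightarrow> 'a) \<Rightarrow> 'm \<times> ('g \<Rightarrow> 'a)) \<Rightarrow> 'g set \<Rightarrow> ('a, 'm \<times> ('g \<Rightarrow> 'a)) dg_module" where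
  "free_ext A M gdeg d G = (let C = {x. fst x \<in> carrier M \<and> (\<forall>g. snd x g \<in> carrier A) \<and>
        finite {g. snd x g \<noteq> \<zero>\<^bsub>A\<^esub>} \<and> (\<forall>g. snd x g \<noteq> \<zero>\<^bsub>A\<^esub> \<longrightarrow> g \<in> G)}
     in \<lparr>carrier = C, mult = (\<lambda>x y. x), one = (\<zero>\<^bsub>M\<^esub>, \<lambda>g. \<zero>\<^bsub>A\<^esub>), zero = (\<zero>\<^bsub>M\<^esub>, \<lambda>g. \<zero>\<^bsub>A\<^esub>),
       add = (\<lambda>x y. (fst x \<oplus>\<^bsub>M\<^esub> fst y, \<lambda>g. snd x g \<oplus>\<^bsub>A\<^esub> snd y g)),
       ract = (\<lambda>x a. (fst x \<triangleleft>\<^bsub>M\<^esub> a, \<lambda>g. snd x g \<otimes>\<^bsub>A\<^esub> a)),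
       mdeg = (\<lambda>n. {x \<in> C. fst x \<in> mdeg M n \<and> (\<forall>g. snd x g \<in> adeg A (n - gdeg g))}),
       mdiff = d\<rparr>)"

lemma free_ext_simps:
  "x \<in> carrier (free_ext A M gdeg d G) \<longleftrightarrow> fst x \<in> carrier M \<and> (\<forall>g. snd x g \<in> carrier A) \<and>
    finite {g. snd x g \<noteq> \<zero>\<^bsub>A\<^esub>} \<and> (\<forall>g. snd x g \<noteq> \<zero>\<^bsub>A\<^esub> \<longrightarrow> g \<in> G)"
  "zero (free_ext A M gdeg d G) = (\<zero>\<^bsub>M\<^esub>, \<lambda>g. \<zero>\<^bsub>A\<^esub>)"
  "add (free_ext A M gdeg d G) x y = (fst x \<oplus>\<^bsub>M\<^esub> fst y, \<lambda>g. snd x g \<oplus>\<^bsub>A\<^esub> snd y g)"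
  "ract (free_ext A M gdeg d G) x a = (fst x \<triangleleft>\<^bsub>M\<^esub> a, \<lambda>g. snd x g \<otimes>\<^bsub>A\<^esub> a)"
  "x \<in> mdeg (free_ext A M gdeg d G) n \<longleftrightarrow> x \<in> carrier (free_ext A M gdeg d G) \<and>
    fst x \<in> mdeg M n \<and> (\<forall>g. snd x g \<in> adeg A (n - gdeg g))"
  "mdiff (free_ext A M gdeg d G) = d"
  by (auto simp: free_ext_def Let_def)

lemma free_extD:
  assumes "x \<in> carrier (free_ext A M gdeg d G)"
  shows "fst x \<in> carrier M" "snd x g \<in> carrier A" "finite {g. snd x g \<noteq> \<zero>\<^bsub>A\<^esub>}"
    "snd x g \<noteq> \<zero>\<^bsub>A\<^esub> \<Longrightarrow> g \<in> G"
  using assms unfolding free_ext_simps(1) by auto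

lemma free_ext_mdegD:
  assumes "x \<in> mdeg (free_ext A M gdeg d G) n"
  shows "x \<in> carrier (free_ext A M gdeg d G)" "fst x \<in> mdeg M n" "snd x g \<in> adeg A (n - gdeg g)"
  using assms unfolding free_ext_simps(5) by auto

definition base_elem :: "('k, 'a) dg_algebra \<Rightarrow> 'm \<Rightarrow> 'm \<times> ('g \<Rightarrow> 'a)" where
  "base_elem A m = (m, \<lambda>g. \<zero>\<^bsub>A\<^esub>)"

text \<open>
  The generator \<open>g\<close> acted on by \<open>\<alpha>\<close>.
\<close>

definition gen_mult :: "('k, 'a) dg_algebra \<Rightarrow> ('a, 'm) dg_module \<Rightarrow> 'g \<Rightarrow> 'a \<Rightarrow> 'm \<times> ('g \<Rightarrow> 'a)" where
  "gen_mult A M g \<alpha> = (\<zero>\<^bsub>M\<^esub>, \<lambda>h. if h = g then \<alpha> else \<zero>\<^bsub>A\<^esub>)"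

text \<open>
  The only additive map that extends the differential of \<open>M\<close>, satisfies the Leibniz rule and sends each
  generator \<open>g\<close> to \<open>bd g\<close>.  The ambient module only provides the addition and the action, so any function may
  take the place of its differential; here it is \<open>id\<close>.
\<close>

definition ext_diff :: "('k, 'a) dg_algebra \<Rightarrow> ('a, 'm) dg_module \<Rightarrow> ('g \<Rightarrow> int) \<Rightarrow>
    ('g \<Rightarrow> 'm \<times> ('g \<Rightarrow> 'a)) \<Rightarrow> 'm \<times> ('g \<Rightarrow> 'a) \<Rightarrow> 'm \<times> ('g \<Rightarrow> 'a)" where
  "ext_diff A M gdeg bd x = (let E = free_ext A M gdeg id UNIV in
     base_elem A (mdiff M (fst x)) \<oplus>\<^bsub>E\<^esub>
     (\<Oplus>\<^bsub>E\<^esub>g\<in>{g. snd x g \<noteq> \<zero>\<^bsub>A\<^esub>}. bd g \<triangleleft>\<^bsub>E\<^esub> snd x g \<oplus>\<^bsub>E\<^esub>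
        gen_mult A M g (ksign A (gdeg g) (adiff A (snd x g)))))"

context dg_module_over
begin

lemma free_ext_abelian_group: "abelian_group (free_ext A M gdeg d G)" (is "abelian_group ?E")
proof (rule abelian_groupI)
  show "x \<oplus>\<^bsub>?E\<^esub> y \<in> carrier ?E" if "x \<in> carrier ?E" "y \<in> carrier ?E" for x y
  proof -
    have "{g. snd x g \<oplus>\<^bsub>A\<^esub> snd y g \<noteq> \<zero>\<^bsub>A\<^esub>} \<subseteq> {g. snd x g \<noteq> \<zero>\<^bsub>A\<^esub>} \<union> {g. snd y g \<noteq> \<zero>\<^bsub>A\<^esub>}"
      by auto
    then show ?thesis using that by (auto simp: free_ext_simps elim: finite_subset)
  qed
  show "\<exists>y\<in>carrier ?E. y \<oplus>\<^bsub>?E\<^esub> x = \<zero>\<^bsub>?E\<^esub>" if "x \<in> carrier ?E" for x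
  proof
    let ?y = "(\<ominus>\<^bsub>M\<^esub> fst x, \<lambda>g. \<ominus>\<^bsub>A\<^esub> snd x g)"
    have "{g. \<ominus>\<^bsub>A\<^esub> snd x g \<noteq> \<zero>\<^bsub>A\<^esub>} \<subseteq> {g. snd x g \<noteq> \<zero>\<^bsub>A\<^esub>}"
      using Alg.minus_equality[of "\<zero>\<^bsub>A\<^esub>" "\<zero>\<^bsub>A\<^esub>"] by auto
    then show "?y \<in> carrier ?E"
      using that by (auto simp: free_ext_simps elim: finite_subset)
    show "?y \<oplus>\<^bsub>?E\<^esub> x = \<zero>\<^bsub>?E\<^esub>"
      using that by (auto simp: free_ext_simps Mod.M.l_neg Alg.l_neg)
  qed
qed (auto simp: free_ext_simps Mod.M.a_ac Alg.a_ac)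

lemma free_ext_graded:
  "graded_right_module A (free_ext A M gdeg d G) (adeg A)" (is "graded_right_module A ?E _")
proof (intro graded_right_module.intro graded_right_module_axioms.intro)
  show "ring A" by (rule Alg.A.ring_axioms)
  show "abelian_group ?E" by (rule free_ext_abelian_group)
  interpret E: abelian_group ?E by (rule free_ext_abelian_group)
  show "x \<triangleleft>\<^bsub>?E\<^esub> a \<in> carrier ?E" if "x \<in> carrier ?E" "a \<in> carrier A" for x a
  proof -
    have "{g. snd x g \<otimes>\<^bsub>A\<^esub> a \<noteq> \<zero>\<^bsub>A\<^esub>} \<subseteq> {g. snd x g \<noteq> \<zero>\<^bsub>A\<^esub>}" using that(2) by auto
    then show ?thesis using that by (auto simp: free_ext_simps elim: finite_subset)
  qed
  then show "x \<triangleleft>\<^bsub>?E\<^esub> a \<in> mdeg ?E (i + j)" if "x \<in> mdeg ?E i" "a \<in> adeg A j" for x a i j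
    using that Mod.ract_mdeg[of "fst x" i a j] Alg.mult_adeg[of _ _ a j] Alg.Ac.degree_carrier[of a j]
    unfolding free_ext_simps(5) by (auto simp: free_ext_simps(4)) (metis add_diff_eq diff_add_eq)
  define p where "p n x = (Mod.Mc.cp n (fst x), \<lambda>g. Alg.Ac.cp (n - gdeg g) (snd x g))" for n x
  have p_closed: "p n x \<in> carrier ?E" if "x \<in> carrier ?E" for n x
  proof -
    have "{g. Alg.Ac.cp (n - gdeg g) (snd x g) \<noteq> \<zero>\<^bsub>A\<^esub>} \<subseteq> {g. snd x g \<noteq> \<zero>\<^bsub>A\<^esub>}" by auto
    then show ?thesis using that by (auto simp: p_def free_ext_simps elim: finite_subset)
  qed
  have "graded_group ?E (mdeg ?E)"
  proof (rule E.graded_groupI[where p = p])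
    show "additive_subgroup (mdeg ?E n) ?E" for n
    proof (rule E.additive_subgroupI_add)
      show "x \<oplus>\<^bsub>?E\<^esub> y \<in> mdeg ?E n" if "x \<in> mdeg ?E n" "y \<in> mdeg ?E n" for x y
        using that E.a_closed[of x y] unfolding free_ext_simps(5)
        by (auto simp: free_ext_simps(3) Mod.Mc.degree_add Alg.Ac.degree_add)
      show "\<ominus>\<^bsub>?E\<^esub> x \<in> mdeg ?E n" if x: "x \<in> mdeg ?E n" for x
      proof -
        have xE: "x \<in> carrier ?E" using x free_ext_simps(5) by blast
        let ?y = "(\<ominus>\<^bsub>M\<^esub> fst x, \<lambda>g. \<ominus>\<^bsub>A\<^esub> snd x g)"
        have "{g. \<ominus>\<^bsub>A\<^esub> snd x g \<noteq> \<zero>\<^bsub>A\<^esub>} \<subseteq> {g. snd x g \<noteq> \<zero>\<^bsub>A\<^esub>}"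
          using Alg.minus_equality[of "\<zero>\<^bsub>A\<^esub>" "\<zero>\<^bsub>A\<^esub>"] by auto
        then have y: "?y \<in> carrier ?E"
          using xE by (auto simp: free_ext_simps elim: finite_subset)
        have "?y \<oplus>\<^bsub>?E\<^esub> x = \<zero>\<^bsub>?E\<^esub>"
          using xE by (auto simp: free_ext_simps Mod.M.l_neg Alg.l_neg)
        then have "\<ominus>\<^bsub>?E\<^esub> x = ?y" using E.minus_equality xE y by blast
        then show ?thesis using x y unfolding free_ext_simps(5)
          by (auto simp: Mod.Mc.degree_neg Alg.Ac.degree_neg)
      qed
    qed (auto simp: free_ext_simps)
    show "abelian_group_hom ?E ?E (p n)" for n
      using p_closed
      by (intro abelian_group_homI_add)
         (auto simp: free_ext_abelian_group, auto simp: p_def free_ext_simps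
           Mod.Mc.component_add Alg.Ac.component_add)
    show "p n x \<in> mdeg ?E n" if "x \<in> carrier ?E" for n x
      using that p_closed[OF that, of n] Mod.Mc.component_degree Alg.Ac.component_degree
      unfolding free_ext_simps(5) by (auto simp: p_def free_ext_simps(1))
    show "finite {n. p n x \<noteq> \<zero>\<^bsub>?E\<^esub>}" if x: "x \<in> carrier ?E" for x
    proof -
      let ?F = "{n. Mod.Mc.cp n (fst x) \<noteq> \<zero>\<^bsub>M\<^esub>}" and ?S = "{g. snd x g \<noteq> \<zero>\<^bsub>A\<^esub>}"
      have "{n. p n x \<noteq> \<zero>\<^bsub>?E\<^esub>}
          \<subseteq> ?F \<union> (\<Union>g\<in>?S. (\<lambda>n. n + gdeg g) ` {n. Alg.Ac.cp n (snd x g) \<noteq> \<zero>\<^bsub>A\<^esub>})"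
      proof
        fix n assume "n \<in> {n. p n x \<noteq> \<zero>\<^bsub>?E\<^esub>}"
        then consider "n \<in> ?F" | g where "Alg.Ac.cp (n - gdeg g) (snd x g) \<noteq> \<zero>\<^bsub>A\<^esub>"
          by (auto simp: p_def free_ext_simps)
        then show "n \<in> ?F \<union> (\<Union>g\<in>?S. (\<lambda>n. n + gdeg g) ` {n. Alg.Ac.cp n (snd x g) \<noteq> \<zero>\<^bsub>A\<^esub>})"
        proof cases
          case (2 g)
          then have "g \<in> ?S" by auto
          moreover have "n \<in> (\<lambda>n. n + gdeg g) ` {n. Alg.Ac.cp n (snd x g) \<noteq> \<zero>\<^bsub>A\<^esub>}"
            using 2 by (intro image_eqI[of _ _ "n - gdeg g"]) auto
          ultimately show ?thesis by blast
        qed blast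
      qed
      moreover have "finite ?F" "finite ?S" "\<And>g. finite {n. Alg.Ac.cp n (snd x g) \<noteq> \<zero>\<^bsub>A\<^esub>}"
        using x Mod.Mc.component_finite Alg.Ac.component_finite by (auto simp: free_ext_simps(1))
      ultimately show ?thesis by (auto elim: finite_subset)
    qed
    show "p m x = (if m = n then x else \<zero>\<^bsub>?E\<^esub>)" if "x \<in> mdeg ?E n" for m n x
      using that Mod.Mc.component_of_degree[of "fst x" n m]
        Alg.Ac.component_of_degree[of "snd x g" "n - gdeg g" "m - gdeg g" for g]
      by (auto simp: p_def free_ext_simps prod_eq_iff fun_eq_iff)
    show "x = \<zero>\<^bsub>?E\<^esub>" if x: "x \<in> carrier ?E" and 0: "\<And>n. p n x = \<zero>\<^bsub>?E\<^esub>" for x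
    proof -
      have pe: "p n x = (\<zero>\<^bsub>M\<^esub>, \<lambda>g. \<zero>\<^bsub>A\<^esub>)" for n
        using 0[of n] by (simp only: free_ext_simps(2))
      have c: "Mod.Mc.cp n (fst x) = \<zero>\<^bsub>M\<^esub>" "Alg.Ac.cp (n - gdeg g) (snd x g) = \<zero>\<^bsub>A\<^esub>" for n g
        using arg_cong[OF pe[of n], of fst] fun_cong[OF arg_cong[OF pe[of n], of snd], of g]
        by (simp_all only: p_def fst_conv snd_conv)
      have x': "fst x \<in> carrier M" "snd x g \<in> carrier A" for g
        using free_extD[OF x] by simp_all
      have "fst x = \<zero>\<^bsub>M\<^esub>" by (rule Mod.Mc.zero_by_components[OF x'(1) c(1)])
      moreover have "snd x g = \<zero>\<^bsub>A\<^esub>" for g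
        using c(2)[of "n + gdeg g" g for n] by (intro Alg.Ac.zero_by_components[OF x'(2)]) simp
      ultimately show ?thesis by (auto simp: free_ext_simps prod_eq_iff)
    qed
  qed
  then show "grading ?E (mdeg ?E)" by (rule graded_group.grading)
qed (auto simp: free_ext_simps Mod.ract_l_distr Mod.ract_r_distr Mod.ract_assoc Mod.ract_one
    Alg.A.l_distr Alg.A.r_distr Alg.A.m_assoc)

end

section \<open>The differential of a free extension\<close>

text \<open>
  Boundaries are only required to be elements of the extension, so that the differential is defined
  on the extension by all generators before it is known for which of them it squares to zero.
\<close>

locale free_extension = dg_module_over K A M
  for K and A :: "('k, 'a) dg_algebra" (structure) and M :: "('a, 'm) dg_module" +
  fixes gdeg :: "'g \<Rightarrow> int" and bd :: "'g \<Rightarrow> 'm \<times> ('g \<Rightarrow> 'a)"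
  assumes bd_typed: "bd g \<in> carrier (free_ext A M gdeg id UNIV)"
begin

abbreviation "d \<equiv> ext_diff A M gdeg bd"
abbreviation "E \<equiv> free_ext A M gdeg d"
abbreviation "EU \<equiv> E UNIV"
abbreviation "base \<equiv> base_elem A"
abbreviation "gen \<equiv> gen_mult A M"

sublocale U: graded_right_module A EU "adeg A" by (rule free_ext_graded)

lemma carrier_mono: "G \<subseteq> H \<Longrightarrow> x \<in> carrier (E G) \<Longrightarrow> x \<in> carrier (E H)"
  by (auto simp: free_ext_simps(1))

lemma carrier_U: "x \<in> carrier (E G) \<Longrightarrow> x \<in> carrier (EU)"
  by (rule carrier_mono) auto

lemma same_operations:
  "zero (E G) = zero (EU)" "add (E G) = add (EU)" "ract (E G) = ract (EU)"
  "mdiff (E G) = d"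
  by (auto simp: free_ext_simps fun_eq_iff)

lemma E_subgroup: "additive_subgroup (carrier (E G)) (EU)"
proof (rule U.M.additive_subgroupI_add)
  interpret G: graded_right_module A "E G" "adeg A" by (rule free_ext_graded)
  show "carrier (E G) \<subseteq> carrier (EU)" using carrier_U by blast
  show "\<zero>\<^bsub>EU\<^esub> \<in> carrier (E G)" using G.M.zero_closed unfolding same_operations(1)[of G] .
  show "x \<oplus>\<^bsub>EU\<^esub> y \<in> carrier (E G)" if "x \<in> carrier (E G)" "y \<in> carrier (E G)" for x y
    using G.M.a_closed[OF that] unfolding same_operations(2)[of G] .
  show "\<ominus>\<^bsub>EU\<^esub> x \<in> carrier (E G)" if x: "x \<in> carrier (E G)" for x
  proof -
    have "\<ominus>\<^bsub>E G\<^esub> x \<oplus>\<^bsub>EU\<^esub> x = \<zero>\<^bsub>EU\<^esub>"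
      using G.M.l_neg[OF x] by (simp only: same_operations[of G])
    then have "\<ominus>\<^bsub>EU\<^esub> x = \<ominus>\<^bsub>E G\<^esub> x"
      using x G.M.a_inv_closed carrier_U by (intro U.M.minus_equality) blast+
    then show ?thesis using G.M.a_inv_closed[OF x] by metis
  qed
qed

lemma a_inv_same: "x \<in> carrier (E G) \<Longrightarrow> \<ominus>\<^bsub>E G\<^esub> x = \<ominus>\<^bsub>EU\<^esub> x"
proof -
  interpret G: graded_right_module A "E G" "adeg A" by (rule free_ext_graded)
  assume x: "x \<in> carrier (E G)"
  have "\<ominus>\<^bsub>E G\<^esub> x \<oplus>\<^bsub>EU\<^esub> x = \<zero>\<^bsub>EU\<^esub>"
    using G.M.l_neg[OF x] by (simp only: same_operations[of G])
  then show "\<ominus>\<^bsub>E G\<^esub> x = \<ominus>\<^bsub>EU\<^esub> x"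
    using x G.M.a_inv_closed carrier_U by (intro U.M.minus_equality[symmetric]) blast+
qed

lemma ksign_same: "x \<in> carrier (E G) \<Longrightarrow> ksign (E G) n x = ksign (EU) n x"
  using a_inv_same by (simp add: ksign_def)

lemma mdeg_carrier: "x \<in> mdeg (E G) n \<Longrightarrow> x \<in> carrier (E G)"
  by (rule free_ext_mdegD(1))

lemma mdeg_iff: "x \<in> mdeg (E G) n \<longleftrightarrow> x \<in> carrier (E G) \<and> x \<in> mdeg (EU) n"
  by (auto simp: free_ext_simps(1,5))

lemma base_closed: "m \<in> carrier M \<Longrightarrow> base m \<in> carrier (E G)"
  by (simp add: base_elem_def free_ext_simps(1))

lemma base_degree: "m \<in> mdeg M n \<Longrightarrow> base m \<in> mdeg (E G) n"
  using base_closed Mod.Mc.degree_carrier by (auto simp: free_ext_simps(5) base_elem_def)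

lemma gen_closed: "\<alpha> \<in> carrier A \<Longrightarrow> g \<in> G \<Longrightarrow> gen g \<alpha> \<in> carrier (E G)"
proof -
  assume a: "\<alpha> \<in> carrier A" "g \<in> G"
  have "{h. (if h = g then \<alpha> else \<zero>) \<noteq> \<zero>} \<subseteq> {g}" by auto
  then have "finite {h. (if h = g then \<alpha> else \<zero>) \<noteq> \<zero>}" using finite_subset by blast
  then show ?thesis using a by (simp add: gen_mult_def free_ext_simps(1))
qed

lemma gen_degree: "\<alpha> \<in> adeg A (n - gdeg g) \<Longrightarrow> g \<in> G \<Longrightarrow> gen g \<alpha> \<in> mdeg (E G) n"
  using gen_closed[of \<alpha> g G] Alg.Ac.degree_carrier[of \<alpha>]
  by (auto simp: free_ext_simps(5) gen_mult_def)

lemma base_hom: "abelian_group_hom M (EU) base"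
  by (rule abelian_group_homI_add[OF Mod.M.abelian_group_axioms free_ext_abelian_group])
     (simp_all add: base_closed, simp add: base_elem_def free_ext_simps)

lemma gen_hom: "abelian_group_hom A (EU) (gen g)"
  by (rule abelian_group_homI_add[OF Alg.abelian_group_axioms free_ext_abelian_group])
     (simp_all add: gen_closed, simp add: gen_mult_def free_ext_simps fun_eq_iff)

lemma base_act: "a \<in> carrier A \<Longrightarrow> base m \<triangleleft>\<^bsub>EU\<^esub> a = base (m \<triangleleft>\<^bsub>M\<^esub> a)"
  by (simp add: base_elem_def free_ext_simps)

lemma gen_act: "a \<in> carrier A \<Longrightarrow> gen g \<alpha> \<triangleleft>\<^bsub>EU\<^esub> a = gen g (\<alpha> \<otimes> a)"
  by (simp add: gen_mult_def free_ext_simps fun_eq_iff Mod.act_zero_left)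

text \<open>
  The summands of \<open>x\<close> itself, rather than arbitrary generators, appear in the premises: for
  homogeneous \<open>x\<close> they are homogeneous of the same degree.
\<close>

lemma ext_induct [consumes 1, case_names base gen add]:
  assumes x: "x \<in> carrier (E G)"
    and b: "Q (base (fst x))"
    and g: "\<And>g. g \<in> G \<Longrightarrow> Q (gen g (snd x g))"
    and a: "\<And>y z. \<lbrakk>y \<in> carrier (E G); z \<in> carrier (E G); Q y; Q z\<rbrakk> \<Longrightarrow> Q (y \<oplus>\<^bsub>EU\<^esub> z)"
  shows "Q x"
proof -
  let ?S = "{g. snd x g \<noteq> \<zero>}"
  have x': "fst x \<in> carrier M" "\<And>g. snd x g \<in> carrier A" "finite ?S" "?S \<subseteq> G"
    using x by (auto simp: free_ext_simps(1))
  let ?y = "\<lambda>F. (fst x, \<lambda>g. if g \<in> F then snd x g else \<zero>)"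
  have "?y F \<in> carrier (E G) \<and> Q (?y F)" if "finite F" "F \<subseteq> ?S" for F
    using that
  proof (induction F rule: finite_induct)
    case empty
    have "?y {} = base (fst x)" by (simp add: base_elem_def)
    then show ?case using b base_closed[OF x'(1)] by simp
  next
    case (insert h F)
    have h: "h \<in> G" using insert x' by blast
    have eq: "?y (insert h F) = ?y F \<oplus>\<^bsub>EU\<^esub> gen h (snd x h)"
      using x' insert(2) by (auto simp: gen_mult_def free_ext_simps fun_eq_iff)
    have "?y F \<in> carrier (E G)" "Q (?y F)" using insert by blast+
    moreover have "gen h (snd x h) \<in> carrier (E G)" using gen_closed x' h by blast
    ultimately show ?case unfolding eq
      using a[of "?y F" "gen h (snd x h)"] g[OF h] additive_subgroup.a_closed[OF E_subgroup] by blast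
  qed
  from this[OF x'(3)] have "Q (?y ?S)" by blast
  moreover have "?y ?S = x" by (auto simp: prod_eq_iff fun_eq_iff)
  ultimately show ?thesis by simp
qed

definition gen_diff :: "'g \<Rightarrow> 'a \<Rightarrow> 'm \<times> ('g \<Rightarrow> 'a)" where
  "gen_diff g \<alpha> = bd g \<triangleleft>\<^bsub>EU\<^esub> \<alpha> \<oplus>\<^bsub>EU\<^esub> gen g (ksign A (gdeg g) (dA \<alpha>))"

lemma bd_closed: "bd g \<in> carrier (EU)"
  using bd_typed[of g] by (simp add: free_ext_simps(1))

lemma gen_diff_hom: "abelian_group_hom A (EU) (gen_diff g)"
proof (rule abelian_group_homI_add[OF Alg.abelian_group_axioms free_ext_abelian_group])
  note gh = abelian_group_hom.hom_add[OF gen_hom]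
  show "gen_diff g \<alpha> \<in> carrier (EU)" if "\<alpha> \<in> carrier A" for \<alpha>
    using that bd_closed gen_closed U.ract_closed by (simp add: gen_diff_def Alg.adiff_closed)
  fix \<alpha> \<beta> assume ab: "\<alpha> \<in> carrier A" "\<beta> \<in> carrier A"
  have "ksign A n (\<alpha> \<oplus> \<beta>) = ksign A n \<alpha> \<oplus> ksign A n \<beta>" if "\<alpha> \<in> carrier A" "\<beta> \<in> carrier A" for n \<alpha> \<beta>
    using that by (simp add: ksign_def Alg.minus_add)
  then have "gen g (ksign A (gdeg g) (dA (\<alpha> \<oplus> \<beta>)))
      = gen g (ksign A (gdeg g) (dA \<alpha>)) \<oplus>\<^bsub>EU\<^esub> gen g (ksign A (gdeg g) (dA \<beta>))"
    using ab by (simp add: gh Alg.adiff_closed Alg.adiff_add)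
  moreover have "bd g \<triangleleft>\<^bsub>EU\<^esub> (\<alpha> \<oplus> \<beta>) = bd g \<triangleleft>\<^bsub>EU\<^esub> \<alpha> \<oplus>\<^bsub>EU\<^esub> bd g \<triangleleft>\<^bsub>EU\<^esub> \<beta>"
    using ab bd_closed U.ract_r_distr by blast
  moreover have "bd g \<triangleleft>\<^bsub>EU\<^esub> \<alpha> \<in> carrier (EU)" "bd g \<triangleleft>\<^bsub>EU\<^esub> \<beta> \<in> carrier (EU)"
    "gen g (ksign A (gdeg g) (dA \<alpha>)) \<in> carrier (EU)" "gen g (ksign A (gdeg g) (dA \<beta>)) \<in> carrier (EU)"
    using ab bd_closed U.ract_closed gen_closed by (simp_all add: Alg.adiff_closed)
  ultimately show "gen_diff g (\<alpha> \<oplus> \<beta>) = gen_diff g \<alpha> \<oplus>\<^bsub>EU\<^esub> gen_diff g \<beta>"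
    unfolding gen_diff_def by (simp add: U.M.a_ac)
qed

lemma ext_diff_eq: "d x = base (dM (fst x)) \<oplus>\<^bsub>EU\<^esub>
    (\<Oplus>\<^bsub>EU\<^esub>g\<in>{g. snd x g \<noteq> \<zero>}. gen_diff g (snd x g))"
proof -
  let ?E = "free_ext A M gdeg id UNIV"
  have f: "finsum (EU) = finsum ?E"
    by (rule additive_structure_cong(1)) (auto simp: free_ext_def Let_def)
  have o: "add (EU) = add ?E" "ract (EU) = ract ?E"
    by (auto simp: free_ext_simps fun_eq_iff)
  show ?thesis unfolding gen_diff_def f o by (simp only: ext_diff_def Let_def)
qed

lemma ext_diff_eq_over:
  assumes x: "x \<in> carrier (EU)" and J: "finite J" "{g. snd x g \<noteq> \<zero>} \<subseteq> J"
  shows "d x = base (dM (fst x)) \<oplus>\<^bsub>EU\<^esub> (\<Oplus>\<^bsub>EU\<^esub>g\<in>J. gen_diff g (snd x g))"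
proof -
  note gd = abelian_group_hom.hom_closed[OF gen_diff_hom] abelian_group_hom.hom_zero[OF gen_diff_hom]
  have c: "snd x g \<in> carrier A" for g using x by (simp add: free_ext_simps(1))
  have "(\<Oplus>\<^bsub>EU\<^esub>g\<in>{g. snd x g \<noteq> \<zero>}. gen_diff g (snd x g)) = (\<Oplus>\<^bsub>EU\<^esub>g\<in>J. gen_diff g (snd x g))"
    using J c gd by (intro U.M.add.finprod_mono_neutral_cong_left) auto
  then show ?thesis unfolding ext_diff_eq[of x] by (rule arg_cong)
qed

lemma ext_diff_hom: "abelian_group_hom (EU) (EU) d"
proof (rule abelian_group_homI_add[OF free_ext_abelian_group free_ext_abelian_group])
  note gdc = abelian_group_hom.hom_closed[OF gen_diff_hom]
  fix x assume x: "x \<in> carrier (EU)"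
  show "d x \<in> carrier (EU)"
    unfolding ext_diff_eq[of x]
    by (intro U.M.a_closed U.M.finsum_closed base_closed Mod.mdiff_closed Pi_I gdc free_extD[OF x])
next
  note gdc = abelian_group_hom.hom_closed[OF gen_diff_hom]
  fix x y assume x: "x \<in> carrier (EU)" and y: "y \<in> carrier (EU)"
  let ?J = "{g. snd x g \<noteq> \<zero>} \<union> {g. snd y g \<noteq> \<zero>}"
  have c: "fst x \<in> carrier M" "\<And>g. snd x g \<in> carrier A" "fst y \<in> carrier M" "\<And>g. snd y g \<in> carrier A"
    "finite ?J"
    using free_extD[OF x] free_extD[OF y] by simp_all
  have xy: "x \<oplus>\<^bsub>EU\<^esub> y \<in> carrier (EU)" using x y by (rule U.M.a_closed)
  have J: "{g. snd (x \<oplus>\<^bsub>EU\<^esub> y) g \<noteq> \<zero>} \<subseteq> ?J" using c by (auto simp: free_ext_simps(3))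
  have fx: "(\<lambda>g. gen_diff g (snd x g)) \<in> ?J \<rightarrow> carrier (EU)"
    and fy: "(\<lambda>g. gen_diff g (snd y g)) \<in> ?J \<rightarrow> carrier (EU)" by (intro Pi_I gdc c)+
  have "(\<Oplus>\<^bsub>EU\<^esub>g\<in>?J. gen_diff g (snd (x \<oplus>\<^bsub>EU\<^esub> y) g)) =
      (\<Oplus>\<^bsub>EU\<^esub>g\<in>?J. gen_diff g (snd x g) \<oplus>\<^bsub>EU\<^esub> gen_diff g (snd y g))"
    using abelian_group_hom.hom_add[OF gen_diff_hom c(2) c(4)]
    by (simp add: free_ext_simps(3))
  also have "\<dots> = (\<Oplus>\<^bsub>EU\<^esub>g\<in>?J. gen_diff g (snd x g)) \<oplus>\<^bsub>EU\<^esub> (\<Oplus>\<^bsub>EU\<^esub>g\<in>?J. gen_diff g (snd y g))"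
    using fx fy by (rule U.M.finsum_addf)
  finally have s: "(\<Oplus>\<^bsub>EU\<^esub>g\<in>?J. gen_diff g (snd (x \<oplus>\<^bsub>EU\<^esub> y) g)) =
    (\<Oplus>\<^bsub>EU\<^esub>g\<in>?J. gen_diff g (snd x g)) \<oplus>\<^bsub>EU\<^esub> (\<Oplus>\<^bsub>EU\<^esub>g\<in>?J. gen_diff g (snd y g))" .
  have b: "base (dM (fst (x \<oplus>\<^bsub>EU\<^esub> y))) = base (dM (fst x)) \<oplus>\<^bsub>EU\<^esub> base (dM (fst y))"
    using c abelian_group_hom.hom_add[OF base_hom] by (simp add: free_ext_simps(3) Mod.mdiff_add Mod.mdiff_closed)
  have cl: "base (dM (fst x)) \<in> carrier (EU)" "base (dM (fst y)) \<in> carrier (EU)"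
    by (intro base_closed Mod.mdiff_closed c)+
  have dx: "d x = base (dM (fst x)) \<oplus>\<^bsub>EU\<^esub> (\<Oplus>\<^bsub>EU\<^esub>g\<in>?J. gen_diff g (snd x g))"
    by (rule ext_diff_eq_over[OF x c(5)]) blast
  have dy: "d y = base (dM (fst y)) \<oplus>\<^bsub>EU\<^esub> (\<Oplus>\<^bsub>EU\<^esub>g\<in>?J. gen_diff g (snd y g))"
    by (rule ext_diff_eq_over[OF y c(5)]) blast
  show "d (x \<oplus>\<^bsub>EU\<^esub> y) = d x \<oplus>\<^bsub>EU\<^esub> d y"
    unfolding ext_diff_eq_over[OF xy c(5) J] s b dx dy
    using cl U.M.finsum_closed[OF fx] U.M.finsum_closed[OF fy] by (simp add: U.M.a_ac)
qed

lemma d_base: "m \<in> carrier M \<Longrightarrow> d (base m) = base (dM m)"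
  using ext_diff_eq_over[of "base m" "{}"] base_closed[of m UNIV] base_closed[OF Mod.mdiff_closed, of m UNIV]
  by (simp add: base_elem_def)

lemma d_gen:
  assumes "\<alpha> \<in> carrier A"
  shows "d (gen g \<alpha>) = bd g \<triangleleft>\<^bsub>EU\<^esub> \<alpha> \<oplus>\<^bsub>EU\<^esub> gen g (ksign A (gdeg g) (dA \<alpha>))"
proof -
  have c: "gen_diff g \<alpha> \<in> carrier (EU)"
    using abelian_group_hom.hom_closed[OF gen_diff_hom assms] .
  have z: "base (dM \<zero>\<^bsub>M\<^esub>) = \<zero>\<^bsub>EU\<^esub>" by (simp add: base_elem_def free_ext_simps(2))
  have "d (gen g \<alpha>) = base (dM (fst (gen g \<alpha>))) \<oplus>\<^bsub>EU\<^esub>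
      (\<Oplus>\<^bsub>EU\<^esub>h\<in>{g}. gen_diff h (snd (gen g \<alpha>) h))"
    using gen_closed[OF assms] by (intro ext_diff_eq_over) (auto simp: gen_mult_def)
  also have "(\<Oplus>\<^bsub>EU\<^esub>h\<in>{g}. gen_diff h (snd (gen g \<alpha>) h)) = gen_diff g \<alpha>"
    using c by (simp add: gen_mult_def)
  also have "base (dM (fst (gen g \<alpha>))) = \<zero>\<^bsub>EU\<^esub>" using z by (simp add: gen_mult_def)
  finally show ?thesis using c by (simp add: gen_diff_def)
qed

lemma d_closed:
  assumes bd: "\<And>g. g \<in> G \<Longrightarrow> bd g \<in> carrier (E G)" and x: "x \<in> carrier (E G)"
  shows "d x \<in> carrier (E G)"
  using x
proof (induction x rule: ext_induct)
  case base
  have "fst x \<in> carrier M" by (rule free_extD(1)[OF x])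
  then show ?case using d_base[of "fst x"] base_closed[OF Mod.mdiff_closed, of "fst x" G] by simp
next
  case (gen g)
  interpret G: graded_right_module A "E G" "adeg A" by (rule free_ext_graded)
  have c: "snd x g \<in> carrier A" by (rule free_extD(2)[OF x])
  have "bd g \<triangleleft>\<^bsub>EU\<^esub> snd x g \<in> carrier (E G)"
    using G.ract_closed[OF bd[OF gen] c] by (simp only: same_operations[of G])
  moreover have "gen g (ksign A (gdeg g) (dA (snd x g))) \<in> carrier (E G)"
    using gen c Alg.adiff_closed by (intro gen_closed) simp_all
  ultimately show ?case
    unfolding d_gen[OF c] by (rule additive_subgroup.a_closed[OF E_subgroup])
next
  case (add y z)
  show ?case
    unfolding abelian_group_hom.hom_add[OF ext_diff_hom carrier_U[OF add(1)] carrier_U[OF add(2)]]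
    by (rule additive_subgroup.a_closed[OF E_subgroup add(3,4)])
qed

lemma d_leibniz:
  assumes x: "x \<in> mdeg (EU) n" and a: "a \<in> carrier A"
  shows "d (x \<triangleleft>\<^bsub>EU\<^esub> a) = d x \<triangleleft>\<^bsub>EU\<^esub> a \<oplus>\<^bsub>EU\<^esub> ksign (EU) n (x \<triangleleft>\<^bsub>EU\<^esub> dA a)"
proof -
  have xd: "fst x \<in> mdeg M n" "\<And>g. snd x g \<in> adeg A (n - gdeg g)" and xU: "x \<in> carrier (EU)"
    using free_ext_mdegD[OF x] by simp_all
  have da: "dA a \<in> carrier A" using a Alg.adiff_closed by blast
  show ?thesis using xU
  proof (induction x rule: ext_induct)
    case base
    let ?m = "fst x"
    have m: "?m \<in> carrier M" "dM ?m \<in> carrier M"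
      by (intro Mod.mdiff_closed Mod.Mc.degree_carrier[OF xd(1)])+
    have "d (base ?m \<triangleleft>\<^bsub>EU\<^esub> a) = base (dM (?m \<triangleleft>\<^bsub>M\<^esub> a))"
      using m a by (simp add: base_act d_base)
    also have "\<dots> = base (dM ?m \<triangleleft>\<^bsub>M\<^esub> a) \<oplus>\<^bsub>EU\<^esub> base (ksign M n (?m \<triangleleft>\<^bsub>M\<^esub> dA a))"
      using m a da Mod.mleibniz[OF xd(1) a] abelian_group_hom.hom_add[OF base_hom] by simp
    also have "base (ksign M n (?m \<triangleleft>\<^bsub>M\<^esub> dA a)) = ksign (EU) n (base (?m \<triangleleft>\<^bsub>M\<^esub> dA a))"
      using m da by (intro abelian_group_hom.hom_ksign[OF base_hom]) simp
    finally show ?case using m a da by (simp add: base_act d_base)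
  next
    case (gen g)
    let ?\<alpha> = "snd x g"
    have c: "?\<alpha> \<in> carrier A" by (rule Alg.Ac.degree_carrier[OF xd(2)])
    have dc: "dA ?\<alpha> \<in> carrier A" using c Alg.adiff_closed by blast
    let ?s = "ksign A (gdeg g)"
    have sgn: "?s (ksign A (n - gdeg g) \<beta>) = ksign A n \<beta>" if "\<beta> \<in> carrier A" for \<beta>
      using that by (auto simp: ksign_def)
    have sa: "?s (\<beta> \<oplus> \<gamma>) = ?s \<beta> \<oplus> ?s \<gamma>" if "\<beta> \<in> carrier A" "\<gamma> \<in> carrier A" for \<beta> \<gamma>
      using that by (simp add: ksign_def Alg.minus_add)
    have sm: "?s (\<beta> \<otimes> \<gamma>) = ?s \<beta> \<otimes> \<gamma>" if "\<beta> \<in> carrier A" "\<gamma> \<in> carrier A" for \<beta> \<gamma>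
      using that by (simp add: ksign_def Alg.A.l_minus)
    have "?s (dA (?\<alpha> \<otimes> a)) = ?s (dA ?\<alpha>) \<otimes> a \<oplus> ksign A n (?\<alpha> \<otimes> dA a)"
      using Alg.leibniz[OF xd(2) a, of g] c dc a da by (simp add: sa sm sgn)
    then have "gen g (?s (dA (?\<alpha> \<otimes> a)))
        = gen g (?s (dA ?\<alpha>) \<otimes> a) \<oplus>\<^bsub>EU\<^esub> gen g (ksign A n (?\<alpha> \<otimes> dA a))"
      using abelian_group_hom.hom_add[OF gen_hom] c dc a da by simp
    also have "gen g (ksign A n (?\<alpha> \<otimes> dA a)) = ksign (EU) n (gen g (?\<alpha> \<otimes> dA a))"
      using c da by (intro abelian_group_hom.hom_ksign[OF gen_hom]) simp
    finally have e: "gen g (?s (dA (?\<alpha> \<otimes> a)))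
        = gen g (?s (dA ?\<alpha>)) \<triangleleft>\<^bsub>EU\<^esub> a \<oplus>\<^bsub>EU\<^esub> ksign (EU) n (gen g ?\<alpha> \<triangleleft>\<^bsub>EU\<^esub> dA a)"
      using a da by (simp add: gen_act)
    have cl: "bd g \<triangleleft>\<^bsub>EU\<^esub> ?\<alpha> \<in> carrier (EU)" "gen g (?s (dA ?\<alpha>)) \<in> carrier (EU)"
      "gen g ?\<alpha> \<triangleleft>\<^bsub>EU\<^esub> dA a \<in> carrier (EU)"
      using bd_closed[of g] U.ract_closed gen_closed c dc da by simp_all
    have "d (gen g ?\<alpha> \<triangleleft>\<^bsub>EU\<^esub> a) = bd g \<triangleleft>\<^bsub>EU\<^esub> (?\<alpha> \<otimes> a) \<oplus>\<^bsub>EU\<^esub> gen g (?s (dA (?\<alpha> \<otimes> a)))"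
      using a c by (simp add: gen_act d_gen)
    also have "bd g \<triangleleft>\<^bsub>EU\<^esub> (?\<alpha> \<otimes> a) = bd g \<triangleleft>\<^bsub>EU\<^esub> ?\<alpha> \<triangleleft>\<^bsub>EU\<^esub> a"
      using bd_closed c a by (simp add: U.ract_assoc)
    finally show ?case unfolding e d_gen[OF c]
      using cl a by (simp add: U.ract_l_distr U.ract_closed U.M.a_assoc)
  next
    case (add y z)
    have k: "ksign (EU) n (p \<oplus>\<^bsub>EU\<^esub> q) = ksign (EU) n p \<oplus>\<^bsub>EU\<^esub> ksign (EU) n q"
      if "p \<in> carrier (EU)" "q \<in> carrier (EU)" for p q
      using that by (simp add: ksign_def U.M.minus_add)
    have cl: "y \<triangleleft>\<^bsub>EU\<^esub> a \<in> carrier (EU)" "z \<triangleleft>\<^bsub>EU\<^esub> a \<in> carrier (EU)"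
      "y \<triangleleft>\<^bsub>EU\<^esub> dA a \<in> carrier (EU)" "z \<triangleleft>\<^bsub>EU\<^esub> dA a \<in> carrier (EU)"
      "d y \<triangleleft>\<^bsub>EU\<^esub> a \<in> carrier (EU)" "d z \<triangleleft>\<^bsub>EU\<^esub> a \<in> carrier (EU)"
      "d y \<in> carrier (EU)" "d z \<in> carrier (EU)"
      using add(1,2) a da U.ract_closed abelian_group_hom.hom_closed[OF ext_diff_hom] by simp_all
    note h = abelian_group_hom.hom_add[OF ext_diff_hom]
    show ?case
      using add(1,2) a da cl
      by (simp add: U.ract_l_distr h k add(3,4) U.M.a_ac)
  qed
qed

end

lemma (in abelian_group) ksign_Suc_cancel:
  "x \<in> carrier G \<Longrightarrow> ksign G (n + 1) x \<oplus> ksign G n x = \<zero>"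
  by (simp add: ksign_def l_neg r_neg)

context free_extension
begin

text \<open>
  The two terms of \<open>d g \<alpha> +/- g d \<alpha>\<close> contribute \<open>d g d \<alpha>\<close> with opposite signs, since \<open>d g\<close> has degree one more
  than \<open>g\<close>.
\<close>

lemma d_d_gen:
  assumes bd: "bd g \<in> mdeg (EU) (gdeg g + 1)" "d (bd g) = \<zero>\<^bsub>EU\<^esub>" and a: "\<alpha> \<in> carrier A"
  shows "d (d (gen g \<alpha>)) = \<zero>\<^bsub>EU\<^esub>"
proof -
  let ?y = "bd g \<triangleleft>\<^bsub>EU\<^esub> dA \<alpha>" and ?s = "ksign A (gdeg g)"
  have da: "dA \<alpha> \<in> carrier A" "?s (dA \<alpha>) \<in> carrier A" using a Alg.adiff_closed by simp_all
  have y: "?y \<in> carrier (EU)" using bd_closed[of g] U.ract_closed da by simp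
  have z: "\<zero>\<^bsub>EU\<^esub> \<triangleleft>\<^bsub>EU\<^esub> \<alpha> = \<zero>\<^bsub>EU\<^esub>" using U.act_zero_left a by simp
  have 1: "d (bd g \<triangleleft>\<^bsub>EU\<^esub> \<alpha>) = ksign (EU) (gdeg g + 1) ?y"
    using d_leibniz[OF bd(1) a] y by (simp add: bd(2) z)
  have "dA (?s (dA \<alpha>)) = \<zero>" using a da by (simp add: Alg.Ac.d_ksign Alg.adiff_adiff)
  then have 2: "d (gen g (?s (dA \<alpha>))) = ksign (EU) (gdeg g) ?y"
    using d_gen[OF da(2), of g] abelian_group_hom.hom_zero[OF gen_hom, of g] y
      U.act_ksign[OF bd_closed[of g] da(1), of "gdeg g"] by simp
  have c: "bd g \<triangleleft>\<^bsub>EU\<^esub> \<alpha> \<in> carrier (EU)" "gen g (?s (dA \<alpha>)) \<in> carrier (EU)"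
    using bd_closed[of g] U.ract_closed gen_closed a da by simp_all
  show ?thesis
    unfolding d_gen[OF a] abelian_group_hom.hom_add[OF ext_diff_hom c] 1 2
    by (rule U.M.ksign_Suc_cancel[OF y])
qed

lemma free_ext_dg_module:
  assumes bd: "\<And>g. g \<in> G \<Longrightarrow> bd g \<in> mdeg (E G) (gdeg g + 1)"
    and d_bd: "\<And>g. g \<in> G \<Longrightarrow> d (bd g) = \<zero>\<^bsub>EU\<^esub>"
  shows "dg_right_module A (E G)"
proof (intro dg_right_module.intro dg_right_module_axioms.intro)
  show "graded_right_module A (E G) (adeg A)" by (rule free_ext_graded)
  interpret G: graded_right_module A "E G" "adeg A" by (rule free_ext_graded)
  interpret GG: graded_group "E G" "mdeg (E G)" by (rule G.graded_group_M)
  note same = same_operations[of G]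
  show "mdiff (E G) x \<in> carrier (E G)" if "x \<in> carrier (E G)" for x
    unfolding same by (intro d_closed mdeg_carrier[OF bd] that)
  show "mdiff (E G) (x \<oplus>\<^bsub>E G\<^esub> y) = mdiff (E G) x \<oplus>\<^bsub>E G\<^esub> mdiff (E G) y"
    if "x \<in> carrier (E G)" "y \<in> carrier (E G)" for x y
    unfolding same by (rule abelian_group_hom.hom_add[OF ext_diff_hom carrier_U[OF that(1)] carrier_U[OF that(2)]])
  show "mdiff (E G) x \<in> mdeg (E G) (n + 1)" if x: "x \<in> mdeg (E G) n" for x n
    unfolding same using mdeg_carrier[OF x]
  proof (induction x rule: ext_induct)
    case base
    have m: "fst x \<in> mdeg M n" by (rule free_ext_mdegD(2)[OF x])
    show ?case
      unfolding d_base[OF Mod.Mc.degree_carrier[OF m]] by (rule base_degree[OF Mod.mdiff_mdeg[OF m]])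
  next
    case (gen g)
    have c: "snd x g \<in> adeg A (n - gdeg g)" by (rule free_ext_mdegD(3)[OF x])
    have "bd g \<triangleleft>\<^bsub>E G\<^esub> snd x g \<in> mdeg (E G) (gdeg g + 1 + (n - gdeg g))"
      by (rule G.ract_mdeg[OF bd[OF gen] c])
    then have 1: "bd g \<triangleleft>\<^bsub>EU\<^esub> snd x g \<in> mdeg (E G) (n + 1)"
      unfolding same by (simp add: algebra_simps)
    have "ksign A (gdeg g) (dA (snd x g)) \<in> adeg A (n - gdeg g + 1)"
      by (rule additive_subgroup.ksign_in_subgroup[OF Alg.Ac.degree_subgroup Alg.adiff_adeg[OF c]])
    then have 2: "gen g (ksign A (gdeg g) (dA (snd x g))) \<in> mdeg (E G) (n + 1)"
      using gen by (intro gen_degree) (simp_all add: algebra_simps)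
    show ?case
      unfolding d_gen[OF Alg.Ac.degree_carrier[OF c]]
      using GG.degree_add[OF 1 2] unfolding same .
  next
    case (add y z)
    show ?case
      unfolding abelian_group_hom.hom_add[OF ext_diff_hom carrier_U[OF add(1)] carrier_U[OF add(2)]]
      using GG.degree_add[OF add(3,4)] unfolding same .
  qed
  show "mdiff (E G) (mdiff (E G) x) = \<zero>\<^bsub>E G\<^esub>" if x: "x \<in> carrier (E G)" for x
    unfolding same using x
  proof (induction x rule: ext_induct)
    case base
    have m: "fst x \<in> carrier M" by (rule free_extD(1)[OF x])
    show ?case
      unfolding d_base[OF m] d_base[OF Mod.mdiff_closed[OF m]] Mod.mdiff_mdiff[OF m]
      by (rule abelian_group_hom.hom_zero[OF base_hom])
  next
    case (gen g)
    show ?case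
      using mdeg_iff[of "bd g" G] bd[OF gen] d_bd[OF gen] free_extD(2)[OF x]
      by (intro d_d_gen) simp_all
  next
    case (add y z)
    have c: "d y \<in> carrier (EU)" "d z \<in> carrier (EU)"
      using abelian_group_hom.hom_closed[OF ext_diff_hom] carrier_U[OF add(1)] carrier_U[OF add(2)] by simp_all
    show ?case
      unfolding abelian_group_hom.hom_add[OF ext_diff_hom carrier_U[OF add(1)] carrier_U[OF add(2)]]
        abelian_group_hom.hom_add[OF ext_diff_hom c] add(3,4) by simp
  qed
  show "mdiff (E G) (x \<triangleleft>\<^bsub>E G\<^esub> a) = mdiff (E G) x \<triangleleft>\<^bsub>E G\<^esub> a \<oplus>\<^bsub>E G\<^esub> ksign (E G) n (x \<triangleleft>\<^bsub>E G\<^esub> adiff A a)"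
    if x: "x \<in> mdeg (E G) n" and a: "a \<in> carrier A" for x n a
  proof -
    have "x \<triangleleft>\<^bsub>E G\<^esub> dA a \<in> carrier (E G)"
      using mdeg_carrier[OF x] Alg.adiff_closed[OF a] by (rule G.ract_closed)
    note k = ksign_same[OF this, of n]
    have "x \<in> mdeg (EU) n" using x mdeg_iff[of x G n] by blast
    from d_leibniz[OF this a] show ?thesis unfolding k unfolding same .
  qed
qed

end

section \<open>Cells\<close>

text \<open>
  A cell is a triple \<open>(z, v, a)\<close> together with the degrees of \<open>z\<close> and \<open>a\<close>.  The generators
  adjoined for the cell \<open>t\<close> are \<open>(t, True)\<close>, written \<open>e\<close> in comments, and \<open>(t, False)\<close>, written \<open>f\<close>.
  The elements \<open>z\<close> and \<open>v\<close> involve finitely many generators of earlier cells; they are represented by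
  their part in \<open>M\<close> and a list of coefficients, which makes the type a datatype.  The degree of \<open>z\<close> is
  recorded because \<open>z\<close> may be zero; together with the degree of \<open>a\<close> it determines the degrees of
  the generators.
\<close>

datatype ('m, 'a) cell = Cell (cyc_base: 'm) (cyc_coeffs: "((('m, 'a) cell \<times> bool) \<times> 'a) list")
  (bnd_base: 'm) (bnd_coeffs: "((('m, 'a) cell \<times> bool) \<times> 'a) list")
  (denom: 'a) (cyc_deg: int) (denom_deg: int)

definition coeffs_elem :: "('k, 'a) dg_algebra \<Rightarrow> 'm \<Rightarrow> ('g \<times> 'a) list \<Rightarrow> 'm \<times> ('g \<Rightarrow> 'a)" where
  "coeffs_elem A m l = (m, \<lambda>g. case map_of l g of None \<Rightarrow> \<zero>\<^bsub>A\<^esub> | Some a \<Rightarrow> a)"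

definition gen_deg :: "('m, 'a) cell \<times> bool \<Rightarrow> int" where
  "gen_deg g = (if snd g then cyc_deg (fst g) - 1 else cyc_deg (fst g) + denom_deg (fst g) - 2)"

definition cyc where "cyc A t = coeffs_elem A (cyc_base t) (cyc_coeffs t)"
definition bnd where "bnd A t = coeffs_elem A (bnd_base t) (bnd_coeffs t)"

text \<open>
  \<open>d e = z\<close> and \<open>d f = v - e a\<close>; the value zero for cells that do not describe elements of the extension
  makes every boundary an element of it.
\<close>

definition gen_bd :: "('k, 'a) dg_algebra \<Rightarrow> ('a, 'm) dg_module \<Rightarrow> ('m, 'a) cell \<times> bool \<Rightarrow>
    'm \<times> (('m, 'a) cell \<times> bool \<Rightarrow> 'a)" where
  "gen_bd A M g = (let E = free_ext A M gen_deg id UNIV; t = fst g in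
     if cyc A t \<in> carrier E \<and> bnd A t \<in> carrier E \<and> denom t \<in> carrier A
     then if snd g then cyc A t else bnd A t \<ominus>\<^bsub>E\<^esub> gen_mult A M (t, True) (denom t)
     else \<zero>\<^bsub>E\<^esub>)"

lemma coeffs_elem_surj:
  assumes "x \<in> carrier (free_ext A M gdeg d G)"
  shows "\<exists>l. coeffs_elem A (fst x) l = x"
proof -
  obtain gs where gs: "set gs = {g. snd x g \<noteq> \<zero>\<^bsub>A\<^esub>}"
    using free_extD(3)[OF assms] finite_list by blast
  have "coeffs_elem A (fst x) (map (\<lambda>g. (g, snd x g)) gs) = x"
    using gs by (auto simp: coeffs_elem_def prod_eq_iff fun_eq_iff map_of_map_restrict
        restrict_map_def split: option.split)
  then show ?thesis by blast
qed

context dg_module_over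
begin

lemma gen_bd_typed: "gen_bd A M g \<in> carrier (free_ext A M gen_deg id UNIV)"
proof -
  interpret E: graded_right_module A "free_ext A M gen_deg id UNIV" "adeg A" by (rule free_ext_graded)
  have gm: "gen_mult A M g a \<in> carrier (free_ext A M gen_deg id UNIV)" if "a \<in> carrier A" for g a
  proof -
    have "finite {h. (if h = g then a else \<zero>\<^bsub>A\<^esub>) \<noteq> \<zero>\<^bsub>A\<^esub>}"
      by (rule finite_subset[of _ "{g}"]) auto
    then show ?thesis using that by (simp add: gen_mult_def free_ext_simps(1))
  qed
  show ?thesis unfolding gen_bd_def Let_def by (auto intro: E.M.zero_closed E.M.minus_closed gm)
qed

end

sublocale dg_module_over \<subseteq> cells: free_extension K A M gen_deg "gen_bd A M"
  by unfold_locales (rule gen_bd_typed)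

section \<open>The tower of cells\<close>

locale cell_tower = graded_prime K A P + dg_module_over K A M
  for K and A :: "('k, 'a) dg_algebra" (structure) and P and M :: "('a, 'm) dg_module"
begin

abbreviation "d \<equiv> ext_diff A M gen_deg (gen_bd A M)"
abbreviation "E T \<equiv> free_ext A M gen_deg d (T \<times> UNIV)"
abbreviation "EU \<equiv> free_ext A M gen_deg d UNIV"
abbreviation "gen \<equiv> gen_mult A M"

text \<open>
  \<open>t\<close> is a triple that can be attached to the extension by the cells in \<open>T\<close>.
\<close>

definition legal :: "('m, 'a) cell set \<Rightarrow> ('m, 'a) cell \<Rightarrow> bool" where
  "legal T t \<longleftrightarrow> cyc A t \<in> mdeg (E T) (cyc_deg t) \<and>
     bnd A t \<in> mdeg (E T) (cyc_deg t + denom_deg t - 1) \<and>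
     denom t \<in> denominators \<and> denom t \<in> adeg A (denom_deg t) \<and>
     d (cyc A t) = \<zero>\<^bsub>EU\<^esub> \<and> d (bnd A t) = cyc A t \<triangleleft>\<^bsub>EU\<^esub> denom t"

lemma legalD:
  assumes "legal T t"
  shows "cyc A t \<in> mdeg (E T) (cyc_deg t)"
    "bnd A t \<in> mdeg (E T) (cyc_deg t + denom_deg t - 1)"
    "denom t \<in> denominators" "denom t \<in> adeg A (denom_deg t)"
    "d (cyc A t) = \<zero>\<^bsub>EU\<^esub>" "d (bnd A t) = cyc A t \<triangleleft>\<^bsub>EU\<^esub> denom t"
  using assms unfolding legal_def by - (elim conjE, assumption)+

primrec stage :: "nat \<Rightarrow> ('m, 'a) cell set" where
  "stage 0 = {}"
| "stage (Suc r) = {t. legal (stage r) t}"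

lemma E_mono: "S \<subseteq> T \<Longrightarrow> x \<in> carrier (E S) \<Longrightarrow> x \<in> carrier (E T)"
  by (rule cells.carrier_mono) auto

lemma E_degree_mono: "S \<subseteq> T \<Longrightarrow> x \<in> mdeg (E S) n \<Longrightarrow> x \<in> mdeg (E T) n"
  using cells.mdeg_iff[of x "S \<times> UNIV" n] cells.mdeg_iff[of x "T \<times> UNIV" n] E_mono[of S T x] by simp

lemma legal_mono: "S \<subseteq> T \<Longrightarrow> legal S t \<Longrightarrow> legal T t"
  unfolding legal_def using E_degree_mono[of S T "cyc A t"] E_degree_mono[of S T "bnd A t"] by simp

lemma gen_bd_legal:
  assumes "legal T t"
  shows "gen_bd A M (t, True) = cyc A t"
    "gen_bd A M (t, False) = bnd A t \<ominus>\<^bsub>EU\<^esub> gen (t, True) (denom t)"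
proof -
  let ?E = "free_ext A M gen_deg id UNIV"
  have c: "cyc A t \<in> carrier EU" "bnd A t \<in> carrier EU"
    by (rule cells.carrier_U[OF cells.mdeg_carrier[OF legalD(1)[OF assms]]]
        cells.carrier_U[OF cells.mdeg_carrier[OF legalD(2)[OF assms]]])+
  have same: "carrier ?E = carrier EU" "zero ?E = zero EU" "add ?E = add EU"
    by (auto simp: free_ext_def Let_def)
  have eq: "carrier ?E = carrier EU" "a_minus ?E = a_minus EU"
    by (rule same(1), intro ext)
       (simp only: a_minus_def a_inv_def m_inv_def same partial_object.simps monoid.simps)
  have a: "denom t \<in> carrier A"
    by (rule Ac.degree_carrier[OF legalD(4)[OF assms]])
  have "cyc A t \<in> carrier ?E \<and> bnd A t \<in> carrier ?E \<and> denom t \<in> carrier A"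
    unfolding eq(1) by (intro conjI c a)
  note bd = if_P[OF this]
  have "gen_bd A M (t, b) = (if b then cyc A t else bnd A t \<ominus>\<^bsub>?E\<^esub> gen (t, True) (denom t))" for b
    unfolding gen_bd_def Let_def fst_conv snd_conv by (rule bd)
  then show "gen_bd A M (t, True) = cyc A t"
    "gen_bd A M (t, False) = bnd A t \<ominus>\<^bsub>EU\<^esub> gen (t, True) (denom t)"
    unfolding eq(2)[symmetric] by simp_all
qed

text \<open>
  The sets of cells that span a dg submodule.
\<close>

definition self_contained :: "('m, 'a) cell set \<Rightarrow> bool" where
  "self_contained T \<longleftrightarrow> (\<forall>t\<in>T. legal T t)"

lemma stage_Suc_mono: "stage r \<subseteq> stage (Suc r)"
proof (induction r)
  case (Suc r)
  then show ?case using legal_mono[OF Suc] by auto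
qed simp

lemma stage_mono: "r \<le> s \<Longrightarrow> stage r \<subseteq> stage s"
  by (rule lift_Suc_mono_le[of stage]) (rule stage_Suc_mono)

lemma self_containedI: "stage r \<subseteq> T \<Longrightarrow> T \<subseteq> stage (Suc r) \<Longrightarrow> self_contained T"
  unfolding self_contained_def using legal_mono[of "stage r" T] by auto

definition all_cells :: "('m, 'a) cell set" where "all_cells = (\<Union>r. stage r)"

text \<open>
  The union of the tower is closed under attaching cells, since a triple involves only finitely many
  generators and so occurs at a finite stage.
\<close>

lemma legal_all_cells:
  assumes "legal all_cells t" shows "t \<in> all_cells"
proof -
  have fin: "\<exists>r. F \<subseteq> stage r \<times> UNIV" if "finite F" "F \<subseteq> all_cells \<times> (UNIV :: bool set)" for F
    using that
  proof (induction F rule: finite_induct)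
    case (insert g F)
    then obtain r where "F \<subseteq> stage r \<times> UNIV" by blast
    moreover obtain s where "fst g \<in> stage s" using insert by (auto simp: all_cells_def)
    moreover have "stage r \<subseteq> stage (max r s)" "stage s \<subseteq> stage (max r s)"
      by (auto intro!: stage_mono del: subsetI)
    ultimately have "insert g F \<subseteq> stage (max r s) \<times> UNIV" by (cases g) auto
    then show ?case by blast
  qed simp
  have deg: "\<exists>r. x \<in> mdeg (E (stage r)) n" if x: "x \<in> mdeg (E all_cells) n" for x n
  proof -
    note xc = free_ext_mdegD(1)[OF x]
    have "{g. snd x g \<noteq> \<zero>} \<subseteq> all_cells \<times> UNIV" using free_extD(4)[OF xc] by blast
    then obtain r where "{g. snd x g \<noteq> \<zero>} \<subseteq> stage r \<times> UNIV" using fin free_extD(3)[OF xc] by blast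
    then have "x \<in> carrier (E (stage r))"
      using free_extD(1-3)[OF xc] by (auto simp: free_ext_simps(1))
    then show ?thesis
      using x cells.mdeg_iff[of x "all_cells \<times> UNIV" n] cells.mdeg_iff[of x "stage r \<times> UNIV" n] by blast
  qed
  obtain r s where rs: "cyc A t \<in> mdeg (E (stage r)) (cyc_deg t)"
    "bnd A t \<in> mdeg (E (stage s)) (cyc_deg t + denom_deg t - 1)"
    using deg[OF legalD(1)[OF assms]] deg[OF legalD(2)[OF assms]] by blast
  have "stage r \<subseteq> stage (max r s)" "stage s \<subseteq> stage (max r s)"
    by (auto intro!: stage_mono del: subsetI)
  then have "legal (stage (max r s)) t"
    using assms E_degree_mono[OF _ rs(1)] E_degree_mono[OF _ rs(2)] unfolding legal_def by simp
  then have "t \<in> stage (Suc (max r s))" by simp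
  then show ?thesis unfolding all_cells_def by blast
qed

lemma stage_all_cells: "stage r \<subseteq> all_cells"
  unfolding all_cells_def by blast

lemma self_contained_all_cells: "self_contained all_cells"
  unfolding self_contained_def
proof
  fix t assume "t \<in> all_cells"
  then obtain r where "t \<in> stage r" unfolding all_cells_def by blast
  then have "legal (stage r) t" using stage_Suc_mono[of r] by auto
  then show "legal all_cells t" by (rule legal_mono[OF stage_all_cells])
qed

lemma E_dg_module:
  assumes T: "self_contained T"
  shows "dg_right_module A (E T)"
proof (rule cells.free_ext_dg_module)
  interpret G: graded_right_module A "E T" "adeg A" by (rule free_ext_graded)
  interpret GG: graded_group "E T" "mdeg (E T)" by (rule G.graded_group_M)
  fix g :: "('m, 'a) cell \<times> bool" assume "g \<in> T \<times> UNIV"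
  then obtain t b where g: "g = (t, b)" "t \<in> T" "legal T t"
    using T by (cases g) (auto simp: self_contained_def)
  have cz: "cyc A t \<in> mdeg (E T) (cyc_deg t)" and bz: "bnd A t \<in> mdeg (E T) (cyc_deg t + denom_deg t - 1)"
    and a: "denom t \<in> denominators" "denom t \<in> adeg A (denom_deg t)"
    and dc: "d (cyc A t) = \<zero>\<^bsub>EU\<^esub>" and db: "d (bnd A t) = cyc A t \<triangleleft>\<^bsub>EU\<^esub> denom t"
    by (fact legalD[OF g(3)])+
  have aA: "denom t \<in> carrier A" "dA (denom t) = \<zero>"
    using denominators_cocycle[OF a(1)] Ac.cocycle_iff[of "denom t"] by simp_all
  have ga: "gen (t, True) (denom t) \<in> mdeg (E T) (cyc_deg t + denom_deg t - 1)"
    using a(2) g(2) by (intro cells.gen_degree) (simp_all add: gen_deg_def)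
  have cU: "cyc A t \<in> carrier EU" "bnd A t \<in> carrier EU" "gen (t, True) (denom t) \<in> carrier EU"
    by (rule cells.carrier_U[OF cells.mdeg_carrier], rule cz bz ga)+
  have minus: "bnd A t \<ominus>\<^bsub>E T\<^esub> gen (t, True) (denom t) = bnd A t \<ominus>\<^bsub>EU\<^esub> gen (t, True) (denom t)"
    unfolding a_minus_def cells.a_inv_same[OF cells.mdeg_carrier[OF ga]] cells.same_operations[of "T \<times> UNIV"] ..
  show "gen_bd A M g \<in> mdeg (E T) (gen_deg g + 1)"
  proof (cases b)
    case True
    then show ?thesis using cz gen_bd_legal(1)[OF g(3)] by (simp add: g(1) gen_deg_def)
  next
    case False
    have "bnd A t \<ominus>\<^bsub>EU\<^esub> gen (t, True) (denom t) \<in> mdeg (E T) (cyc_deg t + denom_deg t - 1)"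
      using GG.degree_minus[OF bz ga] unfolding minus .
    then show ?thesis using False gen_bd_legal(2)[OF g(3)] by (simp add: g(1) gen_deg_def)
  qed
  show "d (gen_bd A M g) = \<zero>\<^bsub>EU\<^esub>"
  proof (cases b)
    case True
    then show ?thesis using dc gen_bd_legal(1)[OF g(3)] by (simp add: g(1))
  next
    case False
    have y: "cyc A t \<triangleleft>\<^bsub>EU\<^esub> denom t \<in> carrier EU" using cU aA by (intro cells.U.ract_closed) simp_all
    have "d (gen (t, True) (denom t)) = cyc A t \<triangleleft>\<^bsub>EU\<^esub> denom t"
      using cells.d_gen[OF aA(1), of "(t, True)"] y gen_bd_legal(1)[OF g(3)]
        abelian_group_hom.hom_zero[OF cells.gen_hom, of "(t, True)"] aA(2) by simp
    then have "d (bnd A t \<ominus>\<^bsub>EU\<^esub> gen (t, True) (denom t)) = \<zero>\<^bsub>EU\<^esub>"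
      using cU y db abelian_group_hom.hom_add[OF cells.ext_diff_hom] abelian_group_hom.hom_a_inv[OF cells.ext_diff_hom]
      by (simp add: a_minus_def cells.U.M.r_neg)
    then show ?thesis using False gen_bd_legal(2)[OF g(3)] by (simp add: g(1))
  qed
qed

end

section \<open>The union of the tower is a homotopy localisation\<close>

context cell_tower
begin

abbreviation "\<Omega> \<equiv> E all_cells"
abbreviation omega_act (infixl "\<bullet>" 70) where "x \<bullet> a \<equiv> x \<triangleleft>\<^bsub>\<Omega>\<^esub> a"
abbreviation omega_add (infixl "\<boxplus>" 65) where "x \<boxplus> y \<equiv> x \<oplus>\<^bsub>\<Omega>\<^esub> y"
abbreviation omega_diff (infixl "\<boxminus>" 65) where "x \<boxminus> y \<equiv> x \<ominus>\<^bsub>\<Omega>\<^esub> y"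

sublocale W: dg_module_over K A \<Omega>
  by (intro dg_module_over.intro dga_axioms E_dg_module self_contained_all_cells)

lemma omega_operations:
  "zero EU = zero \<Omega>" "add EU = add \<Omega>" "ract EU = ract \<Omega>"
  by (rule cells.same_operations[of "all_cells \<times> UNIV", symmetric])+

lemma omega_d: "mdiff \<Omega> = d"
  by (rule cells.same_operations(4))

lemma omega_minus: "y \<in> carrier \<Omega> \<Longrightarrow> x \<ominus>\<^bsub>EU\<^esub> y = x \<boxminus> y"
  unfolding a_minus_def cells.a_inv_same[of y "all_cells \<times> UNIV"] omega_operations(2)
  by (rule refl)

lemma gen_omega:
  assumes "t \<in> all_cells"
  shows "gen (t, b) \<one> \<in> mdeg \<Omega> (gen_deg (t, b))"
    "\<alpha> \<in> carrier A \<Longrightarrow> gen (t, b) \<one> \<bullet> \<alpha> = gen (t, b) \<alpha>"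
proof -
  show "gen (t, b) \<one> \<in> mdeg \<Omega> (gen_deg (t, b))"
    using assms one_adeg by (intro cells.gen_degree) simp_all
  show "gen (t, b) \<one> \<bullet> \<alpha> = gen (t, b) \<alpha>" if "\<alpha> \<in> carrier A"
    using cells.gen_act[OF that, of "(t, b)" \<one>] unfolding A.l_one[OF that] omega_operations .
qed

lemma d_gen_omega:
  assumes t: "t \<in> all_cells"
  shows "mdiff \<Omega> (gen (t, True) \<one>) = cyc A t"
    "mdiff \<Omega> (gen (t, False) \<one>) = bnd A t \<boxminus> gen (t, True) \<one> \<bullet> denom t"
proof -
  have legal: "legal all_cells t" using t self_contained_all_cells by (simp add: self_contained_def)
  have a: "denom t \<in> carrier A" by (rule Ac.degree_carrier[OF legalD(4)[OF legal]])
  have one: "dA \<one> = \<zero>" using one_cocycle Ac.cocycle_iff[of \<one>] by simp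
  have dg: "d (gen g \<one>) = gen_bd A M g" for g
  proof -
    have "gen g (ksign A (gen_deg g) (dA \<one>)) = \<zero>\<^bsub>EU\<^esub>"
      using abelian_group_hom.hom_zero[OF cells.gen_hom, of g] by (simp add: one)
    then show ?thesis
      using cells.d_gen[of \<one> g] cells.bd_closed[of g] cells.U.ract_one by simp
  qed
  have gc: "gen (t, True) (denom t) \<in> carrier \<Omega>" using cells.gen_closed[OF a] t by simp
  show "mdiff \<Omega> (gen (t, True) \<one>) = cyc A t"
    unfolding omega_d dg by (rule gen_bd_legal(1)[OF legal])
  show "mdiff \<Omega> (gen (t, False) \<one>) = bnd A t \<boxminus> gen (t, True) \<one> \<bullet> denom t"
    unfolding omega_d dg gen_omega(2)[OF t a] omega_minus[OF gc, symmetric]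
    by (rule gen_bd_legal(2)[OF legal])
qed

text \<open>
  The property for which \<open>\<Omega>\<close> was constructed: maps from the cones of denominators to it are
  null-homotopic.
\<close>

lemma cell_exists:
  assumes z: "z \<in> mdeg \<Omega> p" and v: "v \<in> mdeg \<Omega> (p + i - 1)"
    and a: "a \<in> denominators" "a \<in> adeg A i"
    and dz: "mdiff \<Omega> z = \<zero>\<^bsub>\<Omega>\<^esub>" and dv: "mdiff \<Omega> v = z \<bullet> a"
  shows "\<exists>e\<in>carrier \<Omega>. \<exists>f\<in>carrier \<Omega>. mdiff \<Omega> e = z \<and> mdiff \<Omega> f = v \<boxminus> e \<bullet> a"
proof -
  obtain l where l: "coeffs_elem A (fst z) l = z"
    using coeffs_elem_surj[OF cells.mdeg_carrier[OF z]] by blast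
  obtain l' where l': "coeffs_elem A (fst v) l' = v"
    using coeffs_elem_surj[OF cells.mdeg_carrier[OF v]] by blast
  define t where "t = Cell (fst z) l (fst v) l' a p i"
  have t: "cyc A t = z" "bnd A t = v" "denom t = a" "cyc_deg t = p" "denom_deg t = i"
    using l l' by (simp_all add: t_def cyc_def bnd_def)
  have "legal all_cells t"
    unfolding legal_def t omega_operations using assms unfolding omega_d by blast
  then have tc: "t \<in> all_cells" by (rule legal_all_cells)
  have "gen (t, True) \<one> \<in> carrier \<Omega>" "gen (t, False) \<one> \<in> carrier \<Omega>"
    using gen_omega(1)[OF tc] cells.mdeg_carrier by blast+
  then show ?thesis using d_gen_omega[OF tc] unfolding t by blast
qed

text \<open>
  The claim for a part \<open>T\<close> of the tower.  Differentials and coboundaries are those of \<open>\<Omega>\<close>, so that the parts can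
  be compared.
\<close>

definition relatively_torsion :: "('m, 'a) cell set \<Rightarrow> bool" where
  "relatively_torsion T \<longleftrightarrow> (\<forall>x\<in>carrier (E T). \<forall>m\<in>carrier M. mdiff \<Omega> x = cells.base m \<longrightarrow>
     (\<exists>a\<in>denominators. \<exists>m'\<in>carrier M. x \<bullet> a \<boxminus> cells.base m' \<in> W.Mod.Mc.B))"

lemma base_omega: "m \<in> carrier M \<Longrightarrow> cells.base m \<in> carrier \<Omega>"
  by (rule cells.base_closed)

lemma base_act_omega: "a \<in> carrier A \<Longrightarrow> cells.base m \<bullet> a = cells.base (m \<triangleleft>\<^bsub>M\<^esub> a)"
  using cells.base_act[of a m] by (simp only: omega_operations)

lemma relatively_torsion_empty: "relatively_torsion {}"
  unfolding relatively_torsion_def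
proof (intro ballI impI)
  fix x m assume x: "x \<in> carrier (E {})"
  have "snd x g = \<zero>" for g using free_extD(4)[OF x, of g] by blast
  then have xb: "cells.base (fst x) = x" by (simp add: base_elem_def prod_eq_iff fun_eq_iff)
  have xW: "x \<in> carrier \<Omega>" by (rule E_mono[OF _ x]) simp
  have "x \<bullet> \<one> \<boxminus> cells.base (fst x) = \<zero>\<^bsub>\<Omega>\<^esub>"
    unfolding xb W.Mod.ract_one[OF xW] using W.Mod.M.minus_zero_iff[OF xW xW] by blast
  then have "x \<bullet> \<one> \<boxminus> cells.base (fst x) \<in> W.Mod.Mc.B"
    using W.Mod.Mc.B.zero_closed by (simp only:)
  then show "\<exists>a\<in>denominators. \<exists>m'\<in>carrier M. x \<bullet> a \<boxminus> cells.base m' \<in> W.Mod.Mc.B"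
    using one_denominator free_extD(1)[OF x] by blast
qed

lemma E_subgroup_omega:
  assumes "T \<subseteq> all_cells" shows "additive_subgroup (carrier (E T)) \<Omega>"
proof (rule W.Mod.M.additive_subgroupI_add)
  note S = cells.E_subgroup[of "T \<times> UNIV"]
  have sub: "carrier (E T) \<subseteq> carrier \<Omega>" using E_mono[OF assms] by blast
  show "carrier (E T) \<subseteq> carrier \<Omega>" by (rule sub)
  show "\<zero>\<^bsub>\<Omega>\<^esub> \<in> carrier (E T)"
    using additive_subgroup.zero_closed[OF S] by (simp only: omega_operations)
  show "x \<boxplus> y \<in> carrier (E T)" if "x \<in> carrier (E T)" "y \<in> carrier (E T)" for x y
    using additive_subgroup.a_closed[OF S that] by (simp only: omega_operations)
  show "\<ominus>\<^bsub>\<Omega>\<^esub> x \<in> carrier (E T)" if x: "x \<in> carrier (E T)" for x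
    using additive_subgroup.a_inv_closed[OF S x] cells.a_inv_same[OF subsetD[OF sub x]] by simp
qed

text \<open>
  An element \<open>x\<close> over the larger set is moved into the smaller one by \<open>cell_detach\<close>, after
  multiplication by the square of the denominator of \<open>t\<close>; the hypothesis on \<open>T\<close> then applies to the result,
  whose differential is still in \<open>M\<close>.
\<close>

lemma relatively_torsion_insert:
  assumes T: "self_contained T" "T \<subseteq> all_cells" "relatively_torsion T"
    and t: "legal T t"
  shows "relatively_torsion (insert t T)"
proof (cases "t \<in> T")
  case True
  then show ?thesis using T(3) by (simp add: insert_absorb)
next
  case tT: False
  have tc: "t \<in> all_cells" by (rule legal_all_cells[OF legal_mono[OF T(2) t]])
  interpret ET: dg_right_module A "E T" by (rule E_dg_module[OF T(1)])
  let ?e = "gen (t, True) \<one>" and ?f = "gen (t, False) \<one>" and ?a = "denom t"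
  have a: "?a \<in> denominators" "?a \<in> Ac.Z" "?a \<in> carrier A"
    using legalD(3)[OF t] denominators_cocycle by auto
  have same: "ract (E T) = ract \<Omega>" "mdiff (E T) = mdiff \<Omega>"
    unfolding omega_d by (fact cells.same_operations[of "T \<times> UNIV", unfolded omega_operations])+
  have add_omega: "x \<boxplus> y = (fst x \<oplus>\<^bsub>M\<^esub> fst y, \<lambda>g. snd x g \<oplus> snd y g)" for x y
    by (rule free_ext_simps(3))
  show ?thesis
    unfolding relatively_torsion_def
  proof (intro ballI impI)
    fix x m assume x: "x \<in> carrier (E (insert t T))" and m: "m \<in> carrier M"
      and dx: "mdiff \<Omega> x = cells.base m"
    let ?n = "(fst x, \<lambda>g. if fst g = t then \<zero> else snd x g)"
    let ?\<alpha> = "snd x (t, True)" and ?\<beta> = "snd x (t, False)"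
    have xs: "fst x \<in> carrier M" "\<And>g. snd x g \<in> carrier A" "finite {g. snd x g \<noteq> \<zero>}"
      using free_extD[OF x] by simp_all
    have xW: "x \<in> carrier \<Omega>" by (rule E_mono[OF _ x]) (use tc T(2) in blast)
    have n: "?n \<in> carrier (E T)"
    proof -
      have "{g. (if fst g = t then \<zero> else snd x g) \<noteq> \<zero>} \<subseteq> {g. snd x g \<noteq> \<zero>}" by auto
      then have "finite {g. (if fst g = t then \<zero> else snd x g) \<noteq> \<zero>}"
        using xs(3) finite_subset by blast
      moreover have "g \<in> T \<times> UNIV" if "(if fst g = t then \<zero> else snd x g) \<noteq> \<zero>" for g
        using that free_extD(4)[OF x, of g] by (cases g) (auto split: if_splits)
      ultimately show ?thesis using xs unfolding free_ext_simps(1) by simp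
    qed
    have cell: "?e \<bullet> \<xi> \<boxplus> ?f \<bullet> \<eta> =
        (\<zero>\<^bsub>M\<^esub>, \<lambda>g. if g = (t, True) then \<xi> else if g = (t, False) then \<eta> else \<zero>)"
      if "\<xi> \<in> carrier A" "\<eta> \<in> carrier A" for \<xi> \<eta>
      using that unfolding gen_omega(2)[OF tc that(1)] gen_omega(2)[OF tc that(2)] add_omega
      by (auto simp: gen_mult_def)
    have x_eq: "x = ?n \<boxplus> (?e \<bullet> ?\<alpha> \<boxplus> ?f \<bullet> ?\<beta>)"
    proof -
      have e: "snd x g = (if fst g = t then \<zero> else snd x g) \<oplus>
          (if g = (t, True) then ?\<alpha> else if g = (t, False) then ?\<beta> else \<zero>)" for g
        using xs(2) by (cases g) auto
      show ?thesis
        unfolding cell[OF xs(2) xs(2)] unfolding add_omega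
      proof (rule prod_eqI, unfold fst_conv snd_conv)
        show "fst x = fst x \<oplus>\<^bsub>M\<^esub> \<zero>\<^bsub>M\<^esub>" using xs(1) by simp
      qed (rule ext, rule e)
    qed
    have free: "\<xi> = \<zero> \<and> \<eta> = \<zero>"
      if k: "k \<in> carrier (E T)" and \<xi>\<eta>: "\<xi> \<in> carrier A" "\<eta> \<in> carrier A"
        and s: "k \<boxplus> (?e \<bullet> \<xi> \<boxplus> ?f \<bullet> \<eta>) \<in> carrier (E T)" for k \<xi> \<eta>
    proof -
      have "snd y (t, b) = \<zero>" if "y \<in> carrier (E T)" for y b
        using free_extD(4)[OF that, of "(t, b)"] tT by blast
      from this[OF s, of True] this[OF s, of False] this[OF k, of True] this[OF k, of False]
      show ?thesis
        unfolding cell[OF \<xi>\<eta>] unfolding add_omega using \<xi>\<eta> by simp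
    qed
    have dxT: "mdiff \<Omega> x \<in> carrier (E T)" unfolding dx by (rule cells.base_closed[OF m])
    have "\<exists>n'\<in>carrier (E T). x \<bullet> ?a \<bullet> ?a \<boxminus> n' \<in> W.Mod.Mc.B"
    proof (rule W.cell_detach[OF E_subgroup_omega[OF T(2)] _ _ a(2) denominator_central[OF a(1)]
          gen_omega(1)[OF tc] d_gen_omega(1)[OF tc] _ gen_omega(1)[OF tc] d_gen_omega(2)[OF tc] _
          free n xs(2) xs(2) x_eq dxT])
      show "k \<bullet> \<alpha> \<in> carrier (E T)" if "k \<in> carrier (E T)" "\<alpha> \<in> carrier A" for k \<alpha>
        using ET.ract_closed[OF that] unfolding same .
      show "mdiff \<Omega> k \<in> carrier (E T)" if "k \<in> carrier (E T)" for k
        using ET.mdiff_closed[OF that] unfolding same .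
      show "cyc A t \<in> carrier (E T)" "bnd A t \<in> carrier (E T)"
        using legalD(1,2)[OF t] cells.mdeg_carrier by blast+
    qed
    then obtain n' where n': "n' \<in> carrier (E T)" "x \<bullet> ?a \<bullet> ?a \<boxminus> n' \<in> W.Mod.Mc.B"
      by blast
    let ?aa = "?a \<otimes> ?a"
    have aa: "?aa \<in> denominators" "?aa \<in> carrier A" "?aa \<in> Ac.Z"
      using mult_denominator[OF a(1) a(1)] denominators_cocycle a(3) by auto
    have n'W: "n' \<in> carrier \<Omega>" by (rule E_mono[OF T(2) n'(1)])
    have xaa: "x \<bullet> ?a \<bullet> ?a = x \<bullet> ?aa"
      using W.Mod.ract_assoc[OF xW a(3) a(3)] by simp
    have xaaW: "x \<bullet> ?aa \<in> carrier \<Omega>" by (rule W.act_carrier[OF xW aa(2)])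
    have "mdiff \<Omega> (x \<bullet> ?aa \<boxminus> n') = \<zero>\<^bsub>\<Omega>\<^esub>"
      using W.Mod.Mc.coboundary_cocycle[OF n'(2)] W.Mod.Mc.cocycle_iff unfolding xaa by blast
    then have "mdiff \<Omega> n' = mdiff \<Omega> (x \<bullet> ?aa)"
      using W.Mod.Mc.d_minus[OF xaaW n'W]
        W.Mod.M.minus_zero_iff[OF W.Mod.mdiff_closed[OF xaaW] W.Mod.mdiff_closed[OF n'W]] by simp
    also have "\<dots> = cells.base (m \<triangleleft>\<^bsub>M\<^esub> ?aa)"
    proof -
      have "dA ?aa = \<zero>" using aa(3) Ac.cocycle_iff[of ?aa] by blast
      then show ?thesis using W.Mod.d_act_cocycle[OF xW aa(2)] dx base_act_omega[OF aa(2)] by simp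
    qed
    finally have dn': "mdiff \<Omega> n' = cells.base (m \<triangleleft>\<^bsub>M\<^esub> ?aa)" .
    obtain b m' where b: "b \<in> denominators" "m' \<in> carrier M" "n' \<bullet> b \<boxminus> cells.base m' \<in> W.Mod.Mc.B"
      using T(3) n'(1) dn' Mod.ract_closed[OF m aa(2)] unfolding relatively_torsion_def by blast
    have bA: "b \<in> Ac.Z" "b \<in> carrier A" using denominators_cocycle[OF b(1)] by auto
    have mW: "cells.base m' \<in> carrier \<Omega>" by (rule base_omega[OF b(2)])
    have s: "(x \<bullet> ?aa \<boxminus> n') \<bullet> b \<in> W.Mod.Mc.B"
      using W.coboundary_act[OF n'(2) bA(1)] unfolding xaa .
    have "x \<bullet> (?aa \<otimes> b) \<boxminus> cells.base m' =
        (x \<bullet> ?aa \<boxminus> n') \<bullet> b \<boxplus> (n' \<bullet> b \<boxminus> cells.base m')"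
    proof -
      have "(p \<boxminus> q) \<boxplus> (q \<boxminus> r) = p \<boxminus> r"
        if "p \<in> carrier \<Omega>" "q \<in> carrier \<Omega>" "r \<in> carrier \<Omega>" for p q r
        using that by (simp add: a_minus_def W.Mod.M.a_assoc W.Mod.M.r_neg1)
      from this[OF W.act_carrier[OF xaaW bA(2)] W.act_carrier[OF n'W bA(2)] mW] show ?thesis
        unfolding W.Mod.act_minus_left[OF xaaW n'W bA(2)] W.Mod.ract_assoc[OF xW aa(2) bA(2)] by simp
    qed
    then have "x \<bullet> (?aa \<otimes> b) \<boxminus> cells.base m' \<in> W.Mod.Mc.B"
      using W.Mod.Mc.B.a_closed[OF s b(3)] by simp
    then show "\<exists>a\<in>denominators. \<exists>m'\<in>carrier M. x \<bullet> a \<boxminus> cells.base m' \<in> W.Mod.Mc.B"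
      using mult_denominator[OF aa(1) b(1)] b(2) by blast
  qed
qed

text \<open>
  A stage attaches arbitrarily many cells at once, but any element involves finitely many of them, and all are
  legal over the previous stage, so they can be attached one after the other.
\<close>

lemma relatively_torsion_stage: "relatively_torsion (stage r)"
proof (induction r)
  case 0
  then show ?case using relatively_torsion_empty by simp
next
  case (Suc r)
  have fin: "relatively_torsion (stage r \<union> F)" if "finite F" "F \<subseteq> stage (Suc r)" for F
    using that
  proof (induction F rule: finite_induct)
    case empty
    then show ?case using Suc by simp
  next
    case (insert t F)
    have "self_contained (stage r \<union> F)"
      using insert(4) stage_Suc_mono[of r] by (intro self_containedI[of r]) blast+
    moreover have "stage r \<union> F \<subseteq> all_cells"
      using insert(4) stage_all_cells[of r] stage_all_cells[of "Suc r"] by blast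
    moreover have "legal (stage r \<union> F) t"
    proof (rule legal_mono)
      show "legal (stage r) t" using insert(4) by simp
    qed simp
    ultimately have "relatively_torsion (insert t (stage r \<union> F))"
      using insert by (intro relatively_torsion_insert) blast+
    then show ?case by simp
  qed
  show ?case
    unfolding relatively_torsion_def
  proof (intro ballI impI)
    fix x m assume x: "x \<in> carrier (E (stage (Suc r)))" and m: "m \<in> carrier M" "mdiff \<Omega> x = cells.base m"
    let ?F = "fst ` {g. snd x g \<noteq> \<zero>}"
    have F: "finite ?F" "?F \<subseteq> stage (Suc r)"
      using free_extD(3,4)[OF x] by (auto simp: mem_Times_iff simp del: stage.simps)
    have "x \<in> carrier (E (stage r \<union> ?F))"
      using free_extD(1-3)[OF x] unfolding free_ext_simps(1) by (auto simp: mem_Times_iff)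
    then show "\<exists>a\<in>denominators. \<exists>m'\<in>carrier M. x \<bullet> a \<boxminus> cells.base m' \<in> W.Mod.Mc.B"
      using fin[OF F] m unfolding relatively_torsion_def by blast
  qed
qed

lemma relatively_torsion_all_cells: "relatively_torsion all_cells"
  unfolding relatively_torsion_def
proof (intro ballI impI)
  fix x m assume x: "x \<in> carrier \<Omega>" and m: "m \<in> carrier M" "mdiff \<Omega> x = cells.base m"
  have "\<exists>r. F \<subseteq> stage r" if "finite F" "F \<subseteq> all_cells" for F
    using that
  proof (induction F rule: finite_induct)
    case (insert t F)
    then obtain r s where "F \<subseteq> stage r" "t \<in> stage s" by (auto simp: all_cells_def)
    then have "insert t F \<subseteq> stage (max r s)"
      using stage_mono[of r "max r s"] stage_mono[of s "max r s"] by auto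
    then show ?case by blast
  qed simp
  moreover have "finite (fst ` {g. snd x g \<noteq> \<zero>})" "fst ` {g. snd x g \<noteq> \<zero>} \<subseteq> all_cells"
    using free_extD(3,4)[OF x] by (auto simp: mem_Times_iff)
  ultimately obtain r where r: "fst ` {g. snd x g \<noteq> \<zero>} \<subseteq> stage r" by blast
  have "x \<in> carrier (E (stage r))"
    using free_extD(1-3)[OF x] r unfolding free_ext_simps(1) by (auto simp: mem_Times_iff)
  then show "\<exists>a\<in>denominators. \<exists>m'\<in>carrier M. x \<bullet> a \<boxminus> cells.base m' \<in> W.Mod.Mc.B"
    using relatively_torsion_stage[of r] m unfolding relatively_torsion_def by blast
qed

text \<open>
  Cells have homogeneous data, so the argument is carried out on components.
\<close>

lemma omega_denominators_inj:
  assumes a: "a \<in> denominators" and z: "z \<in> W.Mod.Mc.Z" "z \<bullet> a \<in> W.Mod.Mc.B"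
  shows "z \<in> W.Mod.Mc.B"
proof -
  obtain i where i: "a \<in> adeg A i" using a by (auto simp: denominators_def)
  have aA: "a \<in> carrier A" using denominators_cocycle[OF a] by simp
  obtain v where v: "v \<in> carrier \<Omega>" "z \<bullet> a = mdiff \<Omega> v"
    using z(2) W.Mod.Mc.coboundary_iff by blast
  have zc: "z \<in> carrier \<Omega>" using z(1) by simp
  show ?thesis
  proof (rule W.Mod.Mc.in_subgroup_by_components[OF W.Mod.Mc.coboundaries_subgroup zc])
    fix n
    let ?z = "W.Mod.Mc.cp n z" and ?v = "W.Mod.Mc.cp (n + i - 1) v"
    have dz: "mdiff \<Omega> ?z = \<zero>\<^bsub>\<Omega>\<^esub>"
      using W.Mod.Mc.cocycle_component[OF z(1), of n] W.Mod.Mc.cocycle_iff by blast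
    have dv: "mdiff \<Omega> ?v = ?z \<bullet> a"
    proof -
      have "mdiff \<Omega> ?v = W.Mod.Mc.cp (n + i) (mdiff \<Omega> v)"
        using W.Mod.Mc.d_component[OF v(1), of "n + i - 1"] by simp
      also have "\<dots> = W.Mod.Mc.cp (n + i) (z \<bullet> a)" by (simp only: v(2))
      also have "\<dots> = ?z \<bullet> a"
        by (rule component_natural[OF W.Mod.graded_group_M W.Mod.graded_group_M W.Mod.act_hom[OF aA] _ zc])
           (rule W.Mod.ract_mdeg[OF _ i])
      finally show ?thesis .
    qed
    obtain e where e: "e \<in> carrier \<Omega>" "mdiff \<Omega> e = ?z"
      using cell_exists[OF W.Mod.Mc.component_degree[OF zc] W.Mod.Mc.component_degree[OF v(1)] a i dz dv]
      by (elim bexE conjE) (rule that)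
    show "?z \<in> W.Mod.Mc.B" unfolding e(2)[symmetric] W.Mod.Mc.coboundary_iff using e(1) by blast
  qed
qed

text \<open>
  A homogeneous cocycle \<open>v\<close> gives the cell with \<open>z = 0\<close>, hence \<open>e\<close> and \<open>f\<close> with \<open>d e = 0\<close> and \<open>d f = v - e a\<close>.
\<close>

lemma omega_denominators_surj:
  assumes a: "a \<in> denominators" and v: "v \<in> W.Mod.Mc.Z"
  shows "\<exists>y\<in>W.Mod.Mc.Z. v \<boxminus> y \<bullet> a \<in> W.Mod.Mc.B"
proof -
  obtain i where i: "a \<in> adeg A i" using a by (auto simp: denominators_def)
  have aA: "a \<in> carrier A" using denominators_cocycle[OF a] by simp
  have vc: "v \<in> carrier \<Omega>" using v by simp
  let ?U = "(\<lambda>y. y \<bullet> a) ` W.Mod.Mc.Z"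
  note h = abelian_group_hom.hom_add[OF W.Mod.act_hom[OF aA]] abelian_group_hom.hom_zero[OF W.Mod.act_hom[OF aA]]
    abelian_group_hom.hom_a_inv[OF W.Mod.act_hom[OF aA]]
  note Zs = W.Mod.Mc.cocycles_subgroup
  have "additive_subgroup ?U \<Omega>"
  proof (rule W.Mod.M.additive_subgroupI_add)
    show "?U \<subseteq> carrier \<Omega>"
      using W.act_carrier[OF W.Mod.Mc.cocycle_carrier aA] by blast
    show "\<zero>\<^bsub>\<Omega>\<^esub> \<in> ?U"
      by (rule image_eqI[where x = "\<zero>\<^bsub>\<Omega>\<^esub>"], rule h(2)[symmetric], rule additive_subgroup.zero_closed[OF Zs])
    show "x \<boxplus> y \<in> ?U" if "x \<in> ?U" "y \<in> ?U" for x y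
    proof -
      obtain x' y' where xy: "x' \<in> W.Mod.Mc.Z" "x = x' \<bullet> a" "y' \<in> W.Mod.Mc.Z" "y = y' \<bullet> a"
        using \<open>x \<in> ?U\<close> \<open>y \<in> ?U\<close> by blast
      have "x \<boxplus> y = (x' \<boxplus> y') \<bullet> a" using h(1)[OF W.Mod.Mc.cocycle_carrier[OF xy(1)] W.Mod.Mc.cocycle_carrier[OF xy(3)]] xy(2,4) by metis
      then show ?thesis using W.Mod.Mc.cocycle_add[OF xy(1,3)] by blast
    qed
    show "\<ominus>\<^bsub>\<Omega>\<^esub> x \<in> ?U" if x: "x \<in> ?U" for x
    proof -
      obtain x' where x': "x' \<in> W.Mod.Mc.Z" "x = x' \<bullet> a" using x by blast
      have "\<ominus>\<^bsub>\<Omega>\<^esub> x = (\<ominus>\<^bsub>\<Omega>\<^esub> x') \<bullet> a" using h(3)[OF W.Mod.Mc.cocycle_carrier[OF x'(1)]] x'(2) by metis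
      then show ?thesis using additive_subgroup.a_inv_closed[OF Zs x'(1)] by blast
    qed
  qed
  from W.Mod.M.subgroup_plus_subgroup[OF this W.Mod.Mc.coboundaries_subgroup]
  have "v \<in> {x \<in> carrier \<Omega>. \<exists>u\<in>?U. x \<boxminus> u \<in> W.Mod.Mc.B}"
  proof (rule W.Mod.Mc.in_subgroup_by_components[OF _ vc])
    fix n
    let ?v = "W.Mod.Mc.cp n v"
    have dv: "mdiff \<Omega> ?v = \<zero>\<^bsub>\<Omega>\<^esub>"
      using W.Mod.Mc.cocycle_component[OF v, of n] W.Mod.Mc.cocycle_iff by blast
    \<comment> \<open>The zero cycle is placed in degree \<open>n - i + 1\<close>, which makes \<open>e\<close> of degree \<open>n - i\<close>.\<close>
    have d: "?v \<in> mdeg \<Omega> ((n - i + 1) + i - 1)" using W.Mod.Mc.component_degree[OF vc, of n] by simp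
    obtain e f where ef: "e \<in> carrier \<Omega>" "f \<in> carrier \<Omega>" "mdiff \<Omega> e = \<zero>\<^bsub>\<Omega>\<^esub>"
      "mdiff \<Omega> f = ?v \<boxminus> e \<bullet> a"
    proof -
      have "mdiff \<Omega> ?v = \<zero>\<^bsub>\<Omega>\<^esub> \<bullet> a" unfolding dv W.Mod.act_zero_left[OF aA] ..
      from cell_exists[OF W.Mod.Mc.degree_zero d a i W.Mod.Mc.d_zero this]
      show ?thesis by (elim bexE conjE) (rule that)
    qed
    have "e \<in> W.Mod.Mc.Z" using ef W.Mod.Mc.cocycle_iff by blast
    moreover have "?v \<boxminus> e \<bullet> a \<in> W.Mod.Mc.B"
      unfolding ef(4)[symmetric] W.Mod.Mc.coboundary_iff using ef(2) by blast
    ultimately show "?v \<in> {x \<in> carrier \<Omega>. \<exists>u\<in>?U. x \<boxminus> u \<in> W.Mod.Mc.B}"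
      using W.Mod.Mc.component_closed[OF vc] by blast
  qed
  then show ?thesis by blast
qed

end

theorem homotopy_localisation_exists:
  assumes "graded_prime K A P" "dg_module_over K A M"
  defines "bd \<equiv> gen_bd A M"
  shows "\<exists>T. homotopy_localisation K A P M
    (free_ext A M gen_deg (ext_diff A M gen_deg bd) T) (base_elem A)"
proof -
  interpret cell_tower K A P M using assms(1,2) by (rule cell_tower.intro)
  have "homotopy_localisation K A P M \<Omega> (base_elem A)"
  proof (intro homotopy_localisation.intro homotopy_localisation_axioms.intro)
    show "graded_prime K A P" "dg_module_over K A M" by (fact assms)+
    show "dg_module_over K A \<Omega>" by (rule W.dg_module_over_axioms)
    have add: "cells.base (x \<oplus>\<^bsub>M\<^esub> y) = cells.base x \<boxplus> cells.base y"
      if "x \<in> carrier M" "y \<in> carrier M" for x y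
      using abelian_group_hom.hom_add[OF cells.base_hom that] by (simp only: omega_operations)
    show "abelian_group_hom M \<Omega> (base_elem A)"
      using Mod.M.abelian_group_axioms free_ext_abelian_group base_omega add
      by (rule abelian_group_homI_add)
    show "cells.base (x \<triangleleft>\<^bsub>M\<^esub> a) = cells.base x \<bullet> a" if "x \<in> carrier M" "a \<in> carrier A" for x a
      using base_act_omega[OF that(2)] by simp
    show "cells.base x \<in> mdeg \<Omega> n" if "x \<in> mdeg M n" for x n
      by (rule cells.base_degree[OF that])
    show "cells.base (mdiff M x) = mdiff \<Omega> (cells.base x)" if "x \<in> carrier M" for x
      unfolding omega_d by (rule cells.d_base[OF that, symmetric])
    show "inj_on (base_elem A) (carrier M)" by (auto simp: inj_on_def base_elem_def)
    show "\<exists>a\<in>graded_prime.denominators A P. \<exists>m'\<in>carrier M.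
        w \<bullet> a \<boxminus> cells.base m' \<in> W.Mod.Mc.B"
      if "w \<in> carrier \<Omega>" "m \<in> carrier M" "mdiff \<Omega> w = cells.base m" for w m
      using relatively_torsion_all_cells that unfolding relatively_torsion_def by blast
  qed (fact omega_denominators_inj omega_denominators_surj)+
  then show ?thesis unfolding bd_def by blast
qed

section \<open>Transport along an injection\<close>

definition transported :: "('n \<Rightarrow> 'z) \<Rightarrow> ('a, 'n) dg_module \<Rightarrow> ('a, 'z) dg_module" where
  "transported h N = (let g = inv_into (carrier N) h in
     \<lparr>carrier = h ` carrier N, mult = (\<lambda>x y. x), one = h \<zero>\<^bsub>N\<^esub>, zero = h \<zero>\<^bsub>N\<^esub>,
      add = (\<lambda>x y. h (g x \<oplus>\<^bsub>N\<^esub> g y)), ract = (\<lambda>x a. h (g x \<triangleleft>\<^bsub>N\<^esub> a)),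
      mdeg = (\<lambda>n. h ` mdeg N n), mdiff = (\<lambda>x. h (mdiff N (g x)))\<rparr>)"

locale transport = dg_module_over K A N
  for K and A :: "('k, 'a) dg_algebra" (structure) and N :: "('a, 'n) dg_module" +
  fixes h :: "'n \<Rightarrow> 'z"
  assumes h_inj: "inj_on h (carrier N)"
begin

abbreviation "T \<equiv> transported h N"

lemma T_simps:
  "carrier T = h ` carrier N" "zero T = h \<zero>\<^bsub>N\<^esub>" "mdeg T n = h ` mdeg N n"
  "\<lbrakk>x \<in> carrier N; y \<in> carrier N\<rbrakk> \<Longrightarrow> h x \<oplus>\<^bsub>T\<^esub> h y = h (x \<oplus>\<^bsub>N\<^esub> y)"
  "x \<in> carrier N \<Longrightarrow> h x \<triangleleft>\<^bsub>T\<^esub> a = h (x \<triangleleft>\<^bsub>N\<^esub> a)"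
  "x \<in> carrier N \<Longrightarrow> mdiff T (h x) = h (mdiff N x)"
  by (simp_all add: transported_def Let_def inv_into_f_f[OF h_inj])

lemma h_eq_iff: "\<lbrakk>x \<in> carrier N; y \<in> carrier N\<rbrakk> \<Longrightarrow> h x = h y \<longleftrightarrow> x = y"
  using h_inj by (auto simp: inj_on_def)

lemma T_abelian: "abelian_group T"
proof (rule abelian_groupI)
  fix \<xi> assume "\<xi> \<in> carrier T"
  then obtain x where x: "x \<in> carrier N" "\<xi> = h x" by (auto simp: T_simps(1))
  then have "h (\<ominus>\<^bsub>N\<^esub> x) \<oplus>\<^bsub>T\<^esub> \<xi> = \<zero>\<^bsub>T\<^esub>" by (simp add: T_simps Mod.M.l_neg)
  moreover have "h (\<ominus>\<^bsub>N\<^esub> x) \<in> carrier T" using x by (simp add: T_simps)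
  ultimately show "\<exists>\<eta>\<in>carrier T. \<eta> \<oplus>\<^bsub>T\<^esub> \<xi> = \<zero>\<^bsub>T\<^esub>" by blast
qed (auto simp: T_simps(1,2), simp_all add: T_simps(4) Mod.M.a_ac)

lemma h_hom: "abelian_group_hom N T h"
  by (rule abelian_group_homI_add[OF Mod.M.abelian_group_axioms T_abelian]) (simp_all add: T_simps)

lemma h_neg: "x \<in> carrier N \<Longrightarrow> \<ominus>\<^bsub>T\<^esub> h x = h (\<ominus>\<^bsub>N\<^esub> x)"
  using abelian_group_hom.hom_a_inv[OF h_hom] by simp

lemma h_minus: "\<lbrakk>x \<in> carrier N; y \<in> carrier N\<rbrakk> \<Longrightarrow> h x \<ominus>\<^bsub>T\<^esub> h y = h (x \<ominus>\<^bsub>N\<^esub> y)"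
  by (simp add: a_minus_def h_neg T_simps)

lemma h_ksign: "x \<in> carrier N \<Longrightarrow> ksign T n (h x) = h (ksign N n x)"
  by (simp add: ksign_def h_neg)

lemma T_grading: "graded_group T (mdeg T)"
proof -
  interpret T: abelian_group T by (rule T_abelian)
  define p where "p n \<xi> = h (Mod.Mc.cp n (inv_into (carrier N) h \<xi>))" for n \<xi>
  have p: "p n (h x) = h (Mod.Mc.cp n x)" if "x \<in> carrier N" for n x
    using that by (simp add: p_def inv_into_f_f[OF h_inj])
  show ?thesis
  proof (rule T.graded_groupI[where p = p])
    show "additive_subgroup (mdeg T n) T" for n
    proof (rule T.additive_subgroupI_add)
      show "\<zero>\<^bsub>T\<^esub> \<in> mdeg T n" by (simp add: T_simps)
    qed (auto simp: T_simps Mod.Mc.degree_carrier Mod.Mc.degree_add Mod.Mc.degree_neg h_neg)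
    show "abelian_group_hom T T (p n)" for n
      by (rule abelian_group_homI_add[OF T_abelian T_abelian])
         (auto simp: T_simps p Mod.Mc.component_add)
    show "p n \<xi> \<in> mdeg T n" if "\<xi> \<in> carrier T" for n \<xi>
      using that by (auto simp: T_simps p Mod.Mc.component_degree)
    show "finite {n. p n \<xi> \<noteq> \<zero>\<^bsub>T\<^esub>}" if "\<xi> \<in> carrier T" for \<xi>
      using that Mod.Mc.component_finite by (auto simp: T_simps p h_eq_iff)
    show "p m \<xi> = (if m = n then \<xi> else \<zero>\<^bsub>T\<^esub>)" if "\<xi> \<in> mdeg T n" for m n \<xi>
      using that by (auto simp: T_simps p Mod.Mc.degree_carrier Mod.Mc.component_of_degree)
    show "\<xi> = \<zero>\<^bsub>T\<^esub>" if \<xi>: "\<xi> \<in> carrier T" and 0: "\<And>n. p n \<xi> = \<zero>\<^bsub>T\<^esub>" for \<xi>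
    proof -
      obtain x where x: "x \<in> carrier N" "\<xi> = h x" using \<xi> by (auto simp: T_simps(1))
      have "Mod.Mc.cp n x = \<zero>\<^bsub>N\<^esub>" for n
        using 0[of n] x h_eq_iff[of "Mod.Mc.cp n x" "\<zero>\<^bsub>N\<^esub>"] by (simp add: p T_simps(2))
      then have "x = \<zero>\<^bsub>N\<^esub>" by (rule Mod.Mc.zero_by_components[OF x(1)])
      then show ?thesis using x by (simp add: T_simps(2))
    qed
  qed
qed

lemma T_dg_module: "dg_right_module A T"
proof (intro dg_right_module.intro graded_right_module.intro graded_right_module_axioms.intro
    dg_right_module_axioms.intro)
  show "ring A" by (rule Alg.A.ring_axioms)
  show "abelian_group T" by (rule T_abelian)
  show "grading T (mdeg T)" by (rule graded_group.grading[OF T_grading])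
  show "mdiff T (\<xi> \<triangleleft>\<^bsub>T\<^esub> a) = mdiff T \<xi> \<triangleleft>\<^bsub>T\<^esub> a \<oplus>\<^bsub>T\<^esub> ksign T n (\<xi> \<triangleleft>\<^bsub>T\<^esub> adiff A a)"
    if "\<xi> \<in> mdeg T n" "a \<in> carrier A" for \<xi> a n
    using that
    by (auto simp: T_simps Mod.Mc.degree_carrier Mod.mleibniz h_ksign Alg.adiff_closed Mod.mdiff_closed)
qed (auto simp: T_simps Mod.Mc.degree_carrier Mod.mdiff_closed Mod.mdiff_add Mod.mdiff_mdeg
    Mod.mdiff_mdiff Mod.ract_l_distr Mod.ract_r_distr Mod.ract_assoc Mod.ract_one Mod.ract_mdeg)

lemma T_dg_module_over: "dg_module_over K A T"
  by (intro dg_module_over.intro Alg.dga_axioms T_dg_module)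

lemma T_cocycles: "cocycles T (mdiff T) = h ` Mod.Mc.Z"
proof -
  have iff: "mdiff T (h x) = \<zero>\<^bsub>T\<^esub> \<longleftrightarrow> mdiff N x = \<zero>\<^bsub>N\<^esub>" if "x \<in> carrier N" for x
    unfolding T_simps(6)[OF that] T_simps(2)
    by (rule h_eq_iff[OF Mod.mdiff_closed[OF that] Mod.M.zero_closed])
  have "cocycles T (mdiff T) = {h x | x. x \<in> carrier N \<and> mdiff T (h x) = \<zero>\<^bsub>T\<^esub>}"
    unfolding cocycles_def T_simps(1) by blast
  also have "\<dots> = h ` Mod.Mc.Z"
    unfolding cocycles_def using iff by blast
  finally show ?thesis .
qed

lemma T_coboundaries: "coboundaries T (mdiff T) = h ` Mod.Mc.B"
  unfolding coboundaries_def T_simps(1) image_image by (rule image_cong[OF refl T_simps(6)])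

end

lemma (in homotopy_localisation) transport_localisation:
  assumes h: "inj_on h (carrier N)"
  shows "homotopy_localisation K A P M (transported h N) (\<lambda>x. h (j x))"
proof -
  interpret T: transport K A N h
    by (intro transport.intro transport_axioms.intro M1.dg_module_over_axioms h)
  have h_coboundary: "h x \<in> coboundaries T.T (mdiff T.T) \<longleftrightarrow> x \<in> B1" if "x \<in> carrier N" for x
    unfolding T.T_coboundaries using T.h_eq_iff[OF that M1.Mod.Mc.coboundary_carrier] by blast
  show ?thesis
  proof (intro homotopy_localisation.intro homotopy_localisation_axioms.intro)
    show "graded_prime K A P" by (rule graded_prime_axioms)
    show "dg_module_over K A M" by (rule M0.dg_module_over_axioms)
    show "dg_module_over K A T.T" by (rule T.T_dg_module_over)
    show "abelian_group_hom M T.T (\<lambda>x. h (j x))"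
      by (rule abelian_group_homI_add[OF M0.Mod.M.abelian_group_axioms T.T_abelian])
         (simp_all add: T.T_simps)
    show "h (j (x \<triangleleft>\<^bsub>M\<^esub> a)) = h (j x) \<triangleleft>\<^bsub>T.T\<^esub> a" if "x \<in> carrier M" "a \<in> carrier A" for x a
      using that by (simp add: T.T_simps j_act)
    show "h (j x) \<in> mdeg T.T n" if "x \<in> mdeg M n" for x n
      using j_degree[OF that] by (simp add: T.T_simps)
    show "h (j (mdiff M x)) = mdiff T.T (h (j x))" if "x \<in> carrier M" for x
      using that by (simp add: T.T_simps j_d)
    show "inj_on (\<lambda>x. h (j x)) (carrier M)"
      using j_inj h by (auto simp: inj_on_def)
    show "\<zeta> \<in> coboundaries T.T (mdiff T.T)"
      if a: "a \<in> denominators" and z: "\<zeta> \<in> cocycles T.T (mdiff T.T)"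
        and za: "\<zeta> \<triangleleft>\<^bsub>T.T\<^esub> a \<in> coboundaries T.T (mdiff T.T)" for a \<zeta>
    proof -
      obtain z' where z': "z' \<in> Z1" "\<zeta> = h z'" using z unfolding T.T_cocycles by blast
      have aA: "a \<in> carrier A" using denominators_cocycle[OF a] by simp
      have "h (z' \<triangleleft>\<^bsub>N\<^esub> a) \<in> coboundaries T.T (mdiff T.T)" using za z' by (simp add: T.T_simps)
      then have "z' \<triangleleft>\<^bsub>N\<^esub> a \<in> B1" using h_coboundary[of "z' \<triangleleft>\<^bsub>N\<^esub> a"] z' aA by simp
      then have "z' \<in> B1" by (rule denominators_inj[OF a z'(1)])
      then show ?thesis unfolding z'(2) T.T_coboundaries by blast
    qed
    show "\<exists>\<eta>\<in>cocycles T.T (mdiff T.T). \<nu> \<ominus>\<^bsub>T.T\<^esub> \<eta> \<triangleleft>\<^bsub>T.T\<^esub> a \<in> coboundaries T.T (mdiff T.T)"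
      if a: "a \<in> denominators" and v: "\<nu> \<in> cocycles T.T (mdiff T.T)" for a \<nu>
    proof -
      obtain v' where v': "v' \<in> Z1" "\<nu> = h v'" using v unfolding T.T_cocycles by blast
      have aA: "a \<in> carrier A" using denominators_cocycle[OF a] by simp
      obtain y where y: "y \<in> Z1" "v' \<ominus>\<^bsub>N\<^esub> y \<triangleleft>\<^bsub>N\<^esub> a \<in> B1" using denominators_surj[OF a v'(1)] by blast
      have "\<nu> \<ominus>\<^bsub>T.T\<^esub> h y \<triangleleft>\<^bsub>T.T\<^esub> a = h (v' \<ominus>\<^bsub>N\<^esub> y \<triangleleft>\<^bsub>N\<^esub> a)"
        using v' y(1) aA by (simp add: T.T_simps T.h_minus)
      then have "\<nu> \<ominus>\<^bsub>T.T\<^esub> h y \<triangleleft>\<^bsub>T.T\<^esub> a \<in> coboundaries T.T (mdiff T.T)"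
        unfolding T.T_coboundaries using y(2) by blast
      moreover have "h y \<in> cocycles T.T (mdiff T.T)" unfolding T.T_cocycles using y(1) by blast
      ultimately show ?thesis by blast
    qed
    show "\<exists>a\<in>denominators. \<exists>m'\<in>carrier M.
        \<omega> \<triangleleft>\<^bsub>T.T\<^esub> a \<ominus>\<^bsub>T.T\<^esub> h (j m') \<in> coboundaries T.T (mdiff T.T)"
      if w: "\<omega> \<in> carrier T.T" and m: "m \<in> carrier M" and dw: "mdiff T.T \<omega> = h (j m)" for \<omega> m
    proof -
      obtain x where x: "x \<in> carrier N" "\<omega> = h x" using w by (auto simp: T.T_simps(1))
      have "mdiff N x = j m"
        using dw x m T.h_eq_iff[of "mdiff N x" "j m"] M1.Mod.mdiff_closed by (simp add: T.T_simps)
      then obtain a m' where a: "a \<in> denominators" "m' \<in> carrier M" "x \<triangleleft>\<^bsub>N\<^esub> a \<ominus>\<^bsub>N\<^esub> j m' \<in> B1"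
        using relative_torsion[OF x(1) m] by blast
      have aA: "a \<in> carrier A" using denominators_cocycle[OF a(1)] by simp
      have "\<omega> \<triangleleft>\<^bsub>T.T\<^esub> a \<ominus>\<^bsub>T.T\<^esub> h (j m') = h (x \<triangleleft>\<^bsub>N\<^esub> a \<ominus>\<^bsub>N\<^esub> j m')"
        using x a(2) aA by (simp add: T.T_simps T.h_minus)
      then have "\<omega> \<triangleleft>\<^bsub>T.T\<^esub> a \<ominus>\<^bsub>T.T\<^esub> h (j m') \<in> coboundaries T.T (mdiff T.T)"
        unfolding T.T_coboundaries using a(3) by blast
      then show ?thesis using a(1,2) by blast
    qed
  qed
qed

section \<open>Cells as words\<close>

text \<open>
  Any two distinct letters would do; the summands of the sum type provide them even if \<open>'m\<close> and \<open>'a\<close>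
  have a single element each.
\<close>

definition enc_nat :: "nat \<Rightarrow> ('m + 'a) list" where
  "enc_nat n = replicate n (Inl undefined) @ [Inr undefined]"

lemma enc_nat_prefix: "enc_nat n @ r = enc_nat n' @ r' \<Longrightarrow> n = n' \<and> r = r'"
proof (induction n arbitrary: n')
  case 0
  then show ?case by (cases n') (auto simp: enc_nat_def)
next
  case (Suc n)
  then show ?case by (cases n') (auto simp: enc_nat_def)
qed

definition enc_entry :: "(('m + 'a) list \<times> bool) \<times> 'a \<Rightarrow> ('m + 'a) list" where
  "enc_entry e = (if snd (fst e) then Inl undefined else Inr undefined) # Inr (snd e) # fst (fst e)"

text \<open>
  A prefix code: the numbers of entries precede the entries, so that the word determines where each
  part ends.
\<close>

primrec enc_cell :: "('m, 'a) cell \<Rightarrow> ('m + 'a) list" where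
  "enc_cell (Cell m l m' l' a p i) = Inl m # Inl m' # Inr a # enc_nat (to_nat p) @ enc_nat (to_nat i) @
     enc_nat (length l) @ enc_nat (length l') @
     concat (map enc_entry (map (map_prod (map_prod enc_cell id) id) l)) @
     concat (map enc_entry (map (map_prod (map_prod enc_cell id) id) l'))"

lemma concat_map_prefix:
  assumes "\<And>x y r r'. x \<in> set l \<Longrightarrow> f x @ r = f y @ r' \<Longrightarrow> x = y \<and> r = r'"
    and "length l = length l'" "concat (map f l) @ r = concat (map f l') @ r'"
  shows "l = l' \<and> r = r'"
  using assms(2,1,3)
proof (induction l l' rule: list_induct2)
  case (Cons x l y l')
  have "f x @ (concat (map f l) @ r) = f y @ (concat (map f l') @ r')" using Cons.prems(2) by simp
  then have "x = y" "concat (map f l) @ r = concat (map f l') @ r'"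
    using Cons.prems(1)[of x] by (meson list.set_intros(1))+
  then show ?case using Cons.IH Cons.prems(1) by (metis list.set_intros(2))
qed simp

lemma enc_cell_prefix: "enc_cell c @ r = enc_cell c' @ r' \<Longrightarrow> c = c' \<and> r = r'"
proof (induction c arbitrary: c' r r')
  case (Cell m l m' l' a p i)
  let ?f = "\<lambda>e. enc_entry (map_prod (map_prod enc_cell id) id e)"
  obtain n k n' k' b q i' where c': "c' = Cell n k n' k' b q i'" by (cases c')
  have entry: "e = e' \<and> s = s'"
    if IH: "\<And>s s' c'. enc_cell (fst (fst e)) @ s = enc_cell c' @ s' \<Longrightarrow> fst (fst e) = c' \<and> s = s'"
      and eq: "?f e @ s = ?f e' @ s'"
    for e e' :: "(('a, 'b) cell \<times> bool) \<times> 'b" and s s'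
  proof -
    have "snd (fst e) = snd (fst e')" "snd e = snd e'"
      "enc_cell (fst (fst e)) @ s = enc_cell (fst (fst e')) @ s'"
      using eq by (auto simp: enc_entry_def split: if_splits)
    then show ?thesis using IH by (auto simp: prod_eq_iff)
  qed
  have el: "e = e' \<and> s = s'" if "e \<in> set l" "?f e @ s = ?f e' @ s'" for e e' s s'
    using that(2) by (rule entry[rotated]) (rule Cell.IH(1)[OF that(1)], auto simp: fsts.simps)
  have el': "e = e' \<and> s = s'" if "e \<in> set l'" "?f e @ s = ?f e' @ s'" for e e' s s'
    using that(2) by (rule entry[rotated]) (rule Cell.IH(2)[OF that(1)], auto simp: fsts.simps)
  have eq: "m = n" "m' = n'" "a = b" and
    1: "enc_nat (to_nat p) @ enc_nat (to_nat i) @ enc_nat (length l) @ enc_nat (length l') @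
       concat (map ?f l) @ concat (map ?f l') @ r =
     enc_nat (to_nat q) @ enc_nat (to_nat i') @ enc_nat (length k) @ enc_nat (length k') @
       concat (map ?f k) @ concat (map ?f k') @ r'"
    using Cell.prems unfolding c' by (simp_all add: comp_def)
  from enc_nat_prefix[OF 1] have p: "p = q" and
    2: "enc_nat (to_nat i) @ enc_nat (length l) @ enc_nat (length l') @
       concat (map ?f l) @ concat (map ?f l') @ r =
     enc_nat (to_nat i') @ enc_nat (length k) @ enc_nat (length k') @
       concat (map ?f k) @ concat (map ?f k') @ r'" by simp_all
  from enc_nat_prefix[OF 2] have i: "i = i'" and
    3: "enc_nat (length l) @ enc_nat (length l') @ concat (map ?f l) @ concat (map ?f l') @ r =
     enc_nat (length k) @ enc_nat (length k') @ concat (map ?f k) @ concat (map ?f k') @ r'"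
    by simp_all
  from enc_nat_prefix[OF 3] have ll: "length l = length k" and
    4: "enc_nat (length l') @ concat (map ?f l) @ concat (map ?f l') @ r =
     enc_nat (length k') @ concat (map ?f k) @ concat (map ?f k') @ r'" by simp_all
  from enc_nat_prefix[OF 4] have ll': "length l' = length k'" and
    5: "concat (map ?f l) @ concat (map ?f l') @ r = concat (map ?f k) @ concat (map ?f k') @ r'"
    by simp_all
  have l: "l = k" and 6: "concat (map ?f l') @ r = concat (map ?f k') @ r'"
    using concat_map_prefix[OF el ll 5] by simp_all
  have "l' = k' \<and> r = r'" by (rule concat_map_prefix[OF el' ll' 6])
  then show ?case using c' eq p i l by simp
qed

lemma inj_enc_cell: "inj enc_cell"
  using enc_cell_prefix[of _ "[]" _ "[]"] by (auto simp: inj_def)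

text \<open>
  An element of the extension is itself the cycle part of a cell, whose word encodes it; the other fields of
  that cell are filled in arbitrarily.  A singleton turns the word into a set of words.
\<close>

lemma free_ext_encodable:
  fixes A :: "('k, 'a) dg_algebra" and M :: "('a, 'm) dg_module"
    and gdeg :: "('m, 'a) cell \<times> bool \<Rightarrow> int"
  shows "\<exists>h :: _ \<Rightarrow> ('m + 'a) list set. inj_on h (carrier (free_ext A M gdeg d G))"
proof -
  let ?E = "free_ext A M gdeg d G"
  define rep where "rep x = (SOME l. coeffs_elem A (fst x) l = x)" for x :: "'m \<times> (('m, 'a) cell \<times> bool \<Rightarrow> 'a)"
  have rep: "coeffs_elem A (fst x) (rep x) = x" if "x \<in> carrier ?E" for x
    unfolding rep_def by (rule someI_ex[OF coeffs_elem_surj[OF that]])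
  let ?h = "\<lambda>x. {enc_cell (Cell (fst x) (rep x) (fst x) [] undefined 0 0)}"
  have "inj_on ?h (carrier ?E)"
  proof (rule inj_onI)
    fix x y assume x: "x \<in> carrier ?E" and y: "y \<in> carrier ?E" and eq: "?h x = ?h y"
    have "Cell (fst x) (rep x) (fst x) [] undefined 0 0 = Cell (fst y) (rep y) (fst y) [] undefined 0 0"
      by (rule injD[OF inj_enc_cell singleton_inject[OF eq]])
    then have "fst x = fst y" "rep x = rep y" by simp_all
    then have "coeffs_elem A (fst x) (rep x) = coeffs_elem A (fst y) (rep y)" by (simp only:)
    then show "x = y" unfolding rep[OF x] rep[OF y] .
  qed
  then show ?thesis by blast
qed

section \<open>Realisability of localisations\<close>

lemma whole_module_submodule:
  assumes "graded_right_module R N (rdeg R)" shows "graded_submodule R N (carrier N)"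
proof -
  interpret N: graded_right_module R N "rdeg R" by fact
  interpret G: graded_group N "mdeg N" by (rule N.graded_group_M)
  have "additive_subgroup (carrier N) N" by (rule N.M.additive_subgroupI_add) auto
  moreover have "homogeneous_subset N (mdeg N) (carrier N)"
    unfolding homogeneous_subset_def
  proof
    fix x assume "x \<in> carrier N"
    from G.hom_decomp_component[OF this]
    have "hom_decomp N (\<lambda>n. mdeg N n \<inter> carrier N) x (\<lambda>n. G.cp n x)"
      using G.degree_carrier by (auto simp: hom_decomp_def)
    then show "\<exists>f. hom_decomp N (\<lambda>n. mdeg N n \<inter> carrier N) x f" by blast
  qed
  ultimately show ?thesis using N.ract_closed by (simp add: graded_submodule_def)
qed

lemma restrict_whole_module:
  assumes "graded_right_module R N (rdeg R)"
  shows "restrict_module N (carrier N) = N"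
proof -
  interpret N: graded_right_module R N "rdeg R" by fact
  interpret G: graded_group N "mdeg N" by (rule N.graded_group_M)
  have "(\<lambda>n. mdeg N n \<inter> carrier N) = mdeg N" using G.degree_carrier by auto
  then show ?thesis by (simp add: restrict_module_def)
qed

theorem lemma11p3:
  fixes K :: "('k, 'l) ring_scheme"
    and A :: "('k, 'a) dg_algebra"
    and P :: "'a set set"
    and X :: "('a set, 'x) graded_module"
  assumes "dg_algebra K A"
    and "graded_commutative (cohom_ring A)"
    and "graded_prime_ideal P (cohom_ring A)"
    and "is_graded_module (cohom_ring A) X"
  shows "(realisable TYPE('m) A X \<longrightarrow>
            realisable TYPE(('m + 'a) list set) A (localise (cohom_ring A) P X)) \<and>
         (strictly_realisable TYPE('m) A X \<longrightarrow>
            strictly_realisable TYPE(('m + 'a) list set) A (localise (cohom_ring A) P X))"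
proof -
  let ?R = "cohom_ring A" and ?S = "even_complement (cohom_ring A) P"
  let ?XP = "localise (cohom_ring A) P X"
  have prime: "graded_prime K A P"
    using assms by (intro graded_prime.intro graded_prime_axioms.intro dga.intro)
  have X: "graded_right_module ?R X (rdeg ?R)" using assms(4) by (simp add: is_graded_module_def)
  have local: "\<exists>(N :: ('a, ('m + 'a) list set) dg_module) \<iota>. dg_right_module A N \<and>
      localisation_map ?R (cohom_module M) (cohom_module N) ?S \<iota>"
    if M: "dg_right_module A M" for M :: "('a, 'm) dg_module"
  proof -
    have "dg_module_over K A M" using assms(1) M by (intro dg_module_over.intro dga.intro)
    then obtain N :: "('a, 'm \<times> (('m, 'a) cell \<times> bool \<Rightarrow> 'a)) dg_module"
        and h :: "_ \<Rightarrow> ('m + 'a) list set"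
      where N: "homotopy_localisation K A P M N (base_elem A)" and h: "inj_on h (carrier N)"
      using homotopy_localisation_exists[OF prime] free_ext_encodable by metis
    let ?N = "transported h N" and ?j = "\<lambda>x. h (base_elem A x)"
    interpret H: homotopy_localisation K A P M ?N ?j
      by (rule homotopy_localisation.transport_localisation[OF N h])
    show ?thesis using H.localisation_map_induced H.M1.Mod.dg_right_module_axioms by blast
  qed
  have iso: "\<exists>\<phi>. \<phi> \<in> graded_iso ?R ?XP
      (restrict_module (cohom_module N) (localisation_map.saturation (cohom_module N) ?S \<iota> U))"
    if "localisation_map ?R (cohom_module M) (cohom_module N) ?S \<iota>"
      "graded_submodule ?R (cohom_module M) U"
      "\<theta> \<in> graded_iso ?R X (restrict_module (cohom_module M) U)"
    for M :: "('a, 'm) dg_module" and N :: "('a, ('m + 'a) list set) dg_module" and \<iota> U \<theta>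
    using localised_fractions.localise_iso[OF localised_fractions.intro[OF that(1) X
          localised_fractions_axioms.intro[OF refl that(2,3)]]] by blast
  have "realisable TYPE(('m + 'a) list set) A ?XP" if r: "realisable TYPE('m) A X"
  proof -
    obtain M :: "('a, 'm) dg_module" and U \<theta> where M: "dg_right_module A M"
      and U: "direct_summand ?R (cohom_module M) U"
      and \<theta>: "\<theta> \<in> graded_iso ?R X (restrict_module (cohom_module M) U)"
      using r unfolding realisable_def graded_isomorphic_def by blast
    obtain N :: "('a, ('m + 'a) list set) dg_module" and \<iota> where N: "dg_right_module A N"
      and \<iota>: "localisation_map ?R (cohom_module M) (cohom_module N) ?S \<iota>"
      using local[OF M] by blast
    show ?thesis
      unfolding realisable_def graded_isomorphic_def
      using N localisation_map.saturation_summand[OF \<iota> U] iso[OF \<iota> _ \<theta>] U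
      unfolding direct_summand_def[of ?R "cohom_module M"] by blast
  qed
  moreover have "strictly_realisable TYPE(('m + 'a) list set) A ?XP"
    if r: "strictly_realisable TYPE('m) A X"
  proof -
    obtain M :: "('a, 'm) dg_module" and \<theta> where M: "dg_right_module A M"
      and \<theta>: "\<theta> \<in> graded_iso ?R X (cohom_module M)"
      using r unfolding strictly_realisable_def graded_isomorphic_def by blast
    obtain N :: "('a, ('m + 'a) list set) dg_module" and \<iota> where N: "dg_right_module A N"
      and \<iota>: "localisation_map ?R (cohom_module M) (cohom_module N) ?S \<iota>"
      using local[OF M] by blast
    note gr = localisation_map.axioms(1,2)[OF \<iota>]
    have "\<exists>\<phi>. \<phi> \<in> graded_iso ?R ?XP (cohom_module N)"
      using iso[OF \<iota> whole_module_submodule[OF gr(1)], of \<theta>] \<theta>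
      unfolding localisation_map.saturation_carrier[OF \<iota>] restrict_whole_module[OF gr(1)]
        restrict_whole_module[OF gr(2)] by blast
    then show ?thesis using N unfolding strictly_realisable_def graded_isomorphic_def by blast
  qed
  ultimately show ?thesis by blast
qed

end
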